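(* Consider latent Dirichlet allocation with $K$ topics, vocabulary size $V$, $D$ documents and $N$ words per document, with the priors and the mean-field $\alpha$-VB solution $\widehat q_\theta$ described in the context, $\alpha\in(0,1)$ fixed, and true parameter $\theta^\ast=(\{\gamma^\ast_d\},\{\beta^\ast_k\})$. Assume: for each $k$, $\beta^\ast_k$ is $d_k$-sparse with $d_k\ll V$, and for each $d$, $\gamma^\ast_d$ is $e_d$-sparse with $e_d\ll K$; moreover, there exists a constant $\delta_0>0$ such that each nonzero component of $\beta^\ast_k$ or $\gamma^\ast_d$ is at least $\delta_0$. Then for any $\varepsilon_\gamma=(\varepsilon_{\gamma_1},\dots,\varepsilon_{\gamma_D})$ and $\varepsilon_\beta=(\varepsilon_{\beta_1},\dots,\varepsilon_{\beta_K})$, it holds with probability at least $1-C/\big(N\sum_{d=1}^D\varepsilon_{\gamma_d}^2+N\sum_{k=1}^K\varepsilon_{\beta_k}^2\big)$, for some constant $C>0$, that $$\int\Big\{D^{-1}\,D_\alpha\big[p(\cdot\mid\theta)\,\|\,p(\cdot\mid\theta^\ast)\big]\Big\}\,\widehat q_\theta(\theta)\,d\theta\ \lesssim\ \frac{\alpha}{1-\alpha}\bigg\{\frac1D\sum_{d=1}^D\varepsilon_{\gamma_d}^2+\frac1D\sum_{k=1}^K\varepsilon_{\beta_k}^2\bigg\}+\frac{1}{N(1-\alpha)}\bigg\{\frac1D\sum_{d=1}^De_d\log\frac{K}{\varepsilon_{\gamma_d}}+\frac1D\sum_{k=1}^Kd_k\log\frac{V}{\varepsilon_{\beta_k}}\bigg\}.$$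 Therefore, if $\big(\sum_{d=1}^De_d+\sum_{k=1}^Kd_k\big)/(DN)\to0$ as $N\to\infty$, then it holds with probability tending to one as $N\to\infty$ that $$\bigg\{\int D^{-1}\,h^2\big[p(\cdot\mid\theta)\,\|\,p(\cdot\mid\theta^\ast)\big]\,\widehat q_\theta(\theta)\,d\theta\bigg\}^{1/2}\ \lesssim\ \sqrt{\frac{\sum_{d=1}^De_d}{DN\,\min\{\alpha,1-\alpha\}}\log(DKN)+\frac{\sum_{k=1}^Kd_k}{DN\,\min\{\alpha,1-\alpha\}}\log(KVN)}.$$
   Context: Model. Each topic $k=1,\dots,K$ has a word distribution $\beta_k$ in the $V$-dimensional probability simplex; each document $d=1,\dots,D$ has topic proportions $\gamma_d$ in the $K$-dimensional probability simplex. For each $d$ and each word $n=1,\dots,N$, independently, a topic $z_{dn}\in\{1,\dots,K\}$ is drawn from the categorical distribution $\gamma_d$, and then a word $w_{dn}\in\{1,\dots,V\}$ is drawn from the categorical distribution $\beta_{z_{dn}}$. The parameter is $\theta=(\pi,\mu)$ with $\pi=\{\gamma_d\}_{d=1}^D$, $\mu=\{\beta_k\}_{k=1}^K$. The sample size is $N$: the observations are $Y_n=(w_{dn})_{d=1}^D$, $n=1,\dots,N$ (i.i.d. in $n$), and the latent variables are $S_n=(z_{dn})_{d=1}^D$. $p(\cdot\mid\theta)$ is the probability mass function of a single $Y_n$, i.e. $p(Y_n\mid\theta)=\prod_{d=1}^Dp_d(w_{dn}\mid\theta)$, $p_d(w\mid\theta)=\sum_{k}\gamma_{d,k}\beta_{k,w}$,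 so that $D_\alpha[p(\cdot\mid\theta)\|p(\cdot\mid\theta^\ast)]=\sum_{d=1}^DD_\alpha[p_d(\cdot\mid\theta)\|p_d(\cdot\mid\theta^\ast)]$. Probability is under the law of $Y^N=(Y_1,\dots,Y_N)$ at $\theta^\ast$. Prior. Independent symmetric Dirichlet priors $\beta_k\sim\mathrm{Dir}_V(\eta_\beta)$ and $\gamma_d\sim\mathrm{Dir}_K(\eta_\gamma)$, with $\eta_\beta=1/V^{c}$ and $\eta_\gamma=1/K^{c}$ (all Dirichlet parameters equal to this value) for some fixed $c>1$; the joint prior density is $p_\theta$. Variational solution. The family $\Gamma$ consists of all $q(\mu,\pi,s^N)=q_\theta(\theta)\,q_{S^N}(s^N)$ with $q_\theta=\prod_{k=1}^Kq_{\beta_k}(\beta_k)\prod_{d=1}^Dq_{\gamma_d}(\gamma_d)$ and $q_{S^N}=\prod_{d=1}^D\prod_{n=1}^Nq_{z_{dn}}(z_{dn})$, with otherwise arbitrary factors. $(\widehat q_\theta,\widehat q_{S^N})$ is a (data-dependent) minimizer, assumed to exist, over $\Gamma$ of $$-\int\sum_{s^N}q_{S^N}(s^N)\log\frac{\prod_{n=1}^N\prod_{d=1}^D\gamma_{d,z_{dn}}\,\beta_{z_{dn},w_{dn}}}{q_{S^N}(s^N)\,\prod_{n=1}^Np(Y_n\mid\theta^\ast)}\,q_\theta(d\theta)+\alpha^{-1}D(q_\theta\,\|\,p_\theta),$$ with $s^N=(z_{dn})$ and $D(\cdot\|\cdot)$ the KL divergence (the plain symbol $D$ is the number of documents). Notation.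 $D_\alpha(p\|q)=\frac{1}{\alpha-1}\log\int p^\alpha q^{1-\alpha}d\mu$, $h(p\|q)=(\int(p^{1/2}-q^{1/2})^2d\mu)^{1/2}$. A vector is $m$-sparse if it has $m$ nonzero components. The components of $\varepsilon_\gamma,\varepsilon_\beta$ are in $(0,1)$. $\lesssim$ denotes inequality up to a positive multiplicative constant not depending on $N,D,K,V$, the sparsity levels, $\varepsilon_\gamma,\varepsilon_\beta$ or $\alpha$. *)

theory Defs
  imports "HOL-Probability.Probability"
begin

text \<open>
  Topics, words, documents and sample points are indexed by \<open>{..<K}\<close>, \<open>{..<V}\<close>, \<open>{..<D}\<close> and
  \<open>{..<N}\<close>. A parameter is \<open>\<theta> = (\<gamma>, \<beta>)\<close>, with \<open>\<gamma> d k\<close> the proportion of topic \<open>k\<close> in document \<open>d\<close>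
  and \<open>\<beta> k v\<close> the probability of word \<open>v\<close> under topic \<open>k\<close>. Data \<open>w\<close> and latent variables \<open>s\<close> are
  curried, \<open>w n d\<close> and \<open>s n d\<close>, so that \<open>w n\<close> is the observation \<open>Y\<^sub>n\<close> and \<open>s n\<close> is \<open>S\<^sub>n\<close>.
\<close>

type_synonym lda_param = "(nat \<Rightarrow> nat \<Rightarrow> real) \<times> (nat \<Rightarrow> nat \<Rightarrow> real)"

definition prob_simplex :: "nat \<Rightarrow> (nat \<Rightarrow> real) set" where
  "prob_simplex n = {x. (\<forall>i<n. 0 \<le> x i) \<and> (\<Sum>i<n. x i) = 1}"

definition m_sparse :: "nat \<Rightarrow> nat \<Rightarrow> (nat \<Rightarrow> real) \<Rightarrow> bool" where
  "m_sparse n m x \<longleftrightarrow> card {i. i < n \<and> x i \<noteq> 0} = m"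


section \<open>Divergences\<close>

text \<open>
  For \<open>0 < \<alpha> < 1\<close> the integral vanishes exactly when the two distributions are mutually singular,
  and then the divergence is infinite (\<^const>\<open>ln\<close> would return 0 there).
\<close>
definition renyi_div :: "'a measure \<Rightarrow> real \<Rightarrow> ('a \<Rightarrow> real) \<Rightarrow> ('a \<Rightarrow> real) \<Rightarrow> ennreal" where
  "renyi_div \<mu> \<alpha> p q =
     (let I = (LINT x|\<mu>. p x powr \<alpha> * q x powr (1 - \<alpha>))
      in if I = 0 then \<infinity> else ennreal (1 / (\<alpha> - 1) * ln I))"

definition hellinger :: "'a measure \<Rightarrow> ('a \<Rightarrow> real) \<Rightarrow> ('a \<Rightarrow> real) \<Rightarrow> real" where
  "hellinger \<mu> p q = sqrt (LINT x|\<mu>. (p x powr (1/2) - q x powr (1/2))\<^sup>2)"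

text \<open>
  \<open>kl Q P\<close> is \<open>D(Q \<parallel> P)\<close> (\<^const>\<open>KL_divergence\<close> takes its arguments in the opposite order). For
  probability measures the negative part of the log-density is always \<open>Q\<close>-integrable, so a
  non-integrable log-density means that the divergence is infinite.
\<close>
definition kl :: "'a measure \<Rightarrow> 'a measure \<Rightarrow> ereal" where
  "kl Q P = (if absolutely_continuous P Q \<and> integrable Q (entropy_density (exp 1) P Q)
             then ereal (KL_divergence (exp 1) P Q) else \<infinity>)"


section \<open>The model\<close>

text \<open>Only meaningful for \<open>p \<in> prob_simplex n\<close>.\<close>
definition categorical :: "nat \<Rightarrow> (nat \<Rightarrow> real) \<Rightarrow> nat pmf" where
  "categorical n p = embed_pmf (\<lambda>i. if i < n then p i else 0)"

definition word_law :: "nat \<Rightarrow> nat \<Rightarrow> lda_param \<Rightarrow> nat \<Rightarrow> nat pmf" where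
  "word_law K V \<theta> d = bind_pmf (categorical K (fst \<theta> d)) (\<lambda>z. categorical V (snd \<theta> z))"

definition obs_law :: "nat \<Rightarrow> nat \<Rightarrow> nat \<Rightarrow> lda_param \<Rightarrow> (nat \<Rightarrow> nat) pmf" where
  "obs_law D K V \<theta> = Pi_pmf {..<D} undefined (word_law K V \<theta>)"

definition data_law :: "nat \<Rightarrow> nat \<Rightarrow> nat \<Rightarrow> nat \<Rightarrow> lda_param \<Rightarrow> (nat \<Rightarrow> nat \<Rightarrow> nat) pmf" where
  "data_law D K V N \<theta> = Pi_pmf {..<N} undefined (\<lambda>_. obs_law D K V \<theta>)"

text \<open>The mass function \<open>p(\<cdot> | \<theta>)\<close> of a single observation \<open>Y\<^sub>n\<close>, as a formula in \<open>\<theta>\<close>.\<close>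
definition obs_mass :: "nat \<Rightarrow> nat \<Rightarrow> lda_param \<Rightarrow> (nat \<Rightarrow> nat) \<Rightarrow> real" where
  "obs_mass D K \<theta> y = (\<Prod>d<D. \<Sum>k<K. fst \<theta> d k * snd \<theta> k (y d))"

definition obs_count :: "nat \<Rightarrow> nat \<Rightarrow> (nat \<Rightarrow> nat) measure" where
  "obs_count D V = count_space ({..<D} \<rightarrow>\<^sub>E {..<V})"

lemma pmf_categorical:
  assumes "p \<in> prob_simplex n"
  shows "pmf (categorical n p) i = (if i < n then p i else 0)"
  unfolding categorical_def
proof (rule pmf_embed_pmf)
  show "\<And>x. 0 \<le> (if x < n then p x else 0)"
    using assms by (auto simp: prob_simplex_def)
  have "(\<integral>\<^sup>+ x. ennreal (if x < n then p x else 0) \<partial>count_space UNIV) =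
        (\<Sum>x<n. ennreal (if x < n then p x else 0))"
    by (rule nn_integral_count_space') auto
  also have "\<dots> = ennreal (\<Sum>x<n. p x)"
    using assms by (subst sum_ennreal[symmetric]) (auto simp: prob_simplex_def intro!: sum.cong)
  finally show "(\<integral>\<^sup>+ x. ennreal (if x < n then p x else 0) \<partial>count_space UNIV) = 1"
    using assms by (simp add: prob_simplex_def)
qed

lemma pmf_obs_law:
  assumes \<gamma>: "\<And>d. d < D \<Longrightarrow> fst \<theta> d \<in> prob_simplex K"
    and \<beta>: "\<And>k. k < K \<Longrightarrow> snd \<theta> k \<in> prob_simplex V"
    and y: "y \<in> {..<D} \<rightarrow>\<^sub>E {..<V}"
  shows "pmf (obs_law D K V \<theta>) y = obs_mass D K \<theta> y"
proof -
  have "pmf (word_law K V \<theta> d) (y d) = (\<Sum>k<K. fst \<theta> d k * snd \<theta> k (y d))" if d: "d < D" for d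
  proof -
    have yd: "y d < V" using y d by auto
    have "pmf (word_law K V \<theta> d) (y d) =
        (\<Sum>k<K. pmf (categorical V (snd \<theta> k)) (y d) * pmf (categorical K (fst \<theta> d)) k)"
      unfolding word_law_def pmf_bind
      by (rule integral_measure_pmf_real)
         (auto simp: set_pmf_eq pmf_categorical[OF \<gamma>[OF d]] split: if_splits)
    also have "\<dots> = (\<Sum>k<K. fst \<theta> d k * snd \<theta> k (y d))"
      by (rule sum.cong) (auto simp: pmf_categorical[OF \<gamma>[OF d]] pmf_categorical[OF \<beta>] yd)
    finally show ?thesis .
  qed
  moreover have "\<forall>d. d \<notin> {..<D} \<longrightarrow> y d = undefined" using y by (auto simp: PiE_def extensional_def)
  ultimately show ?thesis
    unfolding obs_law_def obs_mass_def by (subst pmf_Pi) auto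
qed


section \<open>The prior\<close>

definition simplex_coords :: "nat \<Rightarrow> (nat \<Rightarrow> real) measure" where
  "simplex_coords n = (\<Pi>\<^sub>M i\<in>{..<n}. borel)"

text \<open>The point of the simplex with given first \<open>n - 1\<close> coordinates.\<close>
definition simplex_point :: "nat \<Rightarrow> (nat \<Rightarrow> real) \<Rightarrow> nat \<Rightarrow> real" where
  "simplex_point n x = (\<lambda>i\<in>{..<n}. if i < n - 1 then x i else 1 - (\<Sum>j<n - 1. x j))"

definition dirichlet_density :: "nat \<Rightarrow> real \<Rightarrow> (nat \<Rightarrow> real) \<Rightarrow> real" where
  "dirichlet_density n \<eta> p =
     (if \<forall>i<n. 0 < p i
      then Gamma (real n * \<eta>) / Gamma \<eta> ^ n * (\<Prod>i<n. p i powr (\<eta> - 1)) else 0)"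

text \<open>
  The symmetric Dirichlet distribution: its density refers to Lebesgue measure in the first
  \<open>n - 1\<close> coordinates. For \<open>n = 1\<close> it is the point mass at the only point of the simplex.
\<close>
definition dirichlet :: "nat \<Rightarrow> real \<Rightarrow> (nat \<Rightarrow> real) measure" where
  "dirichlet n \<eta> =
     distr (density (\<Pi>\<^sub>M i\<in>{..<n - 1}. lborel)
                    (\<lambda>x. ennreal (dirichlet_density n \<eta> (simplex_point n x))))
           (simplex_coords n) (simplex_point n)"

definition lda_prior :: "real \<Rightarrow> nat \<Rightarrow> nat \<Rightarrow> nat \<Rightarrow> lda_param measure" where
  "lda_prior c D K V =
     (\<Pi>\<^sub>M d\<in>{..<D}. dirichlet K (1 / real K powr c)) \<Otimes>\<^sub>M
     (\<Pi>\<^sub>M k\<in>{..<K}. dirichlet V (1 / real V powr c))"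


section \<open>The variational problem\<close>

definition simplex_law :: "nat \<Rightarrow> (nat \<Rightarrow> real) measure \<Rightarrow> bool" where
  "simplex_law n q \<longleftrightarrow>
     prob_space q \<and> sets q = sets (simplex_coords n) \<and> (AE x in q. x \<in> prob_simplex n)"

definition mean_field ::
  "nat \<Rightarrow> nat \<Rightarrow> nat \<Rightarrow> nat \<Rightarrow> (lda_param measure \<times> (nat \<Rightarrow> nat \<Rightarrow> nat) pmf) set" where
  "mean_field D K V N =
     {((\<Pi>\<^sub>M d\<in>{..<D}. q\<gamma> d) \<Otimes>\<^sub>M (\<Pi>\<^sub>M k\<in>{..<K}. q\<beta> k),
       Pi_pmf {..<N} undefined (\<lambda>n. Pi_pmf {..<D} undefined (qz n))) | q\<gamma> q\<beta> qz.
      (\<forall>d<D. simplex_law K (q\<gamma> d)) \<and> (\<forall>k<K. simplex_law V (q\<beta> k)) \<and>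
      (\<forall>n<N. \<forall>d<D. set_pmf (qz n d) \<subseteq> {..<K})}"

text \<open>The logarithm with \<open>log 0 = - \<infinity>\<close>; in \<^typ>\<open>ereal\<close>, \<open>0 * log 0 = 0\<close>.\<close>
definition eln :: "real \<Rightarrow> ereal" where
  "eln x = (if 0 < x then ereal (ln x) else - \<infinity>)"

text \<open>
  The extended Lebesgue integral of a function whose positive or negative part is integrable.
\<close>
definition ext_integral :: "'a measure \<Rightarrow> ('a \<Rightarrow> ereal) \<Rightarrow> ereal" where
  "ext_integral M f =
     enn2ereal (\<integral>\<^sup>+ x. e2ennreal (f x) \<partial>M) - enn2ereal (\<integral>\<^sup>+ x. e2ennreal (- f x) \<partial>M)"

definition vb_objective ::
  "real \<Rightarrow> real \<Rightarrow> nat \<Rightarrow> nat \<Rightarrow> nat \<Rightarrow> nat \<Rightarrow> lda_param \<Rightarrow> (nat \<Rightarrow> nat \<Rightarrow> nat) \<Rightarrow>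
   lda_param measure \<times> (nat \<Rightarrow> nat \<Rightarrow> nat) pmf \<Rightarrow> ereal" where
  "vb_objective c \<alpha> D K V N \<theta>s w = (\<lambda>(q\<theta>, qS).
     - ext_integral q\<theta> (\<lambda>(\<gamma>, \<beta>).
         \<Sum>s \<in> {..<N} \<rightarrow>\<^sub>E {..<D} \<rightarrow>\<^sub>E {..<K}.
           ereal (pmf qS s) *
           eln ((\<Prod>n<N. \<Prod>d<D. \<gamma> d (s n d) * \<beta> (s n d) (w n d)) /
                (pmf qS s * (\<Prod>n<N. obs_mass D K \<theta>s (w n)))))
     + ereal (1 / \<alpha>) * kl q\<theta> (lda_prior c D K V))"

text \<open>
  A data-dependent minimizer over the mean-field family. Data sets of probability zero, where the
  objective is not defined because it divides by \<open>p(Y\<^sub>n | \<theta>\<^sup>*) = 0\<close>, are not constrained.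
\<close>
definition vb_solution ::
  "real \<Rightarrow> real \<Rightarrow> nat \<Rightarrow> nat \<Rightarrow> nat \<Rightarrow> nat \<Rightarrow> lda_param \<Rightarrow>
   ((nat \<Rightarrow> nat \<Rightarrow> nat) \<Rightarrow> lda_param measure \<times> (nat \<Rightarrow> nat \<Rightarrow> nat) pmf) \<Rightarrow> bool" where
  "vb_solution c \<alpha> D K V N \<theta>s qhat \<longleftrightarrow>
     (\<forall>w \<in> set_pmf (data_law D K V N \<theta>s).
        is_arg_min (vb_objective c \<alpha> D K V N \<theta>s w) (\<lambda>q. q \<in> mean_field D K V N) (qhat w))"


section \<open>The sparse truth\<close>

text \<open>
  The informal \<open>d\<^sub>k \<lless> V\<close> and \<open>e\<^sub>d \<lless> K\<close> are read as the weakest condition they can express,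
  strict inequality.
\<close>
definition sparse_truth ::
  "real \<Rightarrow> nat \<Rightarrow> nat \<Rightarrow> nat \<Rightarrow> lda_param \<Rightarrow> (nat \<Rightarrow> nat) \<Rightarrow> (nat \<Rightarrow> nat) \<Rightarrow> bool" where
  "sparse_truth \<delta>0 D K V \<theta>s e d \<longleftrightarrow>
     (\<forall>j<D. fst \<theta>s j \<in> prob_simplex K \<and> m_sparse K (e j) (fst \<theta>s j) \<and> e j < K \<and>
            (\<forall>k<K. fst \<theta>s j k \<noteq> 0 \<longrightarrow> \<delta>0 \<le> fst \<theta>s j k)) \<and>
     (\<forall>k<K. snd \<theta>s k \<in> prob_simplex V \<and> m_sparse V (d k) (snd \<theta>s k) \<and> d k < V \<and>
            (\<forall>v<V. snd \<theta>s k v \<noteq> 0 \<longrightarrow> \<delta>0 \<le> snd \<theta>s k v))"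

end

theory Submission
  imports Defs
begin

text \<open>
  Markov's inequality controls the prior average of
  \<open>(p(w | \<theta>) / p(w | \<theta>s)) ^ \<alpha> / I(\<theta>) ^ N\<close>, where \<open>I(\<theta>)\<close> is the \<open>\<alpha>\<close>-affinity of one observation,
  because its expectation under the truth is at most 1. On that event the change of measure
  (Donsker--Varadhan) inequality bounds the average over the variational solution of \<open>- N * ln I(\<theta>)\<close>, i.e. of the Renyi
  divergence, by \<open>\<alpha>\<close> times the variational objective of the solution, hence by that of any
  competitor. The competitor is the prior conditioned on the lower bounds
  \<open>\<gamma> d k \<ge> \<gamma>s d k * exp (- \<rho> d)\<close> and \<open>\<beta> k v \<ge> \<beta>s k v * exp (- \<sigma> k)\<close>, with the exact posterior of the
  topics under the truth; these one-sided bounds constrain only the support of the sparse truth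
  and control the likelihood ratio for every data set.
\<close>

section \<open>Beta integrals and the Dirichlet distribution\<close>

text \<open>The rate m * ln n, instead of n * ln n, for an m-sparse point of the n-simplex rests on
  \<eta> = n^(-c) with c > 1. The normalizing constant of the Dirichlet density is at least \<eta>^n
  / 4, and each of the n - m zero coordinates, confined to (0, t), returns a factor t^\<eta> /
  \<eta>. The powers of \<eta> cancel down to \<eta>^m, and the product of the factors t^\<eta> is
  at least t because n * \<eta> \<le> 1. All zero coordinates together thus cost no more than the
  single factor t. A neighbourhood defined by closeness on average, such as a Kullback-Leibler ball,
  would call for a second random event on which the empirical log-likelihood of the competitor is
  controlled. Pointwise lower bounds on the parameters avoid it, so the event from Markov's
  inequality is the only exceptional one. At a fixed parameter the topics are independent given the
  words. The exact posterior under the truth is therefore a product over observations and documents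
  and belongs to the mean-field family, so factorizing the latent part loses nothing at the
  truth.\<close>

definition tpow :: "real \<Rightarrow> real \<Rightarrow> ennreal" where
  "tpow a t = ennreal (if 0 < t then t powr (a - 1) else 0)"

lemma tpow_measurable [measurable]: "tpow a \<in> borel_measurable borel"
  unfolding tpow_def by measurable

text \<open>\<open>tpow a\<close> is the power t^(a - 1) cut off to 0 for t \<le> 0. With the
  cut-off inside the function, Beta and Dirichlet integrals run over the whole space, without limits
  of integration.\<close>

lemma nn_integral_tpow_Beta:
  assumes "a > 0" "b > 0"
  shows "(\<integral>\<^sup>+y. tpow a y * tpow b (1 - y) \<partial>lborel) = ennreal (Beta a b)"
proof -
  have "(\<integral>\<^sup>+y. tpow a y * tpow b (1 - y) \<partial>lborel)
      = (\<integral>\<^sup>+y. ennreal (indicator {0..1} y * (y powr (a - 1) * (1 - y) powr (b - 1))) \<partial>lborel)"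
  proof (rule nn_integral_cong_AE, rule AE_I[where N = "{0, 1}"])
    show "{x \<in> space lborel. tpow a x * tpow b (1 - x) \<noteq>
        ennreal (indicator {0..1} x * (x powr (a - 1) * (1 - x) powr (b - 1)))} \<subseteq> {0, 1}"
      by (auto simp: tpow_def indicator_def ennreal_mult')
    show "emeasure lborel {0, 1::real} = 0"
      by (rule emeasure_lborel_countable) auto
  qed auto
  also have "\<dots> = ennreal (Beta a b)"
  proof (rule nn_integral_has_integral_lborel)
    have "((\<lambda>y. y powr (a - 1) * (1 - y) powr (b - 1)) has_integral Beta a b) {0..1}"
      using assms by (rule has_integral_Beta_real)
    then have "((\<lambda>y. if y \<in> {0..1} then y powr (a - 1) * (1 - y) powr (b - 1) else 0)
        has_integral Beta a b) UNIV"
      by (simp only: has_integral_restrict_UNIV)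
    also have "(\<lambda>y. if y \<in> {0..1} then y powr (a - 1) * (1 - y) powr (b - 1) else 0)
      = (\<lambda>y. indicator {0..1} y * (y powr (a - 1) * (1 - y) powr (b - 1)))"
      by (auto simp: indicator_def)
    finally show "((\<lambda>y. indicator {0..1} y * (y powr (a - 1) * (1 - y) powr (b - 1)))
        has_integral Beta a b) UNIV" .
  qed auto
  finally show ?thesis .
qed

text \<open>Homogeneity: the substitution y = s * u pulls out the powers of s and leaves the Beta
  integral. For s \<le> 0 the arguments y and s - y are never both positive, so the cut-offs make
  both sides 0.\<close>

lemma nn_integral_tpow_convolution:
  assumes ab: "a > 0" "b > 0"
  shows "(\<integral>\<^sup>+y. tpow a y * tpow b (s - y) \<partial>lborel) = ennreal (Beta a b) * tpow (a + b) s"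
proof (cases "s > 0")
  case True
  have sc: "tpow c (s * u) = ennreal (s powr (c - 1)) * tpow c u" for c u
    using True by (auto simp: tpow_def powr_mult ennreal_mult zero_less_mult_iff)
  have "(\<integral>\<^sup>+y. tpow a y * tpow b (s - y) \<partial>lborel)
      = ennreal \<bar>s\<bar> * (\<integral>\<^sup>+u. tpow a (0 + s * u) * tpow b (s - (0 + s * u)) \<partial>lborel)"
    using True by (subst nn_integral_real_affine[where c = s and t = 0]) auto
  also have "(\<lambda>u. tpow a (0 + s * u) * tpow b (s - (0 + s * u)))
      = (\<lambda>u. ennreal (s powr (a - 1) * s powr (b - 1)) * (tpow a u * tpow b (1 - u)))"
  proof
    fix u
    have "s - (0 + s * u) = s * (1 - u)" by (simp add: algebra_simps)
    then show "tpow a (0 + s * u) * tpow b (s - (0 + s * u))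
      = ennreal (s powr (a - 1) * s powr (b - 1)) * (tpow a u * tpow b (1 - u))"
      by (simp only: sc add_0) (simp add: ennreal_mult ac_simps)
  qed
  also have "ennreal \<bar>s\<bar> * (\<integral>\<^sup>+u. ennreal (s powr (a - 1) * s powr (b - 1)) *
        (tpow a u * tpow b (1 - u)) \<partial>lborel)
      = ennreal (s * (s powr (a - 1) * s powr (b - 1))) * ennreal (Beta a b)"
    using True by (simp add: nn_integral_cmult nn_integral_tpow_Beta[OF ab] ennreal_mult mult.assoc)
  also have "s * (s powr (a - 1) * s powr (b - 1)) = s powr (a + b - 1)"
    using True by (simp add: powr_diff powr_add)
  finally show ?thesis using True by (simp add: tpow_def mult.commute)
next
  case False
  then have "tpow a y * tpow b (s - y) = 0" for y by (auto simp: tpow_def)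
  then have "(\<integral>\<^sup>+y. tpow a y * tpow b (s - y) \<partial>lborel) = 0" by (simp only: nn_integral_const mult_zero_left)
  with False show ?thesis by (simp add: tpow_def)
qed

interpretation lborel_prod: product_sigma_finite "\<lambda>_::nat. lborel :: real measure"
  by standard

text \<open>Dirichlet's integral, one coordinate at a time. The exponent \<open>b\<close> is general
  because integrating a coordinate against the remaining slack is a convolution that turns
  \<open>b\<close> into \<open>\<eta> + b\<close>; the Beta factors telescope to the Gamma
  quotient.\<close>

lemma nn_integral_dirichlet_kernel:
  assumes "\<eta> > 0" "b > 0"
  shows "(\<integral>\<^sup>+x. (\<Prod>i<m. tpow \<eta> (x i)) * tpow b (1 - (\<Sum>i<m. x i)) \<partial>(\<Pi>\<^sub>M i\<in>{..<m}. lborel))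
    = ennreal (Gamma \<eta> ^ m * Gamma b / Gamma (real m * \<eta> + b))"
  using assms
proof (induction m arbitrary: b)
  case 0
  have "Gamma b \<noteq> 0" using Gamma_real_pos[of b] 0 by linarith
  then show ?case by (simp add: tpow_def PiM_empty nn_integral_count_space_finite)
next
  case (Suc m)
  let ?F = "\<lambda>x. (\<Prod>i<Suc m. tpow \<eta> (x i)) * tpow b (1 - (\<Sum>i<Suc m. x i))"
  have "(\<integral>\<^sup>+x. ?F x \<partial>(\<Pi>\<^sub>M i\<in>{..<Suc m}. lborel))
    = (\<integral>\<^sup>+x. (\<integral>\<^sup>+y. ?F (x(m := y)) \<partial>lborel) \<partial>(\<Pi>\<^sub>M i\<in>{..<m}. lborel))"
    unfolding lessThan_Suc
    by (rule lborel_prod.product_nn_integral_insert) (auto simp flip: lessThan_Suc)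
  also have "\<dots> = (\<integral>\<^sup>+x. ennreal (Beta \<eta> b) *
      ((\<Prod>i<m. tpow \<eta> (x i)) * tpow (\<eta> + b) (1 - (\<Sum>i<m. x i))) \<partial>(\<Pi>\<^sub>M i\<in>{..<m}. lborel))"
  proof (rule nn_integral_cong)
    fix x :: "nat \<Rightarrow> real"
    have pr: "(\<Prod>i<m. tpow \<eta> ((x(m := y)) i)) = (\<Prod>i<m. tpow \<eta> (x i))" for y
      by (rule prod.cong) auto
    have "?F (x(m := y)) = (\<Prod>i<m. tpow \<eta> (x i)) *
        (tpow \<eta> y * tpow b ((1 - (\<Sum>i<m. x i)) - y))" for y
      unfolding prod.lessThan_Suc pr by (simp add: diff_diff_eq ac_simps)
    then have "(\<integral>\<^sup>+y. ?F (x(m := y)) \<partial>lborel) = (\<Prod>i<m. tpow \<eta> (x i)) *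
        (\<integral>\<^sup>+y. tpow \<eta> y * tpow b ((1 - (\<Sum>i<m. x i)) - y) \<partial>lborel)"
      by (simp add: nn_integral_cmult)
    then show "(\<integral>\<^sup>+y. ?F (x(m := y)) \<partial>lborel) = ennreal (Beta \<eta> b) *
      ((\<Prod>i<m. tpow \<eta> (x i)) * tpow (\<eta> + b) (1 - (\<Sum>i<m. x i)))"
      using Suc.prems by (simp add: nn_integral_tpow_convolution ac_simps)
  qed
  also have "\<dots> = ennreal (Beta \<eta> b) *
      ennreal (Gamma \<eta> ^ m * Gamma (\<eta> + b) / Gamma (real m * \<eta> + (\<eta> + b)))"
    using Suc.prems by (subst nn_integral_cmult) (auto simp: Suc.IH)
  also have "\<dots> = ennreal (Gamma \<eta> ^ Suc m * Gamma b / Gamma (real (Suc m) * \<eta> + b))"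
  proof -
    have "Gamma (\<eta> + b) > 0" "Gamma \<eta> > 0" "Gamma b > 0" "Gamma (real m * \<eta> + (\<eta> + b)) > 0"
      using Suc.prems by (auto intro!: Gamma_real_pos add_nonneg_pos)
    then show ?thesis
      by (subst ennreal_mult[symmetric]) (auto simp: Beta_def field_simps)
  qed
  finally show ?case .
qed

section \<open>The symmetric Dirichlet law\<close>

lemma simplex_point_measurable [measurable]:
  "simplex_point n \<in> (\<Pi>\<^sub>M i\<in>{..<n - 1}. lborel) \<rightarrow>\<^sub>M simplex_coords n"
  unfolding simplex_point_def simplex_coords_def
proof (rule measurable_restrict)
  fix i
  have "(\<lambda>x. 1 - (\<Sum>j<n - 1. x j)) \<in> borel_measurable (\<Pi>\<^sub>M i\<in>{..<n - 1}. lborel :: real measure)"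
    by (intro borel_measurable_diff borel_measurable_const borel_measurable_sum) auto
  then show "(\<lambda>x. if i < n - 1 then x i else 1 - (\<Sum>j<n - 1. x j))
      \<in> borel_measurable (\<Pi>\<^sub>M i\<in>{..<n - 1}. lborel)"
    by (cases "i < n - 1") auto
qed

lemma dirichlet_density_measurable [measurable]:
  "dirichlet_density n \<eta> \<in> borel_measurable (simplex_coords n)"
  unfolding dirichlet_density_def simplex_coords_def by measurable

lemma space_simplex_coords: "space (simplex_coords n) = {..<n} \<rightarrow>\<^sub>E UNIV"
  by (simp add: simplex_coords_def space_PiM)

lemma sets_dirichlet [measurable_cong, simp]: "sets (dirichlet n \<eta>) = sets (simplex_coords n)"
  by (simp add: dirichlet_def)

lemma dirichlet_density_simplex_point_measurable [measurable]:
  "(\<lambda>x. ennreal (dirichlet_density n \<eta> (simplex_point n x)))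
      \<in> borel_measurable (\<Pi>\<^sub>M i\<in>{..<n - 1}. lborel)"
  by (rule measurable_compose[OF simplex_point_measurable]) measurable

lemma nn_integral_dirichlet:
  assumes [measurable]: "f \<in> borel_measurable (simplex_coords n)"
  shows "(\<integral>\<^sup>+p. f p \<partial>dirichlet n \<eta>) =
    (\<integral>\<^sup>+x. ennreal (dirichlet_density n \<eta> (simplex_point n x)) * f (simplex_point n x)
       \<partial>(\<Pi>\<^sub>M i\<in>{..<n - 1}. lborel))"
proof -
  have [measurable]: "(\<lambda>x. f (simplex_point n x)) \<in> borel_measurable (\<Pi>\<^sub>M i\<in>{..<n - 1}. lborel)"
    by (rule measurable_compose[OF simplex_point_measurable]) measurable
  have "(\<integral>\<^sup>+p. f p \<partial>dirichlet n \<eta>) = (\<integral>\<^sup>+x. f (simplex_point n x) \<partial>density (\<Pi>\<^sub>M i\<in>{..<n - 1}. lborel)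
                    (\<lambda>x. ennreal (dirichlet_density n \<eta> (simplex_point n x))))"
    unfolding dirichlet_def
    by (rule nn_integral_distr) (simp_all add: assms simplex_point_measurable[simplified])
  also have "\<dots> = (\<integral>\<^sup>+x. ennreal (dirichlet_density n \<eta> (simplex_point n x)) * f (simplex_point n x)
       \<partial>(\<Pi>\<^sub>M i\<in>{..<n - 1}. lborel))"
    by (rule nn_integral_density) measurable
  finally show ?thesis .
qed

text \<open>The positivity test moves into the factors: one nonpositive coordinate already makes the
  product 0. In this form Dirichlet's integral applies to the density.\<close>

lemma dirichlet_density_tpow:
  assumes "\<eta> > 0"
  shows "ennreal (dirichlet_density n \<eta> p) =
    ennreal (Gamma (real n * \<eta>) / Gamma \<eta> ^ n) * (\<Prod>i<n. tpow \<eta> (p i))"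
proof (cases "\<forall>i<n. 0 < p i")
  case True
  have "0 \<le> Gamma (real n * \<eta>) / Gamma \<eta> ^ n"
    using assms by (cases "n = 0") (auto intro!: divide_nonneg_nonneg less_imp_le Gamma_real_pos)
  moreover have "(\<Prod>i<n. tpow \<eta> (p i)) = ennreal (\<Prod>i<n. p i powr (\<eta> - 1))"
    using True by (subst prod_ennreal[symmetric]) (auto simp: tpow_def intro!: prod.cong)
  ultimately show ?thesis
    using True by (simp add: dirichlet_density_def ennreal_mult[symmetric] prod_nonneg)
next
  case False
  then obtain i where "i < n" "\<not> 0 < p i" by auto
  then have "(\<Prod>i<n. tpow \<eta> (p i)) = 0"
    by (auto simp: prod_zero_iff tpow_def intro!: exI[of _ i])
  moreover have "dirichlet_density n \<eta> p = 0"
    using False unfolding dirichlet_density_def by (simp only: if_False ennreal_0)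
  ultimately show ?thesis by simp
qed

lemma sum_simplex_point:
  assumes "n \<ge> 1"
  shows "(\<Sum>i<n. simplex_point n x i) = 1"
proof -
  obtain m where "n = Suc m" using assms by (cases n) auto
  then show ?thesis by (simp add: simplex_point_def)
qed

text \<open>The dependent last coordinate contributes one more factor \<open>tpow \<eta>\<close>,
  evaluated at the slack. The mass is therefore Dirichlet's integral over n - 1 coordinates with b =
  \<eta>, which is the reciprocal of the normalizing constant.\<close>

lemma prob_space_dirichlet:
  assumes "n \<ge> 1" "\<eta> > 0"
  shows "prob_space (dirichlet n \<eta>)"
proof
  obtain m where n: "n = Suc m" using assms by (cases n) auto
  have "emeasure (dirichlet n \<eta>) (space (dirichlet n \<eta>)) = (\<integral>\<^sup>+p. 1 \<partial>dirichlet n \<eta>)"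
    by simp
  also have "\<dots> = (\<integral>\<^sup>+x. ennreal (Gamma (real n * \<eta>) / Gamma \<eta> ^ n) *
      ((\<Prod>i<m. tpow \<eta> (x i)) * tpow \<eta> (1 - (\<Sum>i<m. x i))) \<partial>(\<Pi>\<^sub>M i\<in>{..<m}. lborel))"
  proof (subst nn_integral_dirichlet, simp, unfold n diff_Suc_1, rule nn_integral_cong)
    fix x
    have "(\<Prod>i<m. tpow \<eta> (simplex_point (Suc m) x i)) = (\<Prod>i<m. tpow \<eta> (x i))"
      by (rule prod.cong) (auto simp: simplex_point_def)
    then show "ennreal (dirichlet_density (Suc m) \<eta> (simplex_point (Suc m) x)) * 1 =
        ennreal (Gamma (real (Suc m) * \<eta>) / Gamma \<eta> ^ Suc m) *
        ((\<Prod>i<m. tpow \<eta> (x i)) * tpow \<eta> (1 - (\<Sum>i<m. x i)))"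
      unfolding dirichlet_density_tpow[OF assms(2)] prod.lessThan_Suc
      by (simp add: simplex_point_def)
  qed
  also have "\<dots> = ennreal (Gamma (real n * \<eta>) / Gamma \<eta> ^ n) *
      ennreal (Gamma \<eta> ^ m * Gamma \<eta> / Gamma (real m * \<eta> + \<eta>))"
    using assms by (subst nn_integral_cmult) (auto simp: nn_integral_dirichlet_kernel)
  also have "\<dots> = 1"
  proof -
    have "Gamma \<eta> > 0" "Gamma (real n * \<eta>) > 0" "real m * \<eta> + \<eta> = real n * \<eta>"
      using assms by (auto intro!: Gamma_real_pos add_pos_nonneg simp: n algebra_simps)
    then show ?thesis by (subst ennreal_mult[symmetric]) (auto simp: n)
  qed
  finally show "emeasure (dirichlet n \<eta>) (space (dirichlet n \<eta>)) = 1" .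
qed

lemma AE_dirichlet_pos:
  assumes "n \<ge> 1" "\<eta> > 0"
  shows "AE p in dirichlet n \<eta>. (\<forall>i<n. 0 < p i) \<and> (\<Sum>i<n. p i) = 1"
proof -
  have m: "{p \<in> space (simplex_coords n). (\<forall>i<n. 0 < p i) \<and> (\<Sum>i<n. p i) = 1} \<in> sets (simplex_coords n)"
    unfolding simplex_coords_def by measurable
  have "AE x in density (Pi\<^sub>M {..<n - 1} (\<lambda>i. lborel))
            (\<lambda>x. ennreal (dirichlet_density n \<eta> (simplex_point n x))).
       (\<forall>i<n. 0 < simplex_point n x i) \<and> sum (simplex_point n x) {..<n} = 1"
    using dirichlet_density_simplex_point_measurable
    by (subst AE_density) (auto simp: sum_simplex_point[OF assms(1)] dirichlet_density_def)
  moreover have "simplex_point n \<in> density (Pi\<^sub>M {..<n - 1} (\<lambda>i. lborel))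
            (\<lambda>x. ennreal (dirichlet_density n \<eta> (simplex_point n x))) \<rightarrow>\<^sub>M simplex_coords n"
    by measurable
  ultimately show ?thesis
    unfolding dirichlet_def by (subst AE_distr_iff[OF _ m])
qed

section \<open>Choice of the dependent coordinate of the simplex\<close>

definition pivot_point :: "nat \<Rightarrow> nat \<Rightarrow> (nat \<Rightarrow> real) \<Rightarrow> nat \<Rightarrow> real" where
  "pivot_point n i x = (\<lambda>j\<in>{..<n}. if j = i then 1 - (\<Sum>k\<in>{..<n} - {i}. x k) else x j)"

lemma pivot_point_measurable [measurable]:
  "pivot_point n i \<in> (\<Pi>\<^sub>M j\<in>{..<n} - {i}. lborel) \<rightarrow>\<^sub>M simplex_coords n"
  unfolding pivot_point_def simplex_coords_def
proof (rule measurable_restrict)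
  fix j assume j: "j \<in> {..<n}"
  have "(\<lambda>x. 1 - (\<Sum>k\<in>{..<n} - {i}. x k)) \<in> borel_measurable (\<Pi>\<^sub>M j\<in>{..<n} - {i}. lborel :: real measure)"
    by (intro borel_measurable_diff borel_measurable_const borel_measurable_sum) auto
  then show "(\<lambda>x. if j = i then 1 - (\<Sum>k\<in>{..<n} - {i}. x k) else x j)
      \<in> borel_measurable (\<Pi>\<^sub>M j\<in>{..<n} - {i}. lborel)"
    using j by (cases "j = i") auto
qed

text \<open>The Dirichlet law is defined with the last coordinate dependent, whereas the mass bound
  at a sparse point needs the dependent coordinate in its support, where there is room to absorb the
  deviations of the others. Exchanging the dependent coordinate reflects one variable, which
  preserves Lebesgue measure.\<close>

lemma nn_integral_simplex_pivot:
  assumes i: "i < n" and [measurable]: "f \<in> borel_measurable (simplex_coords n)"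
  shows "(\<integral>\<^sup>+x. f (simplex_point n x) \<partial>(\<Pi>\<^sub>M j\<in>{..<n - 1}. lborel)) =
    (\<integral>\<^sup>+x. f (pivot_point n i x) \<partial>(\<Pi>\<^sub>M j\<in>{..<n} - {i}. lborel))"
proof -
  obtain m where n: "n = Suc m" using i by (cases n) auto
  show ?thesis
  proof (cases "i = m")
    case True
    have "{..<n} - {i} = {..<m}" using n True by auto
    moreover have "simplex_point n = pivot_point n i"
      using n True \<open>{..<n} - {i} = {..<m}\<close> by (auto simp: simplex_point_def pivot_point_def fun_eq_iff)
    ultimately show ?thesis by (simp add: n)
  next
    case False
    \<comment> \<open>\<open>J\<close> collects the coordinates that are free in both charts:
      \<open>insert i J\<close> belongs to the chart with m dependent, \<open>insert m J\<close> to
      the chart with i dependent.\<close>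
    define J where "J = {..<m} - {i}"
    have J: "finite J" "i \<notin> J" "m \<notin> J" "insert i J = {..<m}" "insert m J = {..<n} - {i}" "i \<noteq> m"
      using False i by (auto simp: J_def n)
    have m1: "(\<lambda>x. f (simplex_point n x)) \<in> borel_measurable (\<Pi>\<^sub>M j\<in>insert i J. lborel)"
      using measurable_compose[OF simplex_point_measurable assms(2)] by (simp add: J n)
    have m2: "(\<lambda>x. f (pivot_point n i x)) \<in> borel_measurable (\<Pi>\<^sub>M j\<in>insert m J. lborel)"
      using measurable_compose[OF pivot_point_measurable assms(2)] by (simp add: J)
    have "(\<integral>\<^sup>+x. f (simplex_point n x) \<partial>(\<Pi>\<^sub>M j\<in>{..<n - 1}. lborel))
        = (\<integral>\<^sup>+x. (\<integral>\<^sup>+y. f (simplex_point n (x(i := y))) \<partial>lborel) \<partial>(\<Pi>\<^sub>M j\<in>J. lborel))"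
      using lborel_prod.product_nn_integral_insert[OF J(1,2) m1] by (simp add: J n)
    also have "\<dots> = (\<integral>\<^sup>+x. (\<integral>\<^sup>+y. f (pivot_point n i (x(m := y))) \<partial>lborel) \<partial>(\<Pi>\<^sub>M j\<in>J. lborel))"
    proof (rule nn_integral_cong)
      fix x :: "nat \<Rightarrow> real" assume x: "x \<in> space (\<Pi>\<^sub>M j\<in>J. lborel)"
      define s where "s = 1 - (\<Sum>j\<in>J. x j)"
      have [measurable]: "(\<lambda>y. f (pivot_point n i (x(m := y)))) \<in> borel_measurable lborel"
        using measurable_comp[OF measurable_component_update m2, OF x \<open>m \<notin> J\<close>]
        unfolding comp_def .
      have u: "(\<Sum>j\<in>J. (x(l := y)) j) = (\<Sum>j\<in>J. x j)" if "l \<notin> J" for l y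
        using that by (intro sum.cong) auto
      \<comment> \<open>\<open>s\<close> is the mass left for the coordinates i and m together: if
        one of them is y, the other is s - y.\<close>
      have eq: "pivot_point n i (x(m := s + (-1) * y)) = simplex_point n (x(i := y))" for y
      proof -
        have "(\<Sum>k\<in>{..<n} - {i}. (x(m := s + (-1) * y)) k) = s - y + (\<Sum>j\<in>J. x j)"
          unfolding J(5)[symmetric] using J(1,3) u[OF J(3)] by simp
        moreover have "(\<Sum>j<n - 1. (x(i := y)) j) = y + (\<Sum>j\<in>J. x j)"
          unfolding n diff_Suc_1 J(4)[symmetric] using J(1,2) u[OF J(2)] by simp
        ultimately show ?thesis
          using J(6) i by (auto simp: pivot_point_def simplex_point_def fun_eq_iff s_def n restrict_def)
      qed
      have "(\<integral>\<^sup>+y. f (pivot_point n i (x(m := y))) \<partial>lborel) =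
          ennreal \<bar>-1\<bar> * (\<integral>\<^sup>+y. f (pivot_point n i (x(m := s + (-1) * y))) \<partial>lborel)"
        by (rule nn_integral_real_affine) auto
      then show "(\<integral>\<^sup>+y. f (simplex_point n (x(i := y))) \<partial>lborel) =
          (\<integral>\<^sup>+y. f (pivot_point n i (x(m := y))) \<partial>lborel)"
        unfolding eq by simp
    qed
    also have "\<dots> = (\<integral>\<^sup>+x. f (pivot_point n i x) \<partial>(\<Pi>\<^sub>M j\<in>{..<n} - {i}. lborel))"
      using lborel_prod.product_nn_integral_insert[OF J(1,3) m2] by (simp add: J)
    finally show ?thesis .
  qed
qed

section \<open>Prior mass near a sparse point\<close>

text \<open>Log-convexity on [1, 2], with value 1 at both ends.\<close>

lemma Gamma_le_1:
  fixes x :: real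
  assumes "1 \<le> x" "x \<le> 2"
  shows "Gamma x \<le> 1"
proof -
  have "(ln \<circ> Gamma) ((1 - (x - 1)) *\<^sub>R 1 + (x - 1) *\<^sub>R (2::real))
      \<le> (1 - (x - 1)) * (ln \<circ> Gamma) 1 + (x - 1) * (ln \<circ> Gamma) (2::real)"
    by (rule convex_onD[OF log_convex_Gamma_real]) (use assms in auto)
  moreover have "Gamma (2::real) = 1"
    using Gamma_fact[of 1, where 'a = real] by simp
  ultimately have "ln (Gamma x) \<le> 0" by simp
  moreover have "Gamma x > 0" using assms by (intro Gamma_real_pos) auto
  ultimately show ?thesis by (simp add: ln_le_zero_iff)
qed

text \<open>Log-convexity at 2 between x and 3: Gamma 2 = 1 and Gamma 3 = 2 give ln (Gamma x) \<ge>
  - (2 - x) * ln 2, which is at least - ln 4.\<close>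

lemma Gamma_ge_quarter:
  fixes x :: real
  assumes "0 < x" "x \<le> 1"
  shows "1 / 4 \<le> Gamma x"
proof -
  \<comment> \<open>The weight that writes 2 as (1 - l) * x + l * 3.\<close>
  define l where "l = (2 - x) / (3 - x)"
  have "l * (3 - x) = 2 - x" using assms by (simp add: l_def)
  then have l34: "(1 - l) * x + l * 3 = 2" "l = (2 - x) * (1 - l)" by (simp_all add: algebra_simps)
  have "0 \<le> l" "l < 1" using assms by (simp_all add: l_def)
  note l = this l34
  have "(ln \<circ> Gamma) ((1 - l) *\<^sub>R x + l *\<^sub>R (3::real))
      \<le> (1 - l) * (ln \<circ> Gamma) x + l * (ln \<circ> Gamma) (3::real)"
    by (rule convex_onD[OF log_convex_Gamma_real]) (use assms l in auto)
  moreover have "Gamma (2::real) = 1" "Gamma (3::real) = 2"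
    using Gamma_fact[of 1, where 'a = real] Gamma_fact[of 2, where 'a = real]
    by (simp_all add: numeral_eq_Suc)
  ultimately have "0 \<le> (1 - l) * ln (Gamma x) + l * ln 2" using l(3) by simp
  then have "0 \<le> (1 - l) * (ln (Gamma x) + (2 - x) * ln 2)"
    using arg_cong[OF l(4), of "\<lambda>z. z * ln 2"] by (simp add: algebra_simps)
  then have "0 \<le> ln (Gamma x) + (2 - x) * ln 2" using l(2) by (simp add: zero_le_mult_iff)
  moreover have "(2 - x) * ln 2 \<le> 2 * ln 2" using assms by (intro mult_right_mono) auto
  moreover have "2 * ln 2 = ln (4::real)" using ln_realpow[of 2 2] by simp
  ultimately have "ln (1 / 4) \<le> ln (Gamma x)" by (simp add: ln_div)
  moreover have "Gamma x > 0" using assms by (intro Gamma_real_pos) auto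
  ultimately show ?thesis by (subst (asm) ln_le_cancel_iff) auto
qed

text \<open>The functional equation and Gamma (\<eta> + 1) \<le> 1 bound each Gamma \<eta> in the
  denominator by 1 / \<eta>; the numerator is at least 1/4 because n * \<eta> lies in (0,
  1].\<close>

lemma dirichlet_normalizer_ge:
  assumes "0 < \<eta>" "real n * \<eta> \<le> 1" "n \<ge> 1"
  shows "\<eta> ^ n / 4 \<le> Gamma (real n * \<eta>) / Gamma \<eta> ^ n"
proof -
  have "1 * \<eta> \<le> real n * \<eta>" using assms by (intro mult_right_mono) auto
  then have "\<eta> \<le> 1" using assms(2) by linarith
  then have "Gamma (\<eta> + 1) \<le> 1" using assms by (intro Gamma_le_1) auto
  then have g: "\<eta> * Gamma \<eta> \<le> 1" using Gamma_plus1[of \<eta>] assms by (simp add: nonpos_Ints_def)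
  have G: "0 < Gamma \<eta>" using assms by (intro Gamma_real_pos) auto
  have "(\<eta> * Gamma \<eta>) ^ n \<le> 1" using g G assms by (intro power_le_one) auto
  then have "\<eta> ^ n * Gamma \<eta> ^ n / 4 \<le> 1 / 4" by (simp add: power_mult_distrib)
  also have "\<dots> \<le> Gamma (real n * \<eta>)" using assms by (intro Gamma_ge_quarter) auto
  finally show ?thesis using G by (simp add: field_simps)
qed

text \<open>With \<open>i0\<close> as dependent coordinate, the neighbourhood contains a box: the
  other support coordinates lie slightly below \<open>x i\<close>, the remaining ones in (0, t). On
  it the density dominates a product of functions of one variable, whose integrals are at least
  \<delta> * \<rho> / 2 on the support and t^\<eta> / \<eta> off it. The exponent
  \<open>card S - 1\<close> reflects that \<open>i0\<close> is not integrated.\<close>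

lemma emeasure_dirichlet_ge:
  assumes \<eta>: "0 < \<eta>" "real n * \<eta> \<le> 1" and x: "x \<in> prob_simplex n"
    and i0: "i0 < n" "x i0 \<noteq> 0" and \<rho>: "0 < \<rho>" "\<rho> \<le> 1" and \<delta>: "0 < \<delta>"
    and x_ge: "\<And>i. i < n \<Longrightarrow> x i \<noteq> 0 \<Longrightarrow> \<delta> \<le> x i"
  defines "S \<equiv> {i. i < n \<and> x i \<noteq> 0}"
  shows "ennreal (Gamma (real n * \<eta>) / Gamma \<eta> ^ n *
       ((\<delta> * \<rho> / 2) ^ (card S - 1) * ((\<delta> * \<rho> / (2 * real n)) powr \<eta> / \<eta>) ^ (n - card S)))
     \<le> emeasure (dirichlet n \<eta>) {p \<in> space (simplex_coords n). \<forall>i<n. x i * exp (- \<rho>) \<le> p i}"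
proof -
  define B where "B = {p \<in> space (simplex_coords n). \<forall>i<n. x i * exp (- \<rho>) \<le> p i}"
  define G where "G = Gamma (real n * \<eta>) / Gamma \<eta> ^ n"
  \<comment> \<open>Chosen so that n * t = \<delta> * \<rho> / 2 \<le> x i0 * \<rho> / 2: even if
    every other coordinate exceeded x by t, the dependent one would keep at least x i0 * (1 - \<rho>
    / 2).\<close>
  define t where "t = \<delta> * \<rho> / (2 * real n)"
  define I where "I = {..<n} - {i0}"
  \<comment> \<open>\<open>tpow 1 (t - y)\<close> is the indicator of y < t. Written this way, the
    integral of an off-support factor is an instance of
    \<open>nn_integral_tpow_convolution\<close>.\<close>
  define g where "g = (\<lambda>i y. if i \<in> S then indicator {x i * (1 - \<rho> / 2) <..< x i} y
    else tpow \<eta> y * tpow 1 (t - y))"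
  have n: "n \<ge> 1" using i0 by simp
  have "1 * \<eta> \<le> real n * \<eta>" using \<eta> n by (intro mult_right_mono) auto
  then have \<eta>1: "\<eta> \<le> 1" using \<eta>(2) by linarith
  have t: "0 < t" using \<delta> \<rho> n by (simp add: t_def)
  have x0: "0 \<le> x i" if "i < n" for i using x that by (auto simp: prob_simplex_def)
  have xsum: "(\<Sum>i<n. x i) = 1" using x by (auto simp: prob_simplex_def)
  have G0: "0 \<le> G" using \<eta> n by (auto simp: G_def intro!: divide_nonneg_nonneg less_imp_le Gamma_real_pos)
  have [measurable]: "B \<in> sets (simplex_coords n)"
    unfolding B_def simplex_coords_def by measurable
  have g_meas [measurable]: "g i \<in> borel_measurable lborel" for i
    unfolding g_def by (cases "i \<in> S") auto
  \<comment> \<open>Allows the box to be cut out by the linear bound x i * (1 - \<rho> / 2); the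
    estimate relies on \<rho> \<le> 1.\<close>
  have exp_le: "exp (- \<rho>) \<le> 1 - \<rho> / 2"
  proof -
    have "1 \<le> (1 - \<rho> / 2) * (1 + \<rho>)" using \<rho> mult_left_mono[of \<rho> 1 \<rho>] by (simp add: algebra_simps)
    also have "\<dots> \<le> (1 - \<rho> / 2) * exp \<rho>" using \<rho> exp_ge_add_one_self[of \<rho>] by (intro mult_left_mono) auto
    finally show ?thesis by (simp add: exp_minus field_simps)
  qed
  have pw: "ennreal G * (\<Prod>i\<in>I. g i (y i))
     \<le> ennreal (dirichlet_density n \<eta> (pivot_point n i0 y)) * indicator B (pivot_point n i0 y)" for y
  proof (cases "\<forall>i\<in>I. g i (y i) \<noteq> 0")
    case False
    then have "(\<Prod>i\<in>I. g i (y i)) = 0" by (intro prod_zero) (auto simp: I_def)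
    then show ?thesis by (simp only: mult_zero_right zero_le)
  next
    case True
    have yS: "x i * (1 - \<rho> / 2) < y i \<and> y i < x i" if "i \<in> I" "i \<in> S" for i
      using True that by (auto simp: g_def split: split_indicator_asm)
    have yN: "0 < y i \<and> y i < t" if "i \<in> I" "i \<notin> S" for i
      using True that by (auto simp: g_def tpow_def split: if_splits)
    have y0: "0 < y i" if "i \<in> I" for i
    proof (cases "i \<in> S")
      case True
      have "0 \<le> x i * (1 - \<rho> / 2)" using x0[of i] \<rho> that by (auto simp: I_def)
      then show ?thesis using yS[OF that True] by linarith
    qed (use yN that in auto)
    define q where "q = 1 - (\<Sum>i\<in>I. y i)"
    have "(\<Sum>i\<in>I. y i) \<le> (\<Sum>i\<in>I. x i + t)"
    proof (rule sum_mono)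
      fix i assume i: "i \<in> I"
      show "y i \<le> x i + t"
        using yS[OF i] yN[OF i] t x0[of i] i by (cases "i \<in> S") (auto simp: I_def)
    qed
    also have "\<dots> = (1 - x i0) + real (n - 1) * t"
    proof -
      have "(\<Sum>i\<in>I. x i) = 1 - x i0"
        using xsum i0 by (simp add: I_def sum_diff1)
      moreover have "card I = n - 1" using i0 by (simp add: I_def)
      ultimately show ?thesis by (simp add: sum.distrib)
    qed
    also have "\<dots> \<le> (1 - x i0) + real n * t" using t by (auto intro!: mult_right_mono)
    also have "real n * t = \<delta> * \<rho> / 2" using n by (simp add: t_def)
    also have "\<dots> \<le> x i0 * \<rho> / 2" using x_ge[OF i0] \<rho> by auto
    finally have q1: "x i0 * (1 - \<rho> / 2) \<le> q" by (simp add: q_def algebra_simps)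
    have q0: "0 < q"
    proof -
      have "0 < x i0 * (1 - \<rho> / 2)" using x_ge[OF i0] \<delta> \<rho> by (intro mult_pos_pos) auto
      then show ?thesis using q1 by linarith
    qed
    have q2: "q \<le> 1" using sum_nonneg[of I y] y0 by (force simp: q_def)
    have pp: "pivot_point n i0 y i0 = q" "\<And>i. i \<in> I \<Longrightarrow> pivot_point n i0 y i = y i"
      using i0 by (auto simp: pivot_point_def q_def I_def)
    have inB: "pivot_point n i0 y \<in> B"
      unfolding B_def
    proof (intro CollectI conjI allI impI)
      show "pivot_point n i0 y \<in> space (simplex_coords n)"
        by (auto simp: space_simplex_coords pivot_point_def)
      fix i assume i: "i < n"
      have "x i * exp (- \<rho>) \<le> x i * (1 - \<rho> / 2)" using x0[OF i] exp_le by (rule mult_left_mono[rotated])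
      also have "\<dots> \<le> pivot_point n i0 y i"
      proof (cases "i = i0")
        case False
        then have iI: "i \<in> I" using i by (simp add: I_def)
        show ?thesis
          using yS[OF iI] y0[OF iI] i by (cases "i \<in> S") (auto simp: pp iI S_def)
      qed (use q1 pp in simp)
      finally show "x i * exp (- \<rho>) \<le> pivot_point n i0 y i" .
    qed
    \<comment> \<open>Since \<eta> \<le> 1, a density factor is at least 1 on (0, 1]. Support
      coordinates can therefore be replaced by the indicator of their interval, and the factor of
      the dependent coordinate can be inserted.\<close>
    have tp1: "1 \<le> tpow \<eta> z" if "0 < z" "z \<le> 1" for z
    proof -
      have "1 \<le> z powr (\<eta> - 1)" using that \<eta>1 powr_mono'[of "\<eta> - 1" 0 z] by simp
      then show ?thesis using that by (simp add: tpow_def)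
    qed
    have "(\<Prod>i\<in>I. g i (y i)) \<le> (\<Prod>i\<in>I. tpow \<eta> (y i))"
    proof (rule prod_mono_ennreal)
      fix i assume i: "i \<in> I"
      have "x i \<le> 1"
      proof -
        have "x i \<le> (\<Sum>i<n. x i)" using i x0 by (intro member_le_sum) (auto simp: I_def)
        then show ?thesis using xsum by simp
      qed
      then show "g i (y i) \<le> tpow \<eta> (y i)"
        using tp1[OF y0[OF i]] yS[OF i] yN[OF i] i
        by (cases "i \<in> S") (auto simp: g_def tpow_def[of 1] split: split_indicator)
    qed
    also have "\<dots> = (\<Prod>i\<in>I. tpow \<eta> (pivot_point n i0 y i))" by (simp add: pp)
    also have "\<dots> \<le> tpow \<eta> (pivot_point n i0 y i0) * (\<Prod>i\<in>I. tpow \<eta> (pivot_point n i0 y i))"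
      using mult_right_mono[OF tp1[OF q0 q2]] pp by fastforce
    also have "\<dots> = (\<Prod>i<n. tpow \<eta> (pivot_point n i0 y i))"
    proof -
      have "{..<n} = insert i0 I" "i0 \<notin> I" "finite I" using i0 by (auto simp: I_def)
      then show ?thesis by simp
    qed
    finally have "(\<Prod>i\<in>I. g i (y i)) \<le> (\<Prod>i<n. tpow \<eta> (pivot_point n i0 y i))" .
    then show ?thesis
      using inB by (simp add: dirichlet_density_tpow[OF \<eta>(1)] G_def mult_left_mono)
  qed
  have card_S: "card (S - {i0}) = card S - 1" using i0 by (simp add: S_def)
  have card_I: "card (I - S) = n - card S"
  proof -
    have "I - S = {..<n} - S" using i0 by (auto simp: I_def S_def)
    moreover have "S \<subseteq> {..<n}" by (auto simp: S_def)
    ultimately show ?thesis by (simp add: card_Diff_subset finite_subset)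
  qed
  have gS: "ennreal (\<delta> * \<rho> / 2) \<le> (\<integral>\<^sup>+y. g i y \<partial>lborel)" if i: "i \<in> S - {i0}" for i
  proof -
    have "(\<integral>\<^sup>+y. g i y \<partial>lborel) = ennreal (x i - x i * (1 - \<rho> / 2))"
      using i x0[of i] \<rho> by (simp add: g_def S_def mult_left_le)
    moreover have "\<delta> * \<rho> / 2 \<le> x i - x i * (1 - \<rho> / 2)"
      using x_ge[of i] i \<rho> by (simp add: S_def algebra_simps)
    ultimately show ?thesis by (simp add: ennreal_leI)
  qed
  have gN: "ennreal (t powr \<eta> / \<eta>) \<le> (\<integral>\<^sup>+y. g i y \<partial>lborel)" if i: "i \<in> I - S" for i
  proof -
    have "Gamma \<eta> \<noteq> 0" using Gamma_real_pos[of \<eta>] \<eta> by linarith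
    then have "Beta \<eta> 1 = 1 / \<eta>"
      using Gamma_plus1[of \<eta>] \<eta> by (simp add: Beta_def nonpos_Ints_def)
    moreover have "(\<integral>\<^sup>+y. g i y \<partial>lborel) = ennreal (Beta \<eta> 1) * tpow (\<eta> + 1) t"
      using i \<eta> by (simp add: g_def nn_integral_tpow_convolution)
    ultimately have "(\<integral>\<^sup>+y. g i y \<partial>lborel) = ennreal (t powr \<eta> / \<eta>)"
      using \<eta> t by (simp add: tpow_def ennreal_mult[symmetric])
    then show ?thesis by simp
  qed
  have "ennreal ((\<delta> * \<rho> / 2) ^ (card S - 1) * (t powr \<eta> / \<eta>) ^ (n - card S)) =
     (\<Prod>i\<in>S - {i0}. ennreal (\<delta> * \<rho> / 2)) * (\<Prod>i\<in>I - S. ennreal (t powr \<eta> / \<eta>))"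
    using \<delta> \<rho> \<eta> by (simp add: card_S card_I ennreal_mult ennreal_power)
  also have "\<dots> \<le> (\<Prod>i\<in>S - {i0}. (\<integral>\<^sup>+y. g i y \<partial>lborel)) * (\<Prod>i\<in>I - S. (\<integral>\<^sup>+y. g i y \<partial>lborel))"
    by (intro mult_mono prod_mono_ennreal) (use gS gN in auto)
  also have "\<dots> = (\<Prod>i\<in>I. (\<integral>\<^sup>+y. g i y \<partial>lborel))"
  proof -
    have "(S - {i0}) \<union> (I - S) = I" by (auto simp: I_def S_def)
    moreover have "finite (S - {i0})" "finite (I - S)" "(S - {i0}) \<inter> (I - S) = {}"
      by (auto simp: I_def S_def)
    ultimately show ?thesis
      by (simp only: prod.union_disjoint[symmetric])
  qed
  also have "\<dots> = (\<integral>\<^sup>+y. (\<Prod>i\<in>I. g i (y i)) \<partial>(\<Pi>\<^sub>M i\<in>I. lborel))"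
    by (subst lborel_prod.product_nn_integral_prod) (auto simp: I_def)
  finally have "ennreal G * ennreal ((\<delta> * \<rho> / 2) ^ (card S - 1) * (t powr \<eta> / \<eta>) ^ (n - card S))
     \<le> ennreal G * (\<integral>\<^sup>+y. (\<Prod>i\<in>I. g i (y i)) \<partial>(\<Pi>\<^sub>M i\<in>I. lborel))"
    by (rule mult_left_mono) simp
  also have "\<dots> = (\<integral>\<^sup>+y. ennreal G * (\<Prod>i\<in>I. g i (y i)) \<partial>(\<Pi>\<^sub>M i\<in>I. lborel))"
  proof (rule nn_integral_cmult[symmetric], rule borel_measurable_prod_ennreal)
    fix i assume "i \<in> I"
    then show "(\<lambda>y. g i (y i)) \<in> borel_measurable (\<Pi>\<^sub>M i\<in>I. lborel)"
      by (intro measurable_compose[OF measurable_component_singleton[of i I "\<lambda>_. lborel"] g_meas[of i]]) auto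
  qed
  also have "\<dots> \<le> (\<integral>\<^sup>+y. ennreal (dirichlet_density n \<eta> (pivot_point n i0 y)) *
      indicator B (pivot_point n i0 y) \<partial>(\<Pi>\<^sub>M i\<in>I. lborel))"
    by (rule nn_integral_mono) (rule pw)
  \<comment> \<open>Passage from the chart at \<open>i0\<close> back to the chart in which the law
    is defined.\<close>
  also have "\<dots> = (\<integral>\<^sup>+p. indicator B p \<partial>dirichlet n \<eta>)"
    unfolding I_def
    by (subst nn_integral_dirichlet, measurable,
        subst nn_integral_simplex_pivot[OF i0(1), of "\<lambda>p. ennreal (dirichlet_density n \<eta> p) * indicator B p"])
       measurable
  also have "\<dots> = emeasure (dirichlet n \<eta>) B" by simp
  finally show ?thesis
    using G0 \<delta> \<rho> \<eta> by (simp add: B_def G_def t_def ennreal_mult[symmetric])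
qed

lemma m_sparse_ge_1:
  assumes "x \<in> prob_simplex n" "m_sparse n m x"
  shows "1 \<le> m"
proof (rule ccontr)
  assume "\<not> 1 \<le> m"
  then have "{i. i < n \<and> x i \<noteq> 0} = {}"
    using assms(2) card_0_eq[of "{i. i < n \<and> x i \<noteq> 0}"] by (simp add: m_sparse_def)
  then have "(\<Sum>i<n. x i) = 0" by (intro sum.neutral) auto
  then show False using assms(1) by (simp add: prob_simplex_def)
qed

text \<open>Turns the product bound into an exponent proportional to m * (ln n + ln (1 / \<rho>)).
  From 1 \<le> m < n follows n \<ge> 2, so constants are absorbed into ln n \<ge> ln 2, and terms
  that carry no factor m are multiplied by m.\<close>

lemma dirichlet_neighbourhood_mass:
  assumes c: "c > 1" and x: "x \<in> prob_simplex n" "m_sparse n m x" "m < n"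
    and \<delta>: "0 < \<delta>" and x_ge: "\<And>i. i < n \<Longrightarrow> x i \<noteq> 0 \<Longrightarrow> \<delta> \<le> x i"
    and \<rho>: "0 < \<rho>" "\<rho> \<le> 1"
  shows "exp (- ((c + 3 + \<bar>ln 4 + 2 * ln (2 / \<delta>)\<bar> / ln 2) * real m * (ln (real n) + ln (1 / \<rho>))))
    \<le> measure (dirichlet n (1 / real n powr c))
        {p \<in> space (simplex_coords n). \<forall>i<n. x i * exp (- \<rho>) \<le> p i}"
proof -
  define \<eta> where "\<eta> = 1 / real n powr c"
  define S where "S = {i. i < n \<and> x i \<noteq> 0}"
  have m: "card S = m" using x by (simp add: m_sparse_def S_def)
  have "\<exists>i0<n. x i0 \<noteq> 0"
  proof (rule ccontr)
    assume "\<not> ?thesis"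
    then have "(\<Sum>i<n. x i) = 0" by (intro sum.neutral) auto
    then show False using x(1) by (simp add: prob_simplex_def)
  qed
  then obtain i0 where i0: "i0 < n" "x i0 \<noteq> 0" by blast
  have m1: "m \<ge> 1" using i0 m card_gt_0_iff[of S] by (auto simp: S_def)
  then have n2: "n \<ge> 2" using x(3) by simp
  have "real n powr 1 \<le> real n powr c" using n2 c by (intro powr_mono) auto
  then have \<eta>: "0 < \<eta>" "real n * \<eta> \<le> 1" using n2 by (auto simp: \<eta>_def field_simps)
  have \<delta>1: "\<delta> \<le> 1"
  proof -
    have "x i0 \<le> (\<Sum>i<n. x i)" using i0 x by (intro member_le_sum) (auto simp: prob_simplex_def)
    then show ?thesis using x_ge[OF i0] x by (simp add: prob_simplex_def)
  qed
  define t where "t = \<delta> * \<rho> / (2 * real n)"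
  define u where "u = \<delta> * \<rho> / 2"
  have u: "0 < u" "u \<le> 1"
    using \<delta> \<delta>1 \<rho> mult_mono[of \<delta> 1 \<rho> 1] by (auto simp: u_def)
  have tu: "t = u / real n" by (simp add: t_def u_def)
  have t: "0 < t" "t \<le> 1" using u n2 by (auto simp: tu field_simps)
  define L where "L = ln (real n)"
  define R where "R = ln (1 / \<rho>)"
  define k where "k = ln 4 + 2 * ln (2 / \<delta>)"
  have L: "ln 2 \<le> L" and L0: "0 \<le> L" using n2 by (auto simp: L_def)
  have R0: "0 \<le> R" using \<rho> by (simp add: R_def ln_div)
  have ln\<eta>: "ln \<eta> = - c * L" using n2 by (simp add: \<eta>_def L_def ln_div ln_powr)
  have lnu: "ln u = - ln (2 / \<delta>) - R" using \<delta> \<rho> by (simp add: u_def R_def ln_div ln_mult)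
  have lnt: "ln t = ln u - L" using u n2 by (simp add: tu L_def ln_div)
  have d0: "0 \<le> ln (2 / \<delta>)" using \<delta> \<delta>1 by simp
  have k0: "0 \<le> k" using d0 by (simp add: k_def)
  \<comment> \<open>The exponents add up to at most m * ((c + 1) * L + 2 * R + k): c * L comes from
    \<eta>^m, one L and one R from t, another R from u^m, and k collects ln 4 and the two terms ln
    (2 / \<delta>). Both c + 1 and 2 are rounded up to c + 3.\<close>
  have "exp (- ((c + 3 + \<bar>k\<bar> / ln 2) * real m * (L + R))) \<le> exp (real m * ln \<eta> - ln 4 + ln t + real m * ln u)"
  proof -
    have mm: "z \<le> real m * z" if "0 \<le> z" for z :: real
      using m1 mult_right_mono[of 1 "real m" z] that by simp
    have "real m * (c * L) + ln 4 + ln (2 / \<delta>) + R + L + real m * (ln (2 / \<delta>) + R)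
        \<le> real m * (c * L) + real m * ln 4 + real m * ln (2 / \<delta>) + real m * R + real m * L
           + real m * (ln (2 / \<delta>) + R)"
      using mm[OF ln_ge_zero[of 4]] mm[OF d0] mm[OF R0] mm[OF L0] by linarith
    also have "\<dots> = real m * ((c + 1) * L + 2 * R + k)" by (simp add: k_def algebra_simps)
    also have "\<dots> \<le> real m * ((c + 3 + \<bar>k\<bar> / ln 2) * (L + R))"
    proof (rule mult_left_mono)
      have "\<bar>k\<bar> / ln 2 * ln 2 \<le> \<bar>k\<bar> / ln 2 * (L + R)"
        using L R0 by (intro mult_left_mono) auto
      then have "k \<le> \<bar>k\<bar> / ln 2 * (L + R)" using k0 by simp
      moreover have "(c + 1) * L + 2 * R \<le> (c + 3) * (L + R)"
        using L0 R0 c by (simp add: algebra_simps)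
      ultimately show "(c + 1) * L + 2 * R + k \<le> (c + 3 + \<bar>k\<bar> / ln 2) * (L + R)"
        by (simp add: algebra_simps)
    qed simp
    finally show ?thesis unfolding exp_le_cancel_iff lnt lnu ln\<eta> by (simp add: algebra_simps)
  qed
  also have "\<dots> = \<eta> ^ m / 4 * (t * u ^ m)"
    using \<eta> t u by (simp add: exp_add exp_diff ac_simps exp_of_nat_mult)
  also have "\<dots> \<le> \<eta> ^ m / 4 * ((t powr \<eta>) ^ (n - m) * u ^ (m - 1))"
  proof (intro mult_left_mono mult_mono)
    have "\<eta> * real (n - m) \<le> \<eta> * real n" using \<eta> by (intro mult_left_mono) auto
    then have "\<eta> * real (n - m) \<le> 1" using \<eta>(2) unfolding mult.commute[of \<eta> "real n"] by linarith
    then have "t powr 1 \<le> t powr (\<eta> * real (n - m))" using t by (intro powr_mono') auto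
    also have "\<dots> = (t powr \<eta>) ^ (n - m)" using t powr_realpow[of "t powr \<eta>" "n - m"] by (simp add: powr_powr)
    finally show "t \<le> (t powr \<eta>) ^ (n - m)" using t by simp
    show "u ^ m \<le> u ^ (m - 1)" using u by (intro power_decreasing) auto
  qed (use \<eta> u t in auto)
  also have "\<dots> = \<eta> ^ n / 4 * (u ^ (m - 1) * (t powr \<eta> / \<eta>) ^ (n - m))"
  proof -
    have "\<eta> ^ n = \<eta> ^ m * \<eta> ^ (n - m)" using x(3) by (simp flip: power_add)
    then show ?thesis using \<eta> by (simp add: power_divide)
  qed
  also have "\<dots> \<le> Gamma (real n * \<eta>) / Gamma \<eta> ^ n * (u ^ (m - 1) * (t powr \<eta> / \<eta>) ^ (n - m))"
    using dirichlet_normalizer_ge[OF \<eta>] n2 u \<eta> by (intro mult_right_mono) auto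
  finally have "ennreal (exp (- ((c + 3 + \<bar>k\<bar> / ln 2) * real m * (L + R)))) \<le>
      emeasure (dirichlet n \<eta>) {p \<in> space (simplex_coords n). \<forall>i<n. x i * exp (- \<rho>) \<le> p i}"
    using order_trans[OF ennreal_leI emeasure_dirichlet_ge[OF \<eta> x(1) i0 \<rho> \<delta> x_ge]]
    by (simp add: m[unfolded S_def] u_def t_def)
  moreover have "prob_space (dirichlet n \<eta>)" using n2 \<eta> by (intro prob_space_dirichlet) auto
  ultimately show ?thesis
    by (simp add: finite_measure.emeasure_eq_measure prob_space.axioms \<eta>_def k_def L_def R_def)
qed

section \<open>Product laws\<close>

text \<open>Conditioning independent factors on a product event keeps them independent, as
  rectangles show. This is why the prior conditioned on a box has mean-field form.\<close>

lemma PiM_uniform_measure: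
  assumes "finite I" "\<And>i. prob_space (M i)" "\<And>i. B i \<in> sets (M i)" "\<And>i. emeasure (M i) (B i) \<noteq> 0"
  shows "PiM I (\<lambda>i. uniform_measure (M i) (B i)) = uniform_measure (PiM I M) (Pi\<^sub>E I B)"
proof -
  interpret M: prob_space "M i" for i by (rule assms)
  interpret P: product_prob_space M ..
  interpret U: prob_space "uniform_measure (M i) (B i)" for i
    using assms(4) by (intro prob_space_uniform_measure) auto
  interpret PU: product_prob_space "\<lambda>i. uniform_measure (M i) (B i)" ..
  have pos: "measure (M i) (B i) > 0" for i
    using assms(4)[of i] by (simp add: M.emeasure_eq_measure zero_less_measure_iff)
  show ?thesis
  proof (rule PU.PiM_eqI[symmetric, OF assms(1)])
    show "sets (uniform_measure (PiM I M) (Pi\<^sub>E I B)) = sets (\<Pi>\<^sub>M i\<in>I. uniform_measure (M i) (B i))"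
      unfolding sets_uniform_measure by (rule sets_PiM_cong) auto
    fix A assume A: "\<And>i. i \<in> I \<Longrightarrow> A i \<in> sets (uniform_measure (M i) (B i))"
    have "emeasure (uniform_measure (PiM I M) (Pi\<^sub>E I B)) (Pi\<^sub>E I A) =
        emeasure (PiM I M) (Pi\<^sub>E I (\<lambda>i. B i \<inter> A i)) / emeasure (PiM I M) (Pi\<^sub>E I B)"
      using A assms by (subst emeasure_uniform_measure) (auto intro!: sets_PiM_I_finite simp: PiE_Int)
    also have "\<dots> = (\<Prod>i\<in>I. emeasure (M i) (B i \<inter> A i)) / (\<Prod>i\<in>I. emeasure (M i) (B i))"
      using A assms by (subst (1 2) P.emeasure_PiM) auto
    also have "\<dots> = ennreal (\<Prod>i\<in>I. measure (M i) (B i \<inter> A i)) / ennreal (\<Prod>i\<in>I. measure (M i) (B i))"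
      by (simp add: M.emeasure_eq_measure prod_ennreal)
    also have "\<dots> = ennreal (\<Prod>i\<in>I. measure (M i) (B i \<inter> A i) / measure (M i) (B i))"
      using pos by (subst divide_ennreal) (auto intro!: prod_nonneg prod_pos simp: prod_dividef)
    also have "\<dots> = (\<Prod>i\<in>I. ennreal (measure (M i) (B i \<inter> A i) / measure (M i) (B i)))"
      by (rule prod_ennreal[symmetric]) simp
    also have "\<dots> = (\<Prod>i\<in>I. emeasure (uniform_measure (M i) (B i)) (A i))"
      using A pos assms by (intro prod.cong) (auto simp: M.emeasure_eq_measure divide_ennreal)
    finally show "emeasure (uniform_measure (PiM I M) (Pi\<^sub>E I B)) (Pi\<^sub>E I A) =
      (\<Prod>i\<in>I. emeasure (uniform_measure (M i) (B i)) (A i))" .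
  qed
qed

lemma pair_uniform_measure:
  assumes "prob_space M" "prob_space N" "A \<in> sets M" "B \<in> sets N"
    "emeasure M A \<noteq> 0" "emeasure N B \<noteq> 0"
  shows "uniform_measure M A \<Otimes>\<^sub>M uniform_measure N B = uniform_measure (M \<Otimes>\<^sub>M N) (A \<times> B)"
proof -
  interpret M: prob_space M by fact
  interpret N: prob_space N by fact
  interpret pair_prob_space M N ..
  interpret UM: prob_space "uniform_measure M A" using assms by (intro prob_space_uniform_measure) auto
  interpret UN: prob_space "uniform_measure N B" using assms by (intro prob_space_uniform_measure) auto
  have pos: "measure M A > 0" "measure N B > 0"
    using assms(5,6) by (simp_all add: M.emeasure_eq_measure N.emeasure_eq_measure zero_less_measure_iff)
  show ?thesis
  proof (rule pair_measure_eqI)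
    show "sets (uniform_measure M A \<Otimes>\<^sub>M uniform_measure N B) = sets (uniform_measure (M \<Otimes>\<^sub>M N) (A \<times> B))"
      unfolding sets_uniform_measure by (rule sets_pair_measure_cong) auto
    fix A' B' assume A': "A' \<in> sets (uniform_measure M A)" and B': "B' \<in> sets (uniform_measure N B)"
    have "emeasure (uniform_measure (M \<Otimes>\<^sub>M N) (A \<times> B)) (A' \<times> B')
        = emeasure (M \<Otimes>\<^sub>M N) ((A \<inter> A') \<times> (B \<inter> B')) / emeasure (M \<Otimes>\<^sub>M N) (A \<times> B)"
      using A' B' assms by (subst emeasure_uniform_measure) (auto simp: Times_Int_Times)
    also have "\<dots> = (emeasure M (A \<inter> A') * emeasure N (B \<inter> B')) / (emeasure M A * emeasure N B)"
      using A' B' assms by (simp add: N.emeasure_pair_measure_Times)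
    also have "\<dots> = emeasure M (A \<inter> A') / emeasure M A * (emeasure N (B \<inter> B') / emeasure N B)"
      using pos by (simp add: M.emeasure_eq_measure N.emeasure_eq_measure ennreal_mult[symmetric]
          divide_ennreal)
    finally show "emeasure (uniform_measure M A) A' * emeasure (uniform_measure N B) B' =
       emeasure (uniform_measure (M \<Otimes>\<^sub>M N) (A \<times> B)) (A' \<times> B')"
      using A' B' assms by simp
  qed unfold_locales
qed

text \<open>The density is 1 / P(A) on A, so the log-density is almost surely constant under the
  conditioned law. The complexity of the competitor is thus the negative logarithm of a prior
  mass.\<close>

lemma kl_uniform_measure:
  assumes "prob_space P" "A \<in> sets P" "measure P A > 0"
  shows "kl (uniform_measure P A) P = ereal (- ln (measure P A))"
proof -
  interpret P: prob_space P by fact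
  define Q where "Q = uniform_measure P A"
  have A0: "emeasure P A \<noteq> 0" using assms by (simp add: P.emeasure_eq_measure)
  interpret Q: prob_space Q
    unfolding Q_def using A0 by (intro prob_space_uniform_measure) auto
  have [measurable]: "A \<in> sets P" by fact
  have dens: "density P (\<lambda>x. indicator A x / emeasure P A) = Q"
    unfolding Q_def uniform_measure_def ..
  have [simp]: "sets Q = sets P" by (simp add: Q_def)
  have ac: "absolutely_continuous P Q"
    unfolding dens[symmetric] by (rule absolutely_continuousI_density) measurable
  have "AE x in P. indicator A x / emeasure P A = RN_deriv P Q x"
    by (rule P.RN_deriv_unique[OF _ dens]) measurable
  then have "AE x in P. x \<in> A \<longrightarrow> entropy_density (exp 1) P Q x = - ln (measure P A)"
  proof eventually_elim
    case (elim x)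
    then show ?case
      using assms(3) by (auto simp: entropy_density_def P.emeasure_eq_measure log_def ln_div
          divide_ennreal[of 1 "measure P A", simplified] elim[symmetric])
  qed
  then have ae: "AE x in Q. entropy_density (exp 1) P Q x = - ln (measure P A)"
    unfolding Q_def by (rule AE_uniform_measureI[rotated]) measurable
  have [measurable]: "entropy_density (exp 1) P Q \<in> borel_measurable Q"
    using measurable_entropy_density[of "exp 1" P Q] by (simp cong: measurable_cong_sets)
  have "integrable Q (entropy_density (exp 1) P Q)"
    using integrable_cong_AE[OF _ _ ae] by simp
  moreover have "KL_divergence (exp 1) P Q = - ln (measure P A)"
    unfolding KL_divergence_def using integral_cong_AE[OF _ _ ae] Q.prob_space by simp
  ultimately show ?thesis using ac by (simp add: kl_def Q_def)
qed

section \<open>Laws on the parameter space\<close>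

lemma AE_pair_fst:
  assumes "prob_space M" "prob_space N" "AE x in M. P x"
  shows "AE x in M \<Otimes>\<^sub>M N. P (fst x)"
proof -
  interpret N: prob_space N by fact
  interpret M: prob_space M by fact
  have d: "distr (M \<Otimes>\<^sub>M N) M fst = M"
    using N.distr_pair_fst[of M] M.prob_space_axioms by (simp add: N.emeasure_space_1)
  have "AE x in distr (M \<Otimes>\<^sub>M N) M fst. P x" unfolding d by (rule assms(3))
  then show ?thesis by (rule AE_distrD[rotated]) simp
qed

lemma AE_pair_snd:
  assumes "prob_space M" "prob_space N" "AE x in N. P x"
  shows "AE x in M \<Otimes>\<^sub>M N. P (snd x)"
proof -
  interpret N: prob_space N by fact
  interpret M: prob_space M by fact
  interpret pair_prob_space M N ..
  interpret NM: pair_prob_space N M ..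
  have "AE x in N \<Otimes>\<^sub>M M. P (fst x)" by (rule AE_pair_fst) fact+
  then have "AE x in distr (M \<Otimes>\<^sub>M N) (N \<Otimes>\<^sub>M M) (\<lambda>(x, y). (y, x)). P (fst x)"
    by (subst (asm) NM.distr_pair_swap) simp
  then have "AE x in M \<Otimes>\<^sub>M N. P (fst (case x of (x, y) \<Rightarrow> (y, x)))"
    by (rule AE_distrD[rotated]) simp
  then show ?thesis by (simp add: case_prod_beta)
qed

text \<open>The common sigma-algebra of the prior and of all mean-field laws: measurability is
  proved here once and then transported along equality of \<open>sets\<close>.\<close>

abbreviation param_space :: "nat \<Rightarrow> nat \<Rightarrow> nat \<Rightarrow> lda_param measure" where
  "param_space D K V \<equiv> (\<Pi>\<^sub>M d\<in>{..<D}. simplex_coords K) \<Otimes>\<^sub>M (\<Pi>\<^sub>M k\<in>{..<K}. simplex_coords V)"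

lemma sets_param_space_cong:
  assumes "\<And>d. d < D \<Longrightarrow> sets (M d) = sets (simplex_coords K)"
    "\<And>k. k < K \<Longrightarrow> sets (M' k) = sets (simplex_coords V)"
  shows "sets ((\<Pi>\<^sub>M d\<in>{..<D}. M d) \<Otimes>\<^sub>M (\<Pi>\<^sub>M k\<in>{..<K}. M' k)) = sets (param_space D K V)"
  using assms by (intro sets_pair_measure_cong sets_PiM_cong) auto

lemma product_law_props:
  fixes D K :: nat
  assumes "\<And>d. d < D \<Longrightarrow> prob_space (M d)" "\<And>k. k < K \<Longrightarrow> prob_space (M' k)"
    "\<And>d. d < D \<Longrightarrow> AE x in M d. P d x" "\<And>k. k < K \<Longrightarrow> AE x in M' k. P' k x"
  shows "prob_space ((\<Pi>\<^sub>M d\<in>{..<D}. M d) \<Otimes>\<^sub>M (\<Pi>\<^sub>M k\<in>{..<K}. M' k))" (is "prob_space (?A \<Otimes>\<^sub>M ?B)")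
    and "AE \<theta> in (\<Pi>\<^sub>M d\<in>{..<D}. M d) \<Otimes>\<^sub>M (\<Pi>\<^sub>M k\<in>{..<K}. M' k).
      (\<forall>d<D. P d (fst \<theta> d)) \<and> (\<forall>k<K. P' k (snd \<theta> k))"
proof -
  have A: "prob_space ?A" and B: "prob_space ?B" using assms by (auto intro!: prob_space_PiM)
  interpret A: prob_space ?A by (rule A)
  interpret B: prob_space ?B by (rule B)
  interpret pair_prob_space ?A ?B ..
  show "prob_space (?A \<Otimes>\<^sub>M ?B)" by unfold_locales
  have "AE x in ?A. \<forall>d\<in>{..<D}. P d (x d)"
    by (rule AE_finite_allI) (use assms in \<open>auto intro!: AE_PiM_component\<close>)
  moreover have "AE x in ?B. \<forall>k\<in>{..<K}. P' k (x k)"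
    by (rule AE_finite_allI) (use assms in \<open>auto intro!: AE_PiM_component\<close>)
  ultimately have "AE \<theta> in ?A \<Otimes>\<^sub>M ?B. \<forall>d\<in>{..<D}. P d (fst \<theta> d)" "AE \<theta> in ?A \<Otimes>\<^sub>M ?B. \<forall>k\<in>{..<K}. P' k (snd \<theta> k)"
    using AE_pair_fst[OF A B] AE_pair_snd[OF A B] by blast+
  then
  show "AE \<theta> in ?A \<Otimes>\<^sub>M ?B. (\<forall>d<D. P d (fst \<theta> d)) \<and> (\<forall>k<K. P' k (snd \<theta> k))"
    by eventually_elim auto
qed

lemma prior_props:
  assumes "K \<ge> 1" "V \<ge> 1"
  shows prob_space_lda_prior: "prob_space (lda_prior c D K V)"
    and sets_lda_prior: "sets (lda_prior c D K V) = sets (param_space D K V)"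
    and AE_lda_prior: "AE \<theta> in lda_prior c D K V.
      (\<forall>d<D. (\<forall>k<K. 0 < fst \<theta> d k) \<and> (\<Sum>k<K. fst \<theta> d k) = 1) \<and>
      (\<forall>k<K. (\<forall>v<V. 0 < snd \<theta> k v) \<and> (\<Sum>v<V. snd \<theta> k v) = 1)"
  unfolding lda_prior_def
proof -
  let ?G = "\<lambda>_::nat. dirichlet K (1 / real K powr c)" and ?B = "\<lambda>_::nat. dirichlet V (1 / real V powr c)"
  show "prob_space ((\<Pi>\<^sub>M d\<in>{..<D}. ?G d) \<Otimes>\<^sub>M (\<Pi>\<^sub>M k\<in>{..<K}. ?B k))"
    by (rule product_law_props(1)[where P = "\<lambda>_ _. True" and P' = "\<lambda>_ _. True"])
       (use assms in \<open>auto intro!: prob_space_dirichlet\<close>)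
  show "sets ((\<Pi>\<^sub>M d\<in>{..<D}. ?G d) \<Otimes>\<^sub>M (\<Pi>\<^sub>M k\<in>{..<K}. ?B k)) = sets (param_space D K V)"
    by (rule sets_param_space_cong) simp_all
  show "AE \<theta> in (\<Pi>\<^sub>M d\<in>{..<D}. ?G d) \<Otimes>\<^sub>M (\<Pi>\<^sub>M k\<in>{..<K}. ?B k).
      (\<forall>d<D. (\<forall>k<K. 0 < fst \<theta> d k) \<and> (\<Sum>k<K. fst \<theta> d k) = 1) \<and>
      (\<forall>k<K. (\<forall>v<V. 0 < snd \<theta> k v) \<and> (\<Sum>v<V. snd \<theta> k v) = 1)"
    by (rule product_law_props(2); (rule AE_dirichlet_pos prob_space_dirichlet; use assms in simp))
qed

section \<open>Change of measure\<close>

text \<open>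
  The bound is the elementary inequality \<open>ln u \<le> u - 1\<close> for \<open>u = exp (a + R) / (M f)\<close>, where \<open>f\<close> is
  the density of \<open>Q\<close> with respect to \<open>P\<close>, integrated over \<open>Q\<close>.
\<close>
lemma change_of_measure_bound:
  assumes P: "prob_space P" and Q: "prob_space Q" and sets: "sets Q = sets P"
    and kl: "kl Q P \<noteq> \<infinity>"
    and a [measurable]: "a \<in> borel_measurable P" and R [measurable]: "R \<in> borel_measurable P"
    and R0: "AE x in Q. 0 \<le> R x" and int_a: "integrable Q a"
    and exp_moment: "(\<integral>\<^sup>+x. ennreal (exp (a x + R x)) \<partial>P) \<le> ennreal M" and M: "0 < M"
  shows "(\<integral>\<^sup>+x. ennreal (R x) \<partial>Q) \<le> ennreal (real_of_ereal (kl Q P) + ln M - (\<integral>x. a x \<partial>Q))"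
    and "0 \<le> real_of_ereal (kl Q P) + ln M - (\<integral>x. a x \<partial>Q)"
proof -
  interpret P: prob_space P by fact
  interpret Q: prob_space Q by fact
  define f where "f = (\<lambda>x. enn2real (RN_deriv P Q x))"
  have [measurable]: "f \<in> borel_measurable P" by (auto simp: f_def)
  have mQ: "g \<in> borel_measurable Q \<longleftrightarrow> g \<in> borel_measurable P" for g :: "_ \<Rightarrow> real"
    using measurable_cong_sets[OF sets refl] by blast
  have mQe: "g \<in> borel_measurable Q \<longleftrightarrow> g \<in> borel_measurable P" for g :: "_ \<Rightarrow> ennreal"
    using measurable_cong_sets[OF sets refl] by blast
  from kl have ac: "absolutely_continuous P Q"
    and int: "integrable Q (entropy_density (exp 1) P Q)"
    and KL: "kl Q P = ereal (KL_divergence (exp 1) P Q)"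
    by (auto simp: kl_def split: if_splits)
  have ed: "entropy_density (exp 1) P Q = (\<lambda>x. ln (f x))"
    by (auto simp: entropy_density_def f_def log_def)
  have fin: "AE x in P. RN_deriv P Q x \<noteq> \<infinity>"
    by (rule P.RN_deriv_finite[OF _ ac sets]) unfold_locales
  then have fin': "AE x in P. RN_deriv P Q x = ennreal (f x)"
    by eventually_elim (simp add: f_def less_top)
  have dens: "density P (\<lambda>x. ennreal (f x)) = Q"
  proof -
    have "density P (\<lambda>x. ennreal (f x)) = density P (RN_deriv P Q)"
      using fin' by (intro density_cong) auto
    then show ?thesis using P.density_RN_deriv[OF ac sets] by simp
  qed
  have fpos: "AE x in Q. 0 < f x"
  proof -
    have "AE x in density P (\<lambda>x. ennreal (f x)). 0 < f x" by (subst AE_density) auto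
    then show ?thesis by (simp only: dens)
  qed
  define u where "u = (\<lambda>x. exp (a x + R x) / (f x * M))"
  have [measurable]: "u \<in> borel_measurable P" by (simp add: u_def)
  have u0: "0 \<le> u x" for x using M by (auto simp: u_def f_def)
  have "(\<integral>\<^sup>+x. ennreal (u x) \<partial>Q) = (\<integral>\<^sup>+x. ennreal (f x) * ennreal (u x) \<partial>P)"
    unfolding dens[symmetric] by (rule nn_integral_density) auto
  \<comment> \<open>Equality holds wherever \<open>f\<close> is positive. Where \<open>f\<close>
    vanishes, the left side is 0 and the right side positive, so the change of measure only gives an
    inequality.\<close>
  also have "\<dots> \<le> (\<integral>\<^sup>+x. ennreal (1 / M) * ennreal (exp (a x + R x)) \<partial>P)"
  proof (rule nn_integral_mono)
    fix x
    have "0 \<le> f x" by (simp add: f_def)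
    then have "f x * u x \<le> 1 / M * exp (a x + R x)"
      using M by (cases "f x = 0") (auto simp: u_def)
    then show "ennreal (f x) * ennreal (u x) \<le> ennreal (1 / M) * ennreal (exp (a x + R x))"
      using M \<open>0 \<le> f x\<close> u0 by (simp add: ennreal_mult[symmetric] ennreal_leI)
  qed
  also have "\<dots> = ennreal (1 / M) * (\<integral>\<^sup>+x. ennreal (exp (a x + R x)) \<partial>P)"
    by (rule nn_integral_cmult) measurable
  also have "\<dots> \<le> ennreal (1 / M) * ennreal M" by (intro mult_left_mono exp_moment) auto
  also have "\<dots> = 1" using M by (simp add: ennreal_mult[symmetric])
  finally have u1: "(\<integral>\<^sup>+x. ennreal (u x) \<partial>Q) \<le> 1" .
  have int_u: "integrable Q u"
    using u1 u0 by (intro integrableI_nonneg) (auto simp: mQ intro: le_less_trans)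
  have "ennreal (\<integral>x. u x \<partial>Q) \<le> 1"
    using u1 nn_integral_eq_integral[OF int_u] u0 by simp
  then have int_u1: "(\<integral>x. u x \<partial>Q) \<le> 1" by simp
  \<comment> \<open>Integrability of \<open>R\<close> under \<open>Q\<close> is not known in
    advance. \<open>T\<close> is an integrable majorant, and its integral is at most the claimed
    bound because \<open>u\<close> has integral at most 1.\<close>
  define T where "T = (\<lambda>x. ln (f x) + ln M - a x + u x - 1)"
  have int_f: "integrable Q (\<lambda>x. ln (f x))" using int by (simp add: ed)
  have int_T: "integrable Q T"
    unfolding T_def using int_f int_a int_u by auto
  have RT: "AE x in Q. R x \<le> T x"
    using fpos
  proof eventually_elim
    case (elim x)
    then have "0 < u x" using M by (simp add: u_def)
    then have "ln (u x) \<le> u x - 1" by (rule ln_le_minus_one)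
    moreover have "ln (u x) = a x + R x - (ln (f x) + ln M)"
      using elim M by (simp add: u_def ln_div ln_mult)
    ultimately show ?case by (simp add: T_def)
  qed
  have T0: "AE x in Q. 0 \<le> T x" using RT R0 by eventually_elim auto
  have "(\<integral>x. T x \<partial>Q) = (\<integral>x. ln (f x) \<partial>Q) + ln M - (\<integral>x. a x \<partial>Q) + (\<integral>x. u x \<partial>Q) - 1"
    unfolding T_def using int_f int_a int_u by (simp add: Q.prob_space)
  also have "(\<integral>x. ln (f x) \<partial>Q) = real_of_ereal (kl Q P)"
    by (simp add: KL KL_divergence_def ed)
  finally have le: "(\<integral>x. T x \<partial>Q) \<le> real_of_ereal (kl Q P) + ln M - (\<integral>x. a x \<partial>Q)"
    using int_u1 by simp
  have "(\<integral>\<^sup>+x. ennreal (R x) \<partial>Q) \<le> (\<integral>\<^sup>+x. ennreal (T x) \<partial>Q)"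
    using RT by (intro nn_integral_mono_AE) (auto intro: ennreal_leI)
  also have "\<dots> = ennreal (\<integral>x. T x \<partial>Q)"
    by (rule nn_integral_eq_integral[OF int_T T0])
  also have "\<dots> \<le> ennreal (real_of_ereal (kl Q P) + ln M - (\<integral>x. a x \<partial>Q))"
    using le by (rule ennreal_leI)
  finally show "(\<integral>\<^sup>+x. ennreal (R x) \<partial>Q) \<le> ennreal (real_of_ereal (kl Q P) + ln M - (\<integral>x. a x \<partial>Q))" .
  show "0 \<le> real_of_ereal (kl Q P) + ln M - (\<integral>x. a x \<partial>Q)"
    using integral_nonneg_AE[OF T0] le by simp
qed

text \<open>The second conclusion of the change of measure for a = R = 0 and M = 1.\<close>

lemma kl_nonneg:
  assumes "prob_space P" "prob_space Q" "sets Q = sets P"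
  shows "0 \<le> kl Q P"
proof (cases "kl Q P = \<infinity>")
  case False
  have "0 \<le> real_of_ereal (kl Q P) + ln 1 - (\<integral>x. 0 \<partial>Q)"
    by (rule change_of_measure_bound(2)[where R = "\<lambda>_. 0"])
       (use assms False prob_space.emeasure_space_1[of P] in auto)
  then show ?thesis using False by (cases "kl Q P") (auto simp: kl_def split: if_splits)
qed simp

text \<open>The negative part has integral at most b, so the difference of the two parts is never of
  the form \<infinity> - \<infinity>. The positive part may still be infinite.\<close>

lemma ext_integral_AE_ge:
  assumes "prob_space M" "AE x in M. ereal (- b) \<le> f x" "0 \<le> b"
  shows "ereal (- b) \<le> ext_integral M f"
proof -
  interpret prob_space M by fact
  have "(\<integral>\<^sup>+x. e2ennreal (- f x) \<partial>M) \<le> (\<integral>\<^sup>+x. ennreal b \<partial>M)"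
  proof (rule nn_integral_mono_AE, use assms(2) in eventually_elim)
    case (elim x)
    then have "- f x \<le> ereal b" by (cases "f x") auto
    then show ?case using e2ennreal_mono by fastforce
  qed
  also have "\<dots> = ennreal b" by (simp add: emeasure_space_1)
  finally have "enn2ereal (\<integral>\<^sup>+x. e2ennreal (- f x) \<partial>M) \<le> ereal b"
    using assms(3) by (metis enn2ereal_ennreal less_eq_ennreal.rep_eq)
  moreover have "0 \<le> enn2ereal (\<integral>\<^sup>+x. e2ennreal (f x) \<partial>M)" by simp
  ultimately show ?thesis
    unfolding ext_integral_def
    by (cases "enn2ereal (\<integral>\<^sup>+x. e2ennreal (- f x) \<partial>M)"; cases "enn2ereal (\<integral>\<^sup>+x. e2ennreal (f x) \<partial>M)") auto
qed

text \<open>An upper bound makes the integral of the positive part finite. This excludes that an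
  infinite data term offsets an infinite divergence in the objective.\<close>

lemma ext_integral_AE_less_top:
  assumes "prob_space M" "AE x in M. f x \<le> ereal b"
  shows "ext_integral M f \<noteq> \<infinity>"
proof -
  interpret prob_space M by fact
  have "(\<integral>\<^sup>+x. e2ennreal (f x) \<partial>M) \<le> (\<integral>\<^sup>+x. ennreal b \<partial>M)"
    using assms(2) by (intro nn_integral_mono_AE) (auto elim!: eventually_mono dest: e2ennreal_mono)
  also have "\<dots> < \<infinity>" by (simp add: emeasure_space_1)
  finally have "enn2ereal (\<integral>\<^sup>+x. e2ennreal (f x) \<partial>M) \<noteq> \<infinity>"
    by (metis enn2ereal_eq_top_iff infinity_ennreal_def less_irrefl top_ereal_def)
  moreover have "0 \<le> enn2ereal (\<integral>\<^sup>+x. e2ennreal (- f x) \<partial>M)" by simp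
  ultimately show ?thesis
    unfolding ext_integral_def
    by (cases "enn2ereal (\<integral>\<^sup>+x. e2ennreal (- f x) \<partial>M)"; cases "enn2ereal (\<integral>\<^sup>+x. e2ennreal (f x) \<partial>M)") auto
qed

text \<open>Since \<open>f\<close> is bounded above, an infinite integral of its negative part would
  make the extended integral - \<infinity>; hence \<open>g\<close> is integrable, and
  \<open>l\<close>, caught between \<open>g\<close> and a constant, is integrable as well. It is
  applied with \<open>g\<close> the evidence lower bound and \<open>l\<close> the log-likelihood
  ratio.\<close>

lemma ext_integral_le_integral:
  fixes g l :: "'a \<Rightarrow> real"
  assumes M: "prob_space M" and fg: "AE x in M. f x = ereal (g x)"
    and [measurable]: "g \<in> borel_measurable M" "l \<in> borel_measurable M"
    and gl: "AE x in M. g x \<le> l x" and lb: "AE x in M. l x \<le> b"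
    and fin: "ext_integral M f \<noteq> - \<infinity>"
  shows "integrable M l" "ext_integral M f \<le> ereal (\<integral>x. l x \<partial>M)"
proof -
  interpret prob_space M by fact
  have pos: "(\<integral>\<^sup>+x. e2ennreal (f x) \<partial>M) = (\<integral>\<^sup>+x. ennreal (g x) \<partial>M)"
    using fg by (intro nn_integral_cong_AE) (auto elim!: eventually_mono simp: e2ennreal_ereal)
  have neg: "(\<integral>\<^sup>+x. e2ennreal (- f x) \<partial>M) = (\<integral>\<^sup>+x. ennreal (- g x) \<partial>M)"
    using fg by (intro nn_integral_cong_AE) (auto elim!: eventually_mono simp: e2ennreal_ereal)
  have gb: "AE x in M. g x \<le> b" using gl lb by eventually_elim auto
  have "(\<integral>\<^sup>+x. ennreal (g x) \<partial>M) \<le> (\<integral>\<^sup>+x. ennreal b \<partial>M)"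
    using gb by (intro nn_integral_mono_AE) (auto intro: ennreal_leI)
  also have "\<dots> < \<infinity>" by (simp add: emeasure_space_1)
  finally have pf: "(\<integral>\<^sup>+x. ennreal (g x) \<partial>M) \<noteq> \<infinity>" by simp
  have nf: "(\<integral>\<^sup>+x. ennreal (- g x) \<partial>M) \<noteq> \<infinity>"
  proof
    assume "(\<integral>\<^sup>+x. ennreal (- g x) \<partial>M) = \<infinity>"
    moreover obtain r where "(\<integral>\<^sup>+x. ennreal (g x) \<partial>M) = ennreal r" "0 \<le> r"
      using pf by (cases "(\<integral>\<^sup>+x. ennreal (g x) \<partial>M)") auto
    ultimately have "ext_integral M f = - \<infinity>"
      unfolding ext_integral_def pos neg by simp
    then show False using fin by simp
  qed
  have int_g: "integrable M g"
    using pf nf by (subst real_integrable_def) auto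
  show int_l: "integrable M l"
  proof (rule Bochner_Integration.integrable_bound)
    show "integrable M (\<lambda>x. \<bar>g x\<bar> + \<bar>b\<bar>)" using int_g by auto
    show "AE x in M. norm (l x) \<le> norm (\<bar>g x\<bar> + \<bar>b\<bar>)"
      using gl lb by eventually_elim auto
  qed measurable
  obtain r s where "(\<integral>\<^sup>+x. ennreal (g x) \<partial>M) = ennreal r" "0 \<le> r"
    "(\<integral>\<^sup>+x. ennreal (- g x) \<partial>M) = ennreal s" "0 \<le> s"
    using pf nf by (cases "(\<integral>\<^sup>+x. ennreal (g x) \<partial>M)"; cases "(\<integral>\<^sup>+x. ennreal (- g x) \<partial>M)") auto
  then have "ext_integral M f = ereal (\<integral>x. g x \<partial>M)"
    unfolding ext_integral_def pos neg real_lebesgue_integral_def[OF int_g] by simp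
  also have "\<dots> \<le> ereal (\<integral>x. l x \<partial>M)" using integral_mono_AE[OF int_g int_l gl] by simp
  finally show "ext_integral M f \<le> ereal (\<integral>x. l x \<partial>M)" .
qed

section \<open>Likelihood and affinity\<close>

abbreviation words :: "nat \<Rightarrow> nat \<Rightarrow> (nat \<Rightarrow> nat) set" where
  "words D V \<equiv> {..<D} \<rightarrow>\<^sub>E {..<V}"

abbreviation datasets :: "nat \<Rightarrow> nat \<Rightarrow> nat \<Rightarrow> (nat \<Rightarrow> nat \<Rightarrow> nat) set" where
  "datasets D V N \<equiv> {..<N} \<rightarrow>\<^sub>E words D V"

definition simplex_param :: "nat \<Rightarrow> nat \<Rightarrow> nat \<Rightarrow> lda_param \<Rightarrow> bool" where
  "simplex_param D K V \<theta> \<longleftrightarrow>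
     (\<forall>d<D. fst \<theta> d \<in> prob_simplex K) \<and> (\<forall>k<K. snd \<theta> k \<in> prob_simplex V)"

text \<open>The prior charges only such parameters, and a law of finite divergence from the prior
  inherits this. On them all likelihoods are positive and every logarithm is a genuine one.\<close>

definition positive_param :: "nat \<Rightarrow> nat \<Rightarrow> nat \<Rightarrow> lda_param \<Rightarrow> bool" where
  "positive_param D K V \<theta> \<longleftrightarrow>
     (\<forall>d<D. \<forall>k<K. 0 < fst \<theta> d k) \<and> (\<forall>k<K. \<forall>v<V. 0 < snd \<theta> k v)"

definition lik :: "nat \<Rightarrow> nat \<Rightarrow> nat \<Rightarrow> lda_param \<Rightarrow> (nat \<Rightarrow> nat \<Rightarrow> nat) \<Rightarrow> real" where
  "lik D K N \<theta> w = (\<Prod>n<N. obs_mass D K \<theta> (w n))"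

definition affinity :: "real \<Rightarrow> nat \<Rightarrow> nat \<Rightarrow> nat \<Rightarrow> lda_param \<Rightarrow> lda_param \<Rightarrow> real" where
  "affinity \<alpha> D K V \<theta> \<theta>s =
     (\<Sum>y\<in>words D V. obs_mass D K \<theta> y powr \<alpha> * obs_mass D K \<theta>s y powr (1 - \<alpha>))"

lemma finite_words [simp]: "finite (words D V)" and finite_datasets [simp]: "finite (datasets D V N)"
  by (auto intro!: finite_PiE)

lemma words_less: "y \<in> words D V \<Longrightarrow> d < D \<Longrightarrow> y d < V"
  by auto

lemma datasets_words: "w \<in> datasets D V N \<Longrightarrow> n < N \<Longrightarrow> w n \<in> words D V"
  by (drule PiE_mem[where x = n]; simp)

lemma datasets_less: "w \<in> datasets D V N \<Longrightarrow> n < N \<Longrightarrow> d < D \<Longrightarrow> w n d < V"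
  using datasets_words words_less by blast

lemma affinity_eq_integral:
  "(LINT y|obs_count D V. obs_mass D K \<theta> y powr \<alpha> * obs_mass D K \<theta>s y powr (1 - \<alpha>)) = affinity \<alpha> D K V \<theta> \<theta>s"
  unfolding obs_count_def affinity_def by (rule lebesgue_integral_count_space_finite) simp

lemma obs_mass_nonneg:
  assumes "simplex_param D K V \<theta>" "y \<in> words D V"
  shows "0 \<le> obs_mass D K \<theta> y"
  unfolding obs_mass_def
  using assms words_less[OF assms(2)]
  by (intro prod_nonneg sum_nonneg mult_nonneg_nonneg ballI)
     (auto simp: simplex_param_def prob_simplex_def)

lemma obs_mass_pos:
  assumes "positive_param D K V \<theta>" "y \<in> words D V" "K \<ge> 1"
  shows "0 < obs_mass D K \<theta> y"
  unfolding obs_mass_def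
proof (intro prod_pos sum_pos)
  show "{..<K} \<noteq> {}" using assms(3) by (auto simp: lessThan_empty_iff)
qed (use assms words_less[OF assms(2)] in \<open>auto simp: positive_param_def\<close>)

lemma sum_obs_mass:
  assumes "simplex_param D K V \<theta>"
  shows "(\<Sum>y\<in>words D V. obs_mass D K \<theta> y) = 1"
proof -
  have "(\<Sum>y\<in>words D V. obs_mass D K \<theta> y) = (\<Prod>d<D. \<Sum>v<V. \<Sum>k<K. fst \<theta> d k * snd \<theta> k v)"
    unfolding obs_mass_def by (subst prod_sum_PiE) auto
  also have "\<dots> = (\<Prod>d<D. \<Sum>k<K. fst \<theta> d k * (\<Sum>v<V. snd \<theta> k v))"
    by (intro prod.cong refl) (subst sum.swap, simp add: sum_distrib_left)
  also have "\<dots> = (\<Prod>d<D. \<Sum>k<K. fst \<theta> d k)"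
    using assms by (intro prod.cong sum.cong refl) (auto simp: simplex_param_def prob_simplex_def)
  also have "\<dots> = 1"
    using assms by (intro prod.neutral) (auto simp: simplex_param_def prob_simplex_def)
  finally show ?thesis .
qed

lemma obs_mass_le_1:
  assumes "simplex_param D K V \<theta>" "y \<in> words D V"
  shows "obs_mass D K \<theta> y \<le> 1"
proof -
  have "obs_mass D K \<theta> y \<le> (\<Sum>y\<in>words D V. obs_mass D K \<theta> y)"
    using assms by (intro member_le_sum) (auto intro: obs_mass_nonneg)
  then show ?thesis using sum_obs_mass[OF assms(1)] by simp
qed

lemma lik_bounds:
  assumes "simplex_param D K V \<theta>" "w \<in> datasets D V N"
  shows "0 \<le> lik D K N \<theta> w" "lik D K N \<theta> w \<le> 1"
proof -
  have "0 \<le> obs_mass D K \<theta> (w n) \<and> obs_mass D K \<theta> (w n) \<le> 1" if "n < N" for n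
    using obs_mass_nonneg[OF assms(1)] obs_mass_le_1[OF assms(1)] datasets_words[OF assms(2) that] by blast
  then show "0 \<le> lik D K N \<theta> w" "lik D K N \<theta> w \<le> 1"
    unfolding lik_def by (auto intro!: prod_nonneg prod_le_1)
qed

lemma lik_pos:
  assumes "positive_param D K V \<theta>" "w \<in> datasets D V N" "K \<ge> 1"
  shows "0 < lik D K N \<theta> w"
  unfolding lik_def using obs_mass_pos[OF assms(1) datasets_words[OF assms(2)] assms(3)]
  by (auto intro!: prod_pos)

lemma set_data_law:
  assumes \<theta>: "simplex_param D K V \<theta>"
  shows "set_pmf (data_law D K V N \<theta>) \<subseteq> datasets D V N"
    and "w \<in> datasets D V N \<Longrightarrow> pmf (data_law D K V N \<theta>) w = lik D K N \<theta> w"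
proof -
  have "set_pmf (word_law K V \<theta> d) \<subseteq> {..<V}" if "d < D" for d
  proof -
    have "z < K" if "z \<in> set_pmf (categorical K (fst \<theta> d))" for z
      using \<theta> that \<open>d < D\<close> by (auto simp: set_pmf_eq pmf_categorical simplex_param_def split: if_splits)
    moreover have "v < V" if "z < K" "v \<in> set_pmf (categorical V (snd \<theta> z))" for z v
      using \<theta> that by (auto simp: set_pmf_eq pmf_categorical simplex_param_def split: if_splits)
    ultimately show ?thesis by (force simp: word_law_def)
  qed
  then have "set_pmf (obs_law D K V \<theta>) \<subseteq> words D V"
    unfolding obs_law_def by (subst set_Pi_pmf) (auto simp: PiE_dflt_def PiE_def extensional_def)
  then show "set_pmf (data_law D K V N \<theta>) \<subseteq> datasets D V N"
    unfolding data_law_def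
    by (subst set_Pi_pmf) (auto simp: PiE_dflt_def PiE_def extensional_def)
  assume w: "w \<in> datasets D V N"
  have "pmf (data_law D K V N \<theta>) w = (\<Prod>n<N. pmf (obs_law D K V \<theta>) (w n))"
    unfolding data_law_def using w by (subst pmf_Pi) (auto simp: PiE_def extensional_def)
  also have "\<dots> = lik D K N \<theta> w"
    unfolding lik_def using \<theta> w
    by (intro prod.cong refl pmf_obs_law) (auto simp: simplex_param_def)
  finally show "pmf (data_law D K V N \<theta>) w = lik D K N \<theta> w" .
qed

text \<open>Weighted AM-GM, from convexity of exp at ln x and ln y.\<close>

lemma young_powr:
  fixes x y :: real
  assumes "0 \<le> x" "0 \<le> y" "0 < \<alpha>" "\<alpha> \<le> 1"
  shows "x powr \<alpha> * y powr (1 - \<alpha>) \<le> \<alpha> * x + (1 - \<alpha>) * y"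
proof (cases "x = 0 \<or> y = 0")
  case False
  then have "0 < x" "0 < y" using assms by auto
  have "exp (\<alpha> * ln x + (1 - \<alpha>) * ln y) \<le> \<alpha> * exp (ln x) + (1 - \<alpha>) * exp (ln y)"
    using convex_onD[OF exp_convex, of "1 - \<alpha>" "ln x" "ln y"] assms by simp
  then show ?thesis using \<open>0 < x\<close> \<open>0 < y\<close> by (simp add: powr_def exp_add)
qed (use assms in auto)

text \<open>AM-GM summed over two mass functions of total mass 1. It makes \<open>- ln\<close> of
  the affinity nonnegative, as the change of measure demands of its remainder
  \<open>R\<close>.\<close>

lemma affinity_le_1:
  assumes "simplex_param D K V \<theta>" "simplex_param D K V \<theta>s" "0 < \<alpha>" "\<alpha> < 1"
  shows "affinity \<alpha> D K V \<theta> \<theta>s \<le> 1"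
proof -
  have "affinity \<alpha> D K V \<theta> \<theta>s \<le>
     (\<Sum>y\<in>words D V. \<alpha> * obs_mass D K \<theta> y + (1 - \<alpha>) * obs_mass D K \<theta>s y)"
    unfolding affinity_def using assms by (intro sum_mono young_powr obs_mass_nonneg) auto
  also have "\<dots> = 1"
    using sum_obs_mass[OF assms(1)] sum_obs_mass[OF assms(2)]
    by (simp add: sum.distrib flip: sum_distrib_left)
  finally show ?thesis .
qed

lemma affinity_nonneg: "0 \<le> affinity \<alpha> D K V \<theta> \<theta>s"
  unfolding affinity_def by (intro sum_nonneg) auto

text \<open>A positive parameter gives mass to some word vector charged by the truth, which keeps
  the Renyi divergence out of its infinite branch.\<close>

lemma affinity_pos:
  assumes "positive_param D K V \<theta>" "simplex_param D K V \<theta>s" "K \<ge> 1"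
  shows "0 < affinity \<alpha> D K V \<theta> \<theta>s"
proof -
  have "\<exists>y\<in>words D V. obs_mass D K \<theta>s y \<noteq> 0"
  proof (rule ccontr)
    assume "\<not> ?thesis"
    then have "(\<Sum>y\<in>words D V. obs_mass D K \<theta>s y) = 0" by (intro sum.neutral) auto
    then show False using sum_obs_mass[OF assms(2)] by simp
  qed
  then obtain y where y: "y \<in> words D V" "obs_mass D K \<theta>s y \<noteq> 0" by blast
  then have "0 < obs_mass D K \<theta>s y" using obs_mass_nonneg[OF assms(2)] by fastforce
  then show ?thesis
    unfolding affinity_def using y obs_mass_pos[OF assms(1) y(1) assms(3)]
    by (intro sum_pos2[of _ y]) auto
qed

lemma renyi_div_eq:
  assumes "0 < affinity \<alpha> D K V \<theta> \<theta>s" "\<alpha> < 1"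
  shows "renyi_div (obs_count D V) \<alpha> (obs_mass D K \<theta>) (obs_mass D K \<theta>s)
    = ennreal (- ln (affinity \<alpha> D K V \<theta> \<theta>s) / (1 - \<alpha>))"
  unfolding renyi_div_def affinity_eq_integral Let_def
  using assms minus_divide_right[of "ln (affinity \<alpha> D K V \<theta> \<theta>s)" "1 - \<alpha>"] by simp

text \<open>Weighting by the true likelihood turns the power of the ratio into a product of
  one-observation terms, and summing over a product space factorizes. Data of true likelihood 0
  contribute 0 on both sides because 0 powr (1 - \<alpha>) = 0.\<close>

lemma sum_lik_tilted:
  assumes \<theta>: "simplex_param D K V \<theta>" and \<theta>s: "simplex_param D K V \<theta>s" and \<alpha>: "0 < \<alpha>" "\<alpha> < 1"
  shows "(\<Sum>w\<in>datasets D V N. lik D K N \<theta>s w * (lik D K N \<theta> w / lik D K N \<theta>s w) powr \<alpha>)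
     \<le> affinity \<alpha> D K V \<theta> \<theta>s ^ N"
proof -
  have "lik D K N \<theta>s w * (lik D K N \<theta> w / lik D K N \<theta>s w) powr \<alpha> =
      (\<Prod>n<N. obs_mass D K \<theta> (w n) powr \<alpha> * obs_mass D K \<theta>s (w n) powr (1 - \<alpha>))"
    if w: "w \<in> datasets D V N" for w
  proof (cases "lik D K N \<theta>s w = 0")
    case True
    then obtain n where "n < N" "obs_mass D K \<theta>s (w n) = 0" by (auto simp: lik_def)
    then have "(\<Prod>n<N. obs_mass D K \<theta> (w n) powr \<alpha> * obs_mass D K \<theta>s (w n) powr (1 - \<alpha>)) = 0"
      by (intro prod_zero) auto
    then show ?thesis using True by simp
  next
    case False
    then have pos: "0 < obs_mass D K \<theta>s (w n)" if "n < N" for n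
    proof -
      have "obs_mass D K \<theta>s (w n) \<noteq> 0" using False that by (auto simp: lik_def)
      then show ?thesis using obs_mass_nonneg[OF \<theta>s datasets_words[OF w that]] by simp
    qed
    have "lik D K N \<theta>s w * (lik D K N \<theta> w / lik D K N \<theta>s w) powr \<alpha> =
       lik D K N \<theta> w powr \<alpha> * lik D K N \<theta>s w powr (1 - \<alpha>)"
      using lik_bounds(1)[OF \<theta> w] lik_bounds(1)[OF \<theta>s w] False
      by (simp add: powr_divide powr_diff)
    also have "\<dots> = (\<Prod>n<N. obs_mass D K \<theta> (w n) powr \<alpha>) * (\<Prod>n<N. obs_mass D K \<theta>s (w n) powr (1 - \<alpha>))"
      unfolding lik_def
      using obs_mass_nonneg[OF \<theta> datasets_words[OF w]] obs_mass_nonneg[OF \<theta>s datasets_words[OF w]]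
      by (subst (1 2) prod_powr_distrib) auto
    finally show ?thesis by (simp add: prod.distrib)
  qed
  then have "(\<Sum>w\<in>datasets D V N. lik D K N \<theta>s w * (lik D K N \<theta> w / lik D K N \<theta>s w) powr \<alpha>) =
     (\<Sum>w\<in>datasets D V N. \<Prod>n<N. obs_mass D K \<theta> (w n) powr \<alpha> * obs_mass D K \<theta>s (w n) powr (1 - \<alpha>))"
    by (intro sum.cong) auto
  also have "\<dots> = (\<Prod>n<N. affinity \<alpha> D K V \<theta> \<theta>s)"
    unfolding affinity_def by (subst prod_sum_PiE) auto
  finally show ?thesis by simp
qed

section \<open>Measurability in the parameter\<close>

lemma fst_param_measurable:
  "d < D \<Longrightarrow> k < K \<Longrightarrow> (\<lambda>\<theta>. fst \<theta> d k) \<in> borel_measurable (param_space D K V)"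
proof -
  assume "d < D" "k < K"
  then have [measurable]: "(\<lambda>g. g d) \<in> (\<Pi>\<^sub>M d\<in>{..<D}. simplex_coords K) \<rightarrow>\<^sub>M simplex_coords K"
    "(\<lambda>x. x k) \<in> borel_measurable (simplex_coords K)"
    by (auto simp: simplex_coords_def)
  show ?thesis by measurable
qed

lemma snd_param_measurable:
  "k < K \<Longrightarrow> v < V \<Longrightarrow> (\<lambda>\<theta>. snd \<theta> k v) \<in> borel_measurable (param_space D K V)"
proof -
  assume "k < K" "v < V"
  then have [measurable]: "(\<lambda>g. g k) \<in> (\<Pi>\<^sub>M k\<in>{..<K}. simplex_coords V) \<rightarrow>\<^sub>M simplex_coords V"
    "(\<lambda>x. x v) \<in> borel_measurable (simplex_coords V)"
    by (auto simp: simplex_coords_def)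
  show ?thesis by measurable
qed

lemma obs_mass_measurable:
  assumes "y \<in> words D V"
  shows "(\<lambda>\<theta>. obs_mass D K \<theta> y) \<in> borel_measurable (param_space D K V)"
  unfolding obs_mass_def using assms words_less[OF assms]
  by (intro borel_measurable_prod borel_measurable_sum borel_measurable_times
      fst_param_measurable snd_param_measurable) auto

lemma lik_measurable:
  assumes "w \<in> datasets D V N"
  shows "(\<lambda>\<theta>. lik D K N \<theta> w) \<in> borel_measurable (param_space D K V)"
  unfolding lik_def using datasets_words[OF assms]
  by (intro borel_measurable_prod obs_mass_measurable) simp

lemma affinity_measurable [measurable]:
  "(\<lambda>\<theta>. affinity \<alpha> D K V \<theta> \<theta>s) \<in> borel_measurable (param_space D K V)"
  unfolding affinity_def
  by (intro borel_measurable_sum borel_measurable_times powr_real_measurable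
      obs_mass_measurable borel_measurable_const)

lemma AE_lda_prior_positive:
  assumes "K \<ge> 1" "V \<ge> 1"
  shows "AE \<theta> in lda_prior c D K V. simplex_param D K V \<theta> \<and> positive_param D K V \<theta>"
  using AE_lda_prior[OF assms, where c = c and D = D]
  by eventually_elim (auto simp: simplex_param_def positive_param_def prob_simplex_def intro: less_imp_le)

text \<open>Written with exp and ln so that it has the shape exp (a + R) of the exponential moment
  in \<open>change_of_measure_bound\<close>.\<close>

definition evidence_moment ::
  "real \<Rightarrow> real \<Rightarrow> nat \<Rightarrow> nat \<Rightarrow> nat \<Rightarrow> nat \<Rightarrow> lda_param \<Rightarrow> (nat \<Rightarrow> nat \<Rightarrow> nat) \<Rightarrow> ennreal" where
  "evidence_moment c \<alpha> D K V N \<theta>s w =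
     (\<integral>\<^sup>+\<theta>. ennreal (exp (\<alpha> * ln (lik D K N \<theta> w / lik D K N \<theta>s w) + - real N * ln (affinity \<alpha> D K V \<theta> \<theta>s)))
        \<partial>lda_prior c D K V)"

text \<open>The data have finite support, so expectation and prior integral are exchanged by
  additivity of the integral alone. For almost every parameter the tilted sum is then at most the
  N-th power of the affinity, which the denominator cancels.\<close>

lemma expectation_evidence_moment:
  assumes KV: "K \<ge> 1" "V \<ge> 1" and \<theta>s: "simplex_param D K V \<theta>s" and \<alpha>: "0 < \<alpha>" "\<alpha> < 1"
  shows "(\<integral>\<^sup>+w. evidence_moment c \<alpha> D K V N \<theta>s w \<partial>measure_pmf (data_law D K V N \<theta>s)) \<le> 1"
proof -
  let ?P = "lda_prior c D K V" and ?L = "data_law D K V N \<theta>s" and ?S = "set_pmf (data_law D K V N \<theta>s)"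
  define h where "h = (\<lambda>\<theta> w. exp (\<alpha> * ln (lik D K N \<theta> w / lik D K N \<theta>s w)
    + - real N * ln (affinity \<alpha> D K V \<theta> \<theta>s)))"
  interpret P: prob_space ?P using KV by (rule prob_space_lda_prior)
  note S = set_data_law[OF \<theta>s, where N = N]
  have fin: "finite ?S" using S(1) by (rule finite_subset) simp
  have meas: "(\<lambda>\<theta>. ennreal (h \<theta> w)) \<in> borel_measurable ?P" if "w \<in> ?S" for w
  proof -
    have [measurable]: "(\<lambda>\<theta>. lik D K N \<theta> w) \<in> borel_measurable (param_space D K V)"
      using that S by (intro lik_measurable) auto
    have "(\<lambda>\<theta>. ennreal (h \<theta> w)) \<in> borel_measurable (param_space D K V)"
      unfolding h_def by measurable
    then show ?thesis using measurable_cong_sets[OF sets_lda_prior[OF KV] refl] by blast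
  qed
  have "(\<integral>\<^sup>+w. evidence_moment c \<alpha> D K V N \<theta>s w \<partial>measure_pmf ?L)
      = (\<Sum>w\<in>?S. (\<integral>\<^sup>+\<theta>. ennreal (h \<theta> w) \<partial>?P) * ennreal (pmf ?L w))"
    unfolding evidence_moment_def h_def by (rule nn_integral_measure_pmf_finite[OF fin]) simp
  also have "\<dots> = (\<integral>\<^sup>+\<theta>. (\<Sum>w\<in>?S. ennreal (h \<theta> w) * ennreal (pmf ?L w)) \<partial>?P)"
    using meas by (subst nn_integral_sum) (auto intro!: sum.cong nn_integral_multc[symmetric])
  also have "\<dots> \<le> (\<integral>\<^sup>+\<theta>. 1 \<partial>?P)"
  proof (rule nn_integral_mono_AE, use AE_lda_prior_positive[OF KV, where c = c and D = D] in eventually_elim)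
    case (elim \<theta>)
    define I where "I = affinity \<alpha> D K V \<theta> \<theta>s"
    have I: "0 < I" unfolding I_def using elim \<theta>s KV by (intro affinity_pos) auto
    have "(\<Sum>w\<in>?S. h \<theta> w * pmf ?L w) =
        (\<Sum>w\<in>?S. lik D K N \<theta>s w * (lik D K N \<theta> w / lik D K N \<theta>s w) powr \<alpha>) / I ^ N"
      unfolding sum_divide_distrib
    proof (rule sum.cong[OF refl])
      fix w assume w: "w \<in> ?S"
      then have wd: "w \<in> datasets D V N" using S by auto
      have l: "0 < lik D K N \<theta>s w" using w S(2)[OF wd] by (simp add: set_pmf_iff lik_bounds[OF \<theta>s wd] less_le)
      have l': "0 < lik D K N \<theta> w" using elim wd KV by (intro lik_pos) auto
      have "h \<theta> w = (lik D K N \<theta> w / lik D K N \<theta>s w) powr \<alpha> / I ^ N"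
      proof -
        have "exp (- real N * ln I) = 1 / I ^ N"
          using I by (simp add: exp_minus exp_of_nat_mult divide_inverse)
        then show ?thesis using l l' by (simp only: h_def exp_add I_def[symmetric]) (simp add: powr_def)
      qed
      then show "h \<theta> w * pmf ?L w = lik D K N \<theta>s w * (lik D K N \<theta> w / lik D K N \<theta>s w) powr \<alpha> / I ^ N"
        by (simp add: S(2)[OF wd])
    qed
    also have "\<dots> \<le> (\<Sum>w\<in>datasets D V N. lik D K N \<theta>s w * (lik D K N \<theta> w / lik D K N \<theta>s w) powr \<alpha>) / I ^ N"
      using I S(1) lik_bounds(1)[OF \<theta>s] by (intro divide_right_mono sum_mono2) auto
    also have "\<dots> \<le> I ^ N / I ^ N"
      using sum_lik_tilted[OF _ \<theta>s \<alpha>] elim I by (intro divide_right_mono) (auto simp: I_def)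
    also have "\<dots> = 1" using I by simp
    finally have "ennreal (\<Sum>w\<in>?S. h \<theta> w * pmf ?L w) \<le> 1" by simp
    then show ?case
      by (simp add: h_def sum_ennreal[symmetric] ennreal_mult)
  qed
  also have "\<dots> = 1" by (simp add: P.emeasure_space_1)
  finally show ?thesis .
qed

text \<open>Markov's inequality, with complements taken. The event is restricted to the support of
  the data law because \<open>vb_solution\<close> constrains the minimizer only there.\<close>

lemma prob_evidence_moment_le:
  assumes "K \<ge> 1" "V \<ge> 1" "simplex_param D K V \<theta>s" "0 < \<alpha>" "\<alpha> < 1" and M: "0 < M"
  shows "1 - 1 / M \<le> measure_pmf.prob (data_law D K V N \<theta>s)
     {w \<in> set_pmf (data_law D K V N \<theta>s). evidence_moment c \<alpha> D K V N \<theta>s w \<le> ennreal M}"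
proof -
  let ?L = "data_law D K V N \<theta>s"
  have "emeasure (measure_pmf ?L) {w \<in> UNIV. 1 \<le> ennreal (1 / M) * evidence_moment c \<alpha> D K V N \<theta>s w}
     \<le> ennreal (1 / M) * (\<integral>\<^sup>+w. evidence_moment c \<alpha> D K V N \<theta>s w * indicator UNIV w \<partial>measure_pmf ?L)"
    using nn_integral_Markov_inequality[where u = "evidence_moment c \<alpha> D K V N \<theta>s" and M = "measure_pmf ?L"
        and A = UNIV and c = "ennreal (1 / M)"]
    by simp
  also have "\<dots> \<le> ennreal (1 / M) * 1"
    using expectation_evidence_moment[OF assms(1-5)] by (intro mult_left_mono) auto
  finally have "measure_pmf.prob ?L {w. 1 \<le> ennreal (1 / M) * evidence_moment c \<alpha> D K V N \<theta>s w} \<le> 1 / M"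
    using M by (simp add: measure_pmf.emeasure_eq_measure)
  moreover have "measure_pmf.prob ?L (- {w. 1 \<le> ennreal (1 / M) * evidence_moment c \<alpha> D K V N \<theta>s w})
      \<le> measure_pmf.prob ?L {w. evidence_moment c \<alpha> D K V N \<theta>s w \<le> ennreal M}"
  proof (rule measure_pmf.finite_measure_mono, rule subsetI, rule CollectI, rule ccontr)
    fix w assume w: "w \<in> - {w. 1 \<le> ennreal (1 / M) * evidence_moment c \<alpha> D K V N \<theta>s w}" and "\<not> evidence_moment c \<alpha> D K V N \<theta>s w \<le> ennreal M"
    then have "ennreal M \<le> evidence_moment c \<alpha> D K V N \<theta>s w" by simp
    then have "ennreal (1 / M) * ennreal M \<le> ennreal (1 / M) * evidence_moment c \<alpha> D K V N \<theta>s w"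
      by (rule mult_left_mono) simp
    then show False using w M by (simp add: ennreal_mult[symmetric])
  qed simp
  moreover have "measure_pmf.prob ?L {w \<in> set_pmf ?L. evidence_moment c \<alpha> D K V N \<theta>s w \<le> ennreal M}
      = measure_pmf.prob ?L {w. evidence_moment c \<alpha> D K V N \<theta>s w \<le> ennreal M}"
    using measure_Int_set_pmf[of ?L "{w. evidence_moment c \<alpha> D K V N \<theta>s w \<le> ennreal M}"]
    by (simp add: Int_def conj_commute)
  moreover have "measure_pmf.prob ?L (- {w. 1 \<le> ennreal (1 / M) * evidence_moment c \<alpha> D K V N \<theta>s w})
     = 1 - measure_pmf.prob ?L {w. 1 \<le> ennreal (1 / M) * evidence_moment c \<alpha> D K V N \<theta>s w}"
    using measure_pmf.prob_compl[of "{w. 1 \<le> ennreal (1 / M) * evidence_moment c \<alpha> D K V N \<theta>s w}" ?L]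
    by (simp add: Compl_eq_Diff_UNIV)
  ultimately show ?thesis by simp
qed

section \<open>The evidence lower bound\<close>

definition complete_lik :: "nat \<Rightarrow> nat \<Rightarrow> lda_param \<Rightarrow> (nat \<Rightarrow> nat \<Rightarrow> nat) \<Rightarrow> (nat \<Rightarrow> nat \<Rightarrow> nat) \<Rightarrow> real" where
  "complete_lik D N \<theta> w s = (\<Prod>n<N. \<Prod>d<D. fst \<theta> d (s n d) * snd \<theta> (s n d) (w n d))"

text \<open>The evidence lower bound relative to the true likelihood \<open>L\<close> at a fixed
  parameter. It is extended real since zero entries of the parameter can rule out an assignment;
  terms with \<open>pmf qS s = 0\<close> vanish by 0 * (- \<infinity>) = 0.\<close>

definition elbo :: "nat \<Rightarrow> nat \<Rightarrow> nat \<Rightarrow> real \<Rightarrow> (nat \<Rightarrow> nat \<Rightarrow> nat) \<Rightarrow> (nat \<Rightarrow> nat \<Rightarrow> nat) pmf \<Rightarrow> lda_param \<Rightarrow> ereal" where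
  "elbo D K N L w qS \<theta> = (\<Sum>s\<in>datasets D K N.
     ereal (pmf qS s) * eln (complete_lik D N \<theta> w s / (pmf qS s * L)))"

lemma vb_objective_elbo:
  "vb_objective c \<alpha> D K V N \<theta>s w (q\<theta>, qS) =
     - ext_integral q\<theta> (elbo D K N (lik D K N \<theta>s w) w qS) + ereal (1 / \<alpha>) * kl q\<theta> (lda_prior c D K V)"
proof -
  have "(\<lambda>(\<gamma>, \<beta>). \<Sum>s \<in> {..<N} \<rightarrow>\<^sub>E {..<D} \<rightarrow>\<^sub>E {..<K}. ereal (pmf qS s) *
           eln ((\<Prod>n<N. \<Prod>d<D. \<gamma> d (s n d) * \<beta> (s n d) (w n d)) /
                (pmf qS s * (\<Prod>n<N. obs_mass D K \<theta>s (w n)))))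
     = elbo D K N (lik D K N \<theta>s w) w qS"
    by (simp add: fun_eq_iff elbo_def complete_lik_def lik_def)
  then show ?thesis by (simp add: vb_objective_def)
qed

lemma sum_complete_lik: "(\<Sum>s\<in>datasets D K N. complete_lik D N \<theta> w s) = lik D K N \<theta> w"
proof -
  have "lik D K N \<theta> w = (\<Prod>n<N. \<Sum>t\<in>words D K. \<Prod>d<D. fst \<theta> d (t d) * snd \<theta> (t d) (w n d))"
    unfolding lik_def obs_mass_def by (intro prod.cong refl prod_sum_PiE) auto
  also have "\<dots> = (\<Sum>s\<in>datasets D K N. complete_lik D N \<theta> w s)"
    unfolding complete_lik_def by (rule prod_sum_PiE) auto
  finally show ?thesis by simp
qed

lemma complete_lik_nonneg:
  assumes "simplex_param D K V \<theta>" "w \<in> datasets D V N" "s \<in> datasets D K N"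
  shows "0 \<le> complete_lik D N \<theta> w s"
  unfolding complete_lik_def
  using assms datasets_less[OF assms(2)] datasets_less[OF assms(3)]
  by (intro prod_nonneg ballI mult_nonneg_nonneg) (auto simp: simplex_param_def prob_simplex_def)

lemma complete_lik_pos:
  assumes "positive_param D K V \<theta>" "w \<in> datasets D V N" "s \<in> datasets D K N"
  shows "0 < complete_lik D N \<theta> w s"
  unfolding complete_lik_def
  using assms datasets_less[OF assms(2)] datasets_less[OF assms(3)]
  by (intro prod_pos ballI mult_pos_pos) (auto simp: positive_param_def)

lemma complete_lik_measurable:
  assumes "w \<in> datasets D V N" "s \<in> datasets D K N"
  shows "(\<lambda>\<theta>. complete_lik D N \<theta> w s) \<in> borel_measurable (param_space D K V)"
  unfolding complete_lik_def
  using datasets_less[OF assms(1)] datasets_less[OF assms(2)]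
  by (intro borel_measurable_prod borel_measurable_times fst_param_measurable snd_param_measurable) auto

text \<open>From p * ln (a / (p * L)) \<le> a / L, summed over the assignments. This crude bound
  holds on the whole simplex, so it is available before the law is known to be absolutely continuous
  with respect to the prior.\<close>

lemma elbo_le:
  assumes \<theta>: "simplex_param D K V \<theta>" and w: "w \<in> datasets D V N" and L: "0 < L"
  shows "elbo D K N L w qS \<theta> \<le> ereal (1 / L)"
proof -
  have "elbo D K N L w qS \<theta> \<le> (\<Sum>s\<in>datasets D K N. ereal (complete_lik D N \<theta> w s / L))"
    unfolding elbo_def
  proof (rule sum_mono)
    fix s assume s: "s \<in> datasets D K N"
    define a where "a = complete_lik D N \<theta> w s"
    have a: "0 \<le> a" unfolding a_def by (rule complete_lik_nonneg[OF \<theta> w s])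
    show "ereal (pmf qS s) * eln (complete_lik D N \<theta> w s / (pmf qS s * L)) \<le> ereal (complete_lik D N \<theta> w s / L)"
    proof (cases "pmf qS s = 0 \<or> a = 0")
      case True
      then show ?thesis using a L by (auto simp: eln_def a_def[symmetric])
    next
      case False
      then have p: "0 < pmf qS s" "0 < a" using a by (auto simp: less_le)
      have "ln (a / (pmf qS s * L)) \<le> a / (pmf qS s * L)"
        using ln_le_minus_one[of "a / (pmf qS s * L)"] p L by simp
      then have "pmf qS s * ln (a / (pmf qS s * L)) \<le> pmf qS s * (a / (pmf qS s * L))"
        using p by (intro mult_left_mono) auto
      also have "\<dots> = a / L" using p by simp
      finally show ?thesis using p L by (simp add: eln_def a_def[symmetric])
    qed
  qed
  also have "\<dots> = ereal (lik D K N \<theta> w / L)"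
    by (simp add: sum_complete_lik flip: sum_divide_distrib)
  also have "\<dots> \<le> ereal (1 / L)" using lik_bounds[OF \<theta> w] L by (simp add: divide_right_mono)
  finally show ?thesis .
qed

lemma elbo_positive:
  assumes \<theta>: "positive_param D K V \<theta>" and w: "w \<in> datasets D V N" and L: "0 < L"
  shows "elbo D K N L w qS \<theta> = ereal (\<Sum>s\<in>datasets D K N.
     pmf qS s * ln (complete_lik D N \<theta> w s / (pmf qS s * L)))"
proof -
  have "ereal (pmf qS s) * eln (complete_lik D N \<theta> w s / (pmf qS s * L)) =
      ereal (pmf qS s * ln (complete_lik D N \<theta> w s / (pmf qS s * L)))" if "s \<in> datasets D K N" for s
    using complete_lik_pos[OF \<theta> w that] L
    by (cases "pmf qS s = 0") (auto simp: eln_def zero_less_divide_iff zero_less_mult_iff less_le)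
  then show ?thesis by (simp add: elbo_def)
qed

text \<open>Jensen's inequality for the logarithm, from \<open>ln u \<le> u - 1\<close> with \<open>u = p(s | w, \<theta>) / q\<^sub>S(s)\<close>.\<close>
lemma elbo_le_ln_lik:
  assumes \<theta>: "positive_param D K V \<theta>" and w: "w \<in> datasets D V N" and L: "0 < L" and K: "K \<ge> 1"
    and qS: "set_pmf qS \<subseteq> datasets D K N"
  shows "(\<Sum>s\<in>datasets D K N. pmf qS s * ln (complete_lik D N \<theta> w s / (pmf qS s * L)))
    \<le> ln (lik D K N \<theta> w / L)"
proof -
  define l where "l = lik D K N \<theta> w"
  have l: "0 < l" unfolding l_def by (rule lik_pos[OF \<theta> w K])
  have sum1: "(\<Sum>s\<in>datasets D K N. pmf qS s) = 1" using qS by (intro sum_pmf_eq_1) auto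
  \<comment> \<open>The correction \<open>complete_lik D N \<theta> w s / l - pmf qS s\<close> sums
    to 0, since both parts have total 1.\<close>
  have "(\<Sum>s\<in>datasets D K N. pmf qS s * ln (complete_lik D N \<theta> w s / (pmf qS s * L)))
    \<le> (\<Sum>s\<in>datasets D K N. pmf qS s * ln (l / L) + (complete_lik D N \<theta> w s / l - pmf qS s))"
  proof (rule sum_mono)
    fix s assume s: "s \<in> datasets D K N"
    define a where "a = complete_lik D N \<theta> w s"
    have a: "0 < a" unfolding a_def by (rule complete_lik_pos[OF \<theta> w s])
    show "pmf qS s * ln (complete_lik D N \<theta> w s / (pmf qS s * L)) \<le>
       pmf qS s * ln (l / L) + (complete_lik D N \<theta> w s / l - pmf qS s)"
    proof (cases "pmf qS s = 0")
      case False
      then have p: "0 < pmf qS s" by (simp add: less_le)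
      have "ln (a / (pmf qS s * L)) = ln (l / L) + ln (a / (pmf qS s * l))"
        using p a l L by (simp add: ln_div ln_mult)
      also have "\<dots> \<le> ln (l / L) + (a / (pmf qS s * l) - 1)"
        using ln_le_minus_one[of "a / (pmf qS s * l)"] p a l by simp
      finally have "pmf qS s * ln (a / (pmf qS s * L)) \<le> pmf qS s * (ln (l / L) + (a / (pmf qS s * l) - 1))"
        using p by (intro mult_left_mono) auto
      also have "\<dots> = pmf qS s * ln (l / L) + (a / l - pmf qS s)"
        using p by (simp add: algebra_simps)
      finally show ?thesis by (simp add: a_def)
    qed (use a l in \<open>simp add: a_def\<close>)
  qed
  also have "\<dots> = ln (l / L)"
    using l by (simp add: sum.distrib sum_subtractf sum1 sum_complete_lik l_def
        flip: sum_distrib_right sum_divide_distrib)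
  finally show ?thesis by (simp add: l_def)
qed

section \<open>From the objective to the risk\<close>

lemma mean_field_props:
  assumes q: "(q\<theta>, qS) \<in> mean_field D K V N"
  shows "prob_space q\<theta>" "sets q\<theta> = sets (param_space D K V)"
    "AE \<theta> in q\<theta>. simplex_param D K V \<theta>" "set_pmf qS \<subseteq> datasets D K N"
proof -
  from q obtain q\<gamma> q\<beta> qz where q\<theta>: "q\<theta> = (\<Pi>\<^sub>M d\<in>{..<D}. q\<gamma> d) \<Otimes>\<^sub>M (\<Pi>\<^sub>M k\<in>{..<K}. q\<beta> k)"
    and qS: "qS = Pi_pmf {..<N} undefined (\<lambda>n. Pi_pmf {..<D} undefined (qz n))"
    and laws: "\<And>d. d < D \<Longrightarrow> simplex_law K (q\<gamma> d)" "\<And>k. k < K \<Longrightarrow> simplex_law V (q\<beta> k)"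
    and qz: "\<And>n d. n < N \<Longrightarrow> d < D \<Longrightarrow> set_pmf (qz n d) \<subseteq> {..<K}"
    by (auto simp: mean_field_def)
  note props = laws[unfolded simplex_law_def]
  show "prob_space q\<theta>" unfolding q\<theta>
    by (rule product_law_props(1)[where P = "\<lambda>_ _. True" and P' = "\<lambda>_ _. True"]) (use props in auto)
  show "sets q\<theta> = sets (param_space D K V)" unfolding q\<theta>
    by (rule sets_param_space_cong) (use props in auto)
  have "AE \<theta> in q\<theta>. (\<forall>d<D. fst \<theta> d \<in> prob_simplex K) \<and> (\<forall>k<K. snd \<theta> k \<in> prob_simplex V)"
    unfolding q\<theta> by (rule product_law_props(2)) (use props in auto)
  then show "AE \<theta> in q\<theta>. simplex_param D K V \<theta>" by (simp add: simplex_param_def)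
  have sub: "set_pmf (Pi_pmf {..<D} undefined (qz n)) \<subseteq> words D K" if "n < N" for n
    using qz[OF that] by (subst set_Pi_pmf) (fastforce simp: PiE_dflt_def PiE_def extensional_def)+
  show "set_pmf qS \<subseteq> datasets D K N"
  proof
    fix s assume "s \<in> set_pmf qS"
    then have "\<forall>n. (n < N \<longrightarrow> s n \<in> set_pmf (Pi_pmf {..<D} undefined (qz n))) \<and> (\<not> n < N \<longrightarrow> s n = undefined)"
      unfolding qS by (subst (asm) set_Pi_pmf) (auto simp: PiE_dflt_def)
    then show "s \<in> datasets D K N" using sub by (intro PiE_I) blast+
  qed
qed

text \<open>The order of the deductions matters. The data term \<open>E\<close> is not \<infinity>
  by the crude bound, so the divergence is finite; hence the law is absolutely continuous and
  charges only positive parameters. There the evidence lower bound is real and below the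
  log-likelihood ratio \<open>l\<close>, and the change of measure applies with \<open>a\<close>
  equal to \<alpha> * l and \<open>R\<close> equal to - N * ln of the affinity.\<close>

lemma vb_risk_bound:
  assumes KV: "K \<ge> 1" "V \<ge> 1" and \<alpha>: "0 < \<alpha>" "\<alpha> < 1"
    and \<theta>s: "simplex_param D K V \<theta>s" and w: "w \<in> set_pmf (data_law D K V N \<theta>s)"
    and q: "(q\<theta>, qS) \<in> mean_field D K V N"
    and obj: "vb_objective c \<alpha> D K V N \<theta>s w (q\<theta>, qS) \<le> ereal B"
    and moment: "evidence_moment c \<alpha> D K V N \<theta>s w \<le> ennreal M" and M: "0 < M"
  shows "(\<integral>\<^sup>+\<theta>. ennreal (- real N * ln (affinity \<alpha> D K V \<theta> \<theta>s)) \<partial>q\<theta>) \<le> ennreal (\<alpha> * B + ln M)"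
    and "0 \<le> \<alpha> * B + ln M"
    and "AE \<theta> in q\<theta>. 0 < affinity \<alpha> D K V \<theta> \<theta>s"
proof -
  let ?P = "lda_prior c D K V"
  define L where "L = lik D K N \<theta>s w"
  interpret P: prob_space ?P using KV by (rule prob_space_lda_prior)
  note q_props = mean_field_props[OF q]
  interpret Q: prob_space q\<theta> by (rule q_props)
  have sets: "sets q\<theta> = sets ?P" using q_props(2) sets_lda_prior[OF KV] by simp
  have mP: "g \<in> borel_measurable ?P \<longleftrightarrow> g \<in> borel_measurable (param_space D K V)" for g :: "lda_param \<Rightarrow> real"
    using measurable_cong_sets[OF sets_lda_prior[OF KV] refl] by blast
  have mQ: "g \<in> borel_measurable q\<theta> \<longleftrightarrow> g \<in> borel_measurable (param_space D K V)" for g :: "lda_param \<Rightarrow> real"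
    using measurable_cong_sets[OF q_props(2) refl] by blast
  have wd: "w \<in> datasets D V N" using w set_data_law(1)[OF \<theta>s] by auto
  have L: "0 < L"
    using w set_data_law(2)[OF \<theta>s wd] lik_bounds(1)[OF \<theta>s wd] by (simp add: set_pmf_iff L_def less_le)
  define E where "E = ext_integral q\<theta> (elbo D K N L w qS)"
  have E_top: "E \<noteq> \<infinity>"
    unfolding E_def
    by (rule ext_integral_AE_less_top[OF q_props(1), where b = "1 / L"])
       (use q_props(3) in eventually_elim, rule elbo_le[OF _ wd L])
  have obj': "- E + ereal (1 / \<alpha>) * kl q\<theta> ?P \<le> ereal B"
    using obj by (simp add: vb_objective_elbo E_def L_def)
  have kl0: "0 \<le> kl q\<theta> ?P" by (rule kl_nonneg[OF P.prob_space_axioms q_props(1) sets])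
  have kl_top: "kl q\<theta> ?P \<noteq> \<infinity>"
    using obj' E_top \<alpha> by (cases E) auto
  obtain k where k: "kl q\<theta> ?P = ereal k" using kl0 kl_top by (cases "kl q\<theta> ?P") auto
  have E_bot: "E \<noteq> - \<infinity>" using obj' k by auto
  have ac: "absolutely_continuous ?P q\<theta>" using kl_top by (auto simp: kl_def split: if_splits)
  have AE_pos: "AE \<theta> in q\<theta>. simplex_param D K V \<theta> \<and> positive_param D K V \<theta>"
    by (rule absolutely_continuous_AE[OF sets ac AE_lda_prior_positive[OF KV]])
  show "AE \<theta> in q\<theta>. 0 < affinity \<alpha> D K V \<theta> \<theta>s"
    using AE_pos by eventually_elim (use \<theta>s KV in \<open>auto intro: affinity_pos\<close>)
  define l where "l = (\<lambda>\<theta>. ln (lik D K N \<theta> w / L))"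
  define g where "g = (\<lambda>\<theta>. \<Sum>s\<in>datasets D K N. pmf qS s * ln (complete_lik D N \<theta> w s / (pmf qS s * L)))"
  have l_meas: "l \<in> borel_measurable (param_space D K V)"
    using lik_measurable[OF wd, where K = K] unfolding l_def by measurable
  have g_meas: "g \<in> borel_measurable (param_space D K V)"
    unfolding g_def
    by (intro borel_measurable_sum borel_measurable_times borel_measurable_const borel_measurable_ln
        borel_measurable_divide complete_lik_measurable[OF wd])
  have l_int: "integrable q\<theta> l" and E_le: "E \<le> ereal (\<integral>\<theta>. l \<theta> \<partial>q\<theta>)"
  proof -
    have 1: "AE \<theta> in q\<theta>. elbo D K N L w qS \<theta> = ereal (g \<theta>)"
      using AE_pos by eventually_elim (use elbo_positive[OF _ wd L] in \<open>auto simp: g_def\<close>)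
    have 2: "AE \<theta> in q\<theta>. g \<theta> \<le> l \<theta>"
      using AE_pos by eventually_elim
        (use elbo_le_ln_lik[OF _ wd L KV(1) q_props(4)] in \<open>auto simp: g_def l_def\<close>)
    have 3: "AE \<theta> in q\<theta>. l \<theta> \<le> ln (1 / L)"
      using AE_pos
    proof eventually_elim
      case (elim \<theta>)
      have "0 < lik D K N \<theta> w" using elim lik_pos[OF _ wd KV(1)] by auto
      moreover have "lik D K N \<theta> w \<le> 1" using elim lik_bounds(2)[OF _ wd] by auto
      ultimately show ?case using L by (simp add: l_def divide_right_mono)
    qed
    show "integrable q\<theta> l" "E \<le> ereal (\<integral>\<theta>. l \<theta> \<partial>q\<theta>)"
      using ext_integral_le_integral[OF q_props(1) 1 _ _ 2 3] E_bot l_meas g_meas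
      by (auto simp: mQ E_def)
  qed
  define R where "R = (\<lambda>\<theta>. - real N * ln (affinity \<alpha> D K V \<theta> \<theta>s))"
  have R0: "AE \<theta> in q\<theta>. 0 \<le> R \<theta>"
    using AE_pos
  proof eventually_elim
    case (elim \<theta>)
    then have "affinity \<alpha> D K V \<theta> \<theta>s \<le> 1" "0 < affinity \<alpha> D K V \<theta> \<theta>s"
      using affinity_le_1[OF _ \<theta>s \<alpha>] affinity_pos[OF _ \<theta>s KV(1)] by auto
    then show ?case by (simp add: R_def mult_nonneg_nonpos)
  qed
  have "(\<integral>\<^sup>+\<theta>. ennreal (exp (\<alpha> * l \<theta> + R \<theta>)) \<partial>?P) \<le> ennreal M"
    using moment by (simp add: evidence_moment_def l_def R_def L_def)
  moreover have "(\<lambda>\<theta>. \<alpha> * l \<theta>) \<in> borel_measurable ?P" using l_meas by (simp add: mP)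
  moreover have "R \<in> borel_measurable ?P" unfolding mP R_def by measurable
  ultimately have bound: "(\<integral>\<^sup>+\<theta>. ennreal (R \<theta>) \<partial>q\<theta>)
       \<le> ennreal (real_of_ereal (kl q\<theta> ?P) + ln M - (\<integral>\<theta>. \<alpha> * l \<theta> \<partial>q\<theta>))"
    and nonneg: "0 \<le> real_of_ereal (kl q\<theta> ?P) + ln M - (\<integral>\<theta>. \<alpha> * l \<theta> \<partial>q\<theta>)"
    using change_of_measure_bound[OF P.prob_space_axioms q_props(1) sets kl_top, where a = "\<lambda>\<theta>. \<alpha> * l \<theta>" and R = R]
      R0 l_int M by auto
  obtain e where e: "E = ereal e" using E_top E_bot by (cases E) auto
  \<comment> \<open>The weight 1 / \<alpha> of the divergence fits the power \<alpha> of the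
    likelihood ratio: \<alpha> times the objective is k - \<alpha> * e.\<close>
  have "- e + k / \<alpha> \<le> B" using obj' by (simp add: e k)
  then have "\<alpha> * (- e + k / \<alpha>) \<le> \<alpha> * B" using \<alpha> by (intro mult_left_mono) auto
  then have "k - \<alpha> * e \<le> \<alpha> * B" using \<alpha> by (simp add: algebra_simps)
  moreover have "\<alpha> * e \<le> \<alpha> * (\<integral>\<theta>. l \<theta> \<partial>q\<theta>)" using E_le \<alpha> by (simp add: e)
  ultimately have le: "real_of_ereal (kl q\<theta> ?P) + ln M - (\<integral>\<theta>. \<alpha> * l \<theta> \<partial>q\<theta>) \<le> \<alpha> * B + ln M"
    by (simp add: k)
  show "0 \<le> \<alpha> * B + ln M" using nonneg le by linarith
  show "(\<integral>\<^sup>+\<theta>. ennreal (- real N * ln (affinity \<alpha> D K V \<theta> \<theta>s)) \<partial>q\<theta>) \<le> ennreal (\<alpha> * B + ln M)"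
    using order_trans[OF bound ennreal_leI[OF le]] by (simp add: R_def)
qed

text \<open>The affinity is almost surely positive, so the divergence equals - ln of it over 1 -
  \<alpha>, and the preceding bound is divided by N * D * (1 - \<alpha>).\<close>

lemma renyi_risk_bound:
  assumes KV: "K \<ge> 1" "V \<ge> 1" and \<alpha>: "0 < \<alpha>" "\<alpha> < 1" and DN: "D \<ge> 1" "N \<ge> 1"
    and \<theta>s: "simplex_param D K V \<theta>s" and w: "w \<in> set_pmf (data_law D K V N \<theta>s)"
    and q: "(q\<theta>, qS) \<in> mean_field D K V N"
    and obj: "vb_objective c \<alpha> D K V N \<theta>s w (q\<theta>, qS) \<le> ereal B"
    and moment: "evidence_moment c \<alpha> D K V N \<theta>s w \<le> ennreal M" and M: "0 < M"
  shows "(\<integral>\<^sup>+\<theta>. ennreal (1 / real D) * renyi_div (obs_count D V) \<alpha> (obs_mass D K \<theta>) (obs_mass D K \<theta>s) \<partial>q\<theta>)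
     \<le> ennreal ((\<alpha> * B + ln M) / (real N * real D * (1 - \<alpha>)))"
proof -
  note b = vb_risk_bound[OF assms(1-4) \<theta>s w q obj moment M]
  define C where "C = 1 / (real N * real D * (1 - \<alpha>))"
  have C: "0 \<le> C" using \<alpha> by (simp add: C_def)
  have "(\<integral>\<^sup>+\<theta>. ennreal (1 / real D) * renyi_div (obs_count D V) \<alpha> (obs_mass D K \<theta>) (obs_mass D K \<theta>s) \<partial>q\<theta>)
      = (\<integral>\<^sup>+\<theta>. ennreal C * ennreal (- real N * ln (affinity \<alpha> D K V \<theta> \<theta>s)) \<partial>q\<theta>)"
  proof (rule nn_integral_cong_AE, use b(3) in eventually_elim)
    case (elim \<theta>)
    have "- ln (affinity \<alpha> D K V \<theta> \<theta>s) / (1 - \<alpha>) * (1 / real D)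
        = C * (- real N * ln (affinity \<alpha> D K V \<theta> \<theta>s))"
      using DN \<alpha> by (simp add: C_def)
    then show ?case
      unfolding renyi_div_eq[OF elim \<alpha>(2)] using C
      by (simp add: ennreal_mult'[symmetric] mult.commute)
  qed
  also have "\<dots> = ennreal C * (\<integral>\<^sup>+\<theta>. ennreal (- real N * ln (affinity \<alpha> D K V \<theta> \<theta>s)) \<partial>q\<theta>)"
  proof (rule nn_integral_cmult)
    have "(\<lambda>\<theta>. ennreal (- real N * ln (affinity \<alpha> D K V \<theta> \<theta>s))) \<in> borel_measurable (param_space D K V)"
      by measurable
    then show "(\<lambda>\<theta>. ennreal (- real N * ln (affinity \<alpha> D K V \<theta> \<theta>s))) \<in> borel_measurable q\<theta>"
      using measurable_cong_sets[OF mean_field_props(2)[OF q] refl] by blast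
  qed
  also have "\<dots> \<le> ennreal C * ennreal (\<alpha> * B + ln M)" by (intro mult_left_mono b(1)) simp
  also have "\<dots> = ennreal ((\<alpha> * B + ln M) / (real N * real D * (1 - \<alpha>)))"
    using C b(2) by (simp add: ennreal_mult[symmetric] C_def)
  finally show ?thesis .
qed

section \<open>The competitor\<close>

lemma simplex_neighbourhood_sets:
  "{p \<in> space (simplex_coords n). \<forall>i<n. x i \<le> p i} \<in> sets (simplex_coords n)"
  unfolding simplex_coords_def by measurable

text \<open>Given the words, the topic of each (n, d) has probability proportional to its own term
  of the mixture sum \<open>Z n d\<close>, independently of the others. A positive likelihood makes
  every \<open>Z n d\<close> positive.\<close>

lemma posterior_latent:
  assumes \<theta>s: "simplex_param D K V \<theta>s" and w: "w \<in> datasets D V N" and L: "0 < lik D K N \<theta>s w"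
  obtains qz where "\<And>n d. n < N \<Longrightarrow> d < D \<Longrightarrow> set_pmf (qz n d) \<subseteq> {..<K}"
    "\<And>s. s \<in> datasets D K N \<Longrightarrow>
      pmf (Pi_pmf {..<N} undefined (\<lambda>n. Pi_pmf {..<D} undefined (qz n))) s * lik D K N \<theta>s w
      = complete_lik D N \<theta>s w s"
proof -
  define Z where "Z = (\<lambda>n d. \<Sum>k<K. fst \<theta>s d k * snd \<theta>s k (w n d))"
  define qz where "qz = (\<lambda>n d. categorical K (\<lambda>k. fst \<theta>s d k * snd \<theta>s k (w n d) / Z n d))"
  have nn: "0 \<le> fst \<theta>s d k * snd \<theta>s k (w n d)" if "n < N" "d < D" "k < K" for n d k
    using \<theta>s that datasets_less[OF w] by (auto simp: simplex_param_def prob_simplex_def)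
  have Z0: "Z n d \<noteq> 0" if nd: "n < N" "d < D" for n d
  proof
    assume "Z n d = 0"
    then have "obs_mass D K \<theta>s (w n) = 0"
      unfolding obs_mass_def Z_def using nd(2) by (intro prod_zero) auto
    then have "lik D K N \<theta>s w = 0"
      unfolding lik_def using nd(1) by (intro prod_zero) auto
    then show False using L by simp
  qed
  have Zpos: "0 < Z n d" if nd: "n < N" "d < D" for n d
  proof -
    have "0 \<le> Z n d" unfolding Z_def using nn[OF nd] by (intro sum_nonneg) auto
    then show ?thesis using Z0[OF nd] by simp
  qed
  have simplex: "(\<lambda>k. fst \<theta>s d k * snd \<theta>s k (w n d) / Z n d) \<in> prob_simplex K"
    if nd: "n < N" "d < D" for n d
    using nn[OF nd] Zpos[OF nd]
    by (auto simp: prob_simplex_def sum_divide_distrib[symmetric]) (simp add: Z_def)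
  have pmf_qz: "pmf (qz n d) k = fst \<theta>s d k * snd \<theta>s k (w n d) / Z n d"
    if "n < N" "d < D" "k < K" for n d k
    using pmf_categorical[OF simplex[OF that(1,2)], of k] that(3) by (simp add: qz_def)
  show ?thesis
  proof (rule that[of qz])
    show "set_pmf (qz n d) \<subseteq> {..<K}" if "n < N" "d < D" for n d
      using pmf_categorical[OF simplex[OF that]] by (auto simp: qz_def set_pmf_eq split: if_splits)
    fix s assume s: "s \<in> datasets D K N"
    have "pmf (Pi_pmf {..<N} undefined (\<lambda>n. Pi_pmf {..<D} undefined (qz n))) s
        = (\<Prod>n<N. pmf (Pi_pmf {..<D} undefined (qz n)) (s n))"
      using s by (subst pmf_Pi) (auto simp: PiE_def extensional_def)
    also have "\<dots> = (\<Prod>n<N. \<Prod>d<D. pmf (qz n d) (s n d))"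
    proof (rule prod.cong[OF refl])
      fix n assume "n \<in> {..<N}"
      then have "s n \<in> words D K" using datasets_words[OF s] by simp
      then show "pmf (Pi_pmf {..<D} undefined (qz n)) (s n) = (\<Prod>d<D. pmf (qz n d) (s n d))"
        by (subst pmf_Pi) (auto simp: PiE_def extensional_def)
    qed
    also have "\<dots> = (\<Prod>n<N. \<Prod>d<D. fst \<theta>s d (s n d) * snd \<theta>s (s n d) (w n d) / Z n d)"
      using pmf_qz datasets_less[OF s] by (intro prod.cong refl) auto
    also have "\<dots> = complete_lik D N \<theta>s w s / lik D K N \<theta>s w"
      by (simp add: complete_lik_def lik_def obs_mass_def Z_def prod_dividef)
    finally show "pmf (Pi_pmf {..<N} undefined (\<lambda>n. Pi_pmf {..<D} undefined (qz n))) s * lik D K N \<theta>s w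
      = complete_lik D N \<theta>s w s" using L by simp
  qed
qed

text \<open>With the exact posterior, each logarithm becomes that of the ratio of complete
  likelihoods at \<theta> and \<theta>s. An assignment of positive posterior probability uses only
  topics in the support of each document, so within one observation topic k is charged \<sigma> k at
  most once per document that can use it.\<close>

lemma competitor_elbo_ge:
  assumes \<theta>s: "simplex_param D K V \<theta>s" and w: "w \<in> datasets D V N" and L: "0 < lik D K N \<theta>s w"
    and qS: "set_pmf qS \<subseteq> datasets D K N"
      "\<And>s. s \<in> datasets D K N \<Longrightarrow> pmf qS s * lik D K N \<theta>s w = complete_lik D N \<theta>s w s"
    and \<gamma>: "\<And>d k. d < D \<Longrightarrow> k < K \<Longrightarrow> fst \<theta>s d k * exp (- \<rho> d) \<le> fst \<theta> d k"
    and \<beta>: "\<And>k v. k < K \<Longrightarrow> v < V \<Longrightarrow> snd \<theta>s k v * exp (- \<sigma> k) \<le> snd \<theta> k v"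
    and \<sigma>: "\<And>k. k < K \<Longrightarrow> 0 \<le> \<sigma> k"
  shows "ereal (- (real N * ((\<Sum>d<D. \<rho> d) + (\<Sum>k<K. real (card {d. d < D \<and> fst \<theta>s d k \<noteq> 0}) * \<sigma> k))))
    \<le> elbo D K N (lik D K N \<theta>s w) w qS \<theta>"
proof -
  define X where "X = real N * ((\<Sum>d<D. \<rho> d) + (\<Sum>k<K. real (card {d. d < D \<and> fst \<theta>s d k \<noteq> 0}) * \<sigma> k))"
  have term_ge: "ereal (pmf qS s * (- X)) \<le> ereal (pmf qS s) *
      eln (complete_lik D N \<theta> w s / (pmf qS s * lik D K N \<theta>s w))" if s: "s \<in> datasets D K N" for s
  proof (cases "pmf qS s = 0")
    case False
    define a where "a = complete_lik D N \<theta>s w s"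
    have p: "0 < pmf qS s" using False by (simp add: less_le)
    have a: "pmf qS s * lik D K N \<theta>s w = a" "0 < a" using qS(2)[OF s] mult_pos_pos[OF p L] by (auto simp: a_def)
    have nz: "fst \<theta>s d (s n d) \<noteq> 0" if "n < N" "d < D" for n d
    proof
      assume "fst \<theta>s d (s n d) = 0"
      then have "(\<Prod>d<D. fst \<theta>s d (s n d) * snd \<theta>s (s n d) (w n d)) = 0"
        using that by (intro prod_zero) auto
      then have "a = 0" unfolding a_def complete_lik_def using that by (intro prod_zero) auto
      then show False using a by simp
    qed
    \<comment> \<open>Documents are grouped by the topic assigned to them; each group lies among the
      documents whose true proportions include that topic.\<close>
    have row: "(\<Sum>d<D. \<sigma> (s n d)) \<le> (\<Sum>k<K. real (card {d. d < D \<and> fst \<theta>s d k \<noteq> 0}) * \<sigma> k)"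
      if n: "n < N" for n
    proof -
      have "(\<Sum>d<D. \<sigma> (s n d)) = (\<Sum>k<K. \<Sum>d\<in>{d\<in>{..<D}. s n d = k}. \<sigma> (s n d))"
        using datasets_less[OF s n] by (intro sum.group[symmetric]) auto
      also have "\<dots> = (\<Sum>k<K. real (card {d\<in>{..<D}. s n d = k}) * \<sigma> k)"
        by simp
      also have "\<dots> \<le> (\<Sum>k<K. real (card {d. d < D \<and> fst \<theta>s d k \<noteq> 0}) * \<sigma> k)"
        using nz[OF n] by (intro sum_mono mult_right_mono \<sigma>) (auto intro!: card_mono)
      finally show ?thesis .
    qed
    have "(\<Sum>n<N. \<Sum>d<D. \<rho> d + \<sigma> (s n d)) \<le>
        (\<Sum>n<N. (\<Sum>d<D. \<rho> d) + (\<Sum>k<K. real (card {d. d < D \<and> fst \<theta>s d k \<noteq> 0}) * \<sigma> k))"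
      using row by (intro sum_mono) (simp add: sum.distrib)
    then have X: "(\<Sum>n<N. \<Sum>d<D. \<rho> d + \<sigma> (s n d)) \<le> X" by (simp add: X_def)
    have truth_nonneg: "0 \<le> fst \<theta>s d (s n d)" "0 \<le> snd \<theta>s (s n d) (w n d)" if "n < N" "d < D" for n d
      using \<theta>s that datasets_less[OF s that] datasets_less[OF w that]
      by (auto simp: simplex_param_def prob_simplex_def)
    have "exp (- X) * a \<le> exp (- (\<Sum>n<N. \<Sum>d<D. \<rho> d + \<sigma> (s n d))) * a"
      using X a by (intro mult_right_mono) auto
    also have "\<dots> = (\<Prod>n<N. \<Prod>d<D. (fst \<theta>s d (s n d) * exp (- \<rho> d)) *
        (snd \<theta>s (s n d) (w n d) * exp (- \<sigma> (s n d))))"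
    proof -
      have e: "exp (- (\<Sum>n<N. \<Sum>d<D. \<rho> d + \<sigma> (s n d))) = (\<Prod>n<N. \<Prod>d<D. exp (- (\<rho> d + \<sigma> (s n d))))"
        by (simp only: sum_negf[symmetric] exp_sum finite_lessThan)
      have ee: "exp (- (r + t)) = exp (- r) * exp (- t)" for r t :: real
        by (simp add: exp_add[symmetric])
      show ?thesis
        unfolding e a_def complete_lik_def prod.distrib[symmetric] ee
        by (intro prod.cong refl) (simp add: ac_simps)
    qed
    also have "\<dots> \<le> complete_lik D N \<theta> w s"
      unfolding complete_lik_def
    proof (intro prod_mono conjI mult_mono prod_nonneg mult_nonneg_nonneg ballI)
      fix n d assume "n \<in> {..<N}" "d \<in> {..<D}"
      then have nd: "n < N" "d < D" "s n d < K" "w n d < V"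
        using datasets_less[OF s] datasets_less[OF w] by auto
      show "fst \<theta>s d (s n d) * exp (- \<rho> d) \<le> fst \<theta> d (s n d)" by (rule \<gamma>[OF nd(2,3)])
      show "snd \<theta>s (s n d) (w n d) * exp (- \<sigma> (s n d)) \<le> snd \<theta> (s n d) (w n d)"
        by (rule \<beta>[OF nd(3,4)])
      have "0 \<le> fst \<theta>s d (s n d) * exp (- \<rho> d)"
        using \<theta>s nd by (auto simp: simplex_param_def prob_simplex_def)
      then show "0 \<le> fst \<theta> d (s n d)" using \<gamma>[OF nd(2,3)] by linarith
    qed (use truth_nonneg in auto)
    finally have ge: "exp (- X) * a \<le> complete_lik D N \<theta> w s" .
    then have pos: "0 < complete_lik D N \<theta> w s" using a by (smt (verit) exp_gt_zero mult_pos_pos)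
    have "ln (exp (- X) * a) \<le> ln (complete_lik D N \<theta> w s)" using ge a pos by (subst ln_le_cancel_iff) auto
    then have "- X \<le> ln (complete_lik D N \<theta> w s / a)" using a pos by (simp add: ln_mult ln_div)
    then have "pmf qS s * (- X) \<le> pmf qS s * ln (complete_lik D N \<theta> w s / a)"
      using p by (intro mult_left_mono) auto
    then show ?thesis using a pos by (simp add: eln_def)
  qed (simp flip: zero_ereal_def)
  have "(\<Sum>s\<in>datasets D K N. pmf qS s) = 1" using qS(1) by (intro sum_pmf_eq_1) auto
  then have "ereal (- X) = (\<Sum>s\<in>datasets D K N. ereal (pmf qS s * (- X)))"
    by (simp add: sum_negf flip: sum_distrib_right)
  also have "\<dots> \<le> elbo D K N (lik D K N \<theta>s w) w qS \<theta>"
    unfolding elbo_def using term_ge by (rule sum_mono)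
  finally show ?thesis by (simp add: X_def)
qed

text \<open>The likelihood bound holds for every parameter in the box, so the data term needs no
  averaging. The prior mass of the box is a product over documents and topics, so its negative
  logarithm is at most the sum of the \<open>a d\<close> and \<open>b k\<close>.\<close>

lemma competitor_objective:
  assumes KV: "K \<ge> 1" "V \<ge> 1" and \<alpha>: "0 < \<alpha>"
    and \<theta>s: "simplex_param D K V \<theta>s" and w: "w \<in> set_pmf (data_law D K V N \<theta>s)"
    and \<rho>: "\<And>d. d < D \<Longrightarrow> 0 \<le> \<rho> d" and \<sigma>: "\<And>k. k < K \<Longrightarrow> 0 \<le> \<sigma> k"
    and mass_\<gamma>: "\<And>d. d < D \<Longrightarrow> exp (- a d) \<le> measure (dirichlet K (1 / real K powr c))
        {p \<in> space (simplex_coords K). \<forall>i<K. fst \<theta>s d i * exp (- \<rho> d) \<le> p i}"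
    and mass_\<beta>: "\<And>k. k < K \<Longrightarrow> exp (- b k) \<le> measure (dirichlet V (1 / real V powr c))
        {p \<in> space (simplex_coords V). \<forall>i<V. snd \<theta>s k i * exp (- \<sigma> k) \<le> p i}"
  shows "\<exists>q\<in>mean_field D K V N. vb_objective c \<alpha> D K V N \<theta>s w q \<le>
    ereal (real N * ((\<Sum>d<D. \<rho> d) + (\<Sum>k<K. real (card {d. d < D \<and> fst \<theta>s d k \<noteq> 0}) * \<sigma> k))
      + 1 / \<alpha> * ((\<Sum>d<D. a d) + (\<Sum>k<K. b k)))"
proof -
  let ?P = "lda_prior c D K V"
  let ?X = "real N * ((\<Sum>d<D. \<rho> d) + (\<Sum>k<K. real (card {d. d < D \<and> fst \<theta>s d k \<noteq> 0}) * \<sigma> k))"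
  define MG where "MG = dirichlet K (1 / real K powr c)"
  define MB where "MB = dirichlet V (1 / real V powr c)"
  interpret P: prob_space ?P using KV by (rule prob_space_lda_prior)
  interpret MG: prob_space MG unfolding MG_def using KV by (intro prob_space_dirichlet) auto
  interpret MB: prob_space MB unfolding MB_def using KV by (intro prob_space_dirichlet) auto
  have sMG: "sets MG = sets (simplex_coords K)" and sMB: "sets MB = sets (simplex_coords V)"
    by (simp_all add: MG_def MB_def)
  \<comment> \<open>Outside the index range the event is the whole space, because
    \<open>PiM_uniform_measure\<close> asks for positive mass at every index.\<close>
  define G where "G = (\<lambda>d. if d < D then {p \<in> space (simplex_coords K). \<forall>i<K. fst \<theta>s d i * exp (- \<rho> d) \<le> p i}
    else space MG)"
  define B where "B = (\<lambda>k. if k < K then {p \<in> space (simplex_coords V). \<forall>i<V. snd \<theta>s k i * exp (- \<sigma> k) \<le> p i}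
    else space MB)"
  have Gs: "G d \<in> sets MG" for d
    unfolding G_def using simplex_neighbourhood_sets[of K "\<lambda>i. fst \<theta>s d i * exp (- \<rho> d)"]
    by (cases "d < D") (simp_all only: if_True if_False sMG[symmetric] sets.top)
  have Bs: "B k \<in> sets MB" for k
    unfolding B_def using simplex_neighbourhood_sets[of V "\<lambda>i. snd \<theta>s k i * exp (- \<sigma> k)"]
    by (cases "k < K") (simp_all only: if_True if_False sMB[symmetric] sets.top)
  have Gm: "exp (- a d) \<le> measure MG (G d)" if "d < D" for d
    using mass_\<gamma>[OF that] that by (simp add: G_def MG_def)
  have Bm: "exp (- b k) \<le> measure MB (B k)" if "k < K" for k
    using mass_\<beta>[OF that] that by (simp add: B_def MB_def)
  have G0: "emeasure MG (G d) \<noteq> 0" for d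
  proof (cases "d < D")
    case True
    then have "0 < measure MG (G d)" using Gm[OF True] by (smt (verit) exp_gt_zero)
    then show ?thesis by (simp add: MG.emeasure_eq_measure)
  qed (simp add: G_def MG.emeasure_space_1)
  have B0: "emeasure MB (B k) \<noteq> 0" for k
  proof (cases "k < K")
    case True
    then have "0 < measure MB (B k)" using Bm[OF True] by (smt (verit) exp_gt_zero)
    then show ?thesis by (simp add: MB.emeasure_eq_measure)
  qed (simp add: B_def MB.emeasure_space_1)
  interpret PG: product_prob_space "\<lambda>_::nat. MG" ..
  interpret PB: product_prob_space "\<lambda>_::nat. MB" ..
  define A where "A = (\<Pi>\<^sub>E d\<in>{..<D}. G d) \<times> (\<Pi>\<^sub>E k\<in>{..<K}. B k)"
  have prior: "?P = (\<Pi>\<^sub>M d\<in>{..<D}. MG) \<Otimes>\<^sub>M (\<Pi>\<^sub>M k\<in>{..<K}. MB)"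
    by (simp add: lda_prior_def MG_def MB_def)
  have eG: "emeasure (\<Pi>\<^sub>M d\<in>{..<D}. MG) (\<Pi>\<^sub>E d\<in>{..<D}. G d) = ennreal (\<Prod>d<D. measure MG (G d))"
    using PG.emeasure_PiM[of "{..<D}" G] Gs by (simp add: MG.emeasure_eq_measure prod_ennreal)
  have eB: "emeasure (\<Pi>\<^sub>M k\<in>{..<K}. MB) (\<Pi>\<^sub>E k\<in>{..<K}. B k) = ennreal (\<Prod>k<K. measure MB (B k))"
    using PB.emeasure_PiM[of "{..<K}" B] Bs by (simp add: MB.emeasure_eq_measure prod_ennreal)
  have pG: "0 < (\<Prod>d<D. measure MG (G d))"
    using G0 by (intro prod_pos) (simp add: MG.emeasure_eq_measure zero_less_measure_iff)
  have pB: "0 < (\<Prod>k<K. measure MB (B k))"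
    using B0 by (intro prod_pos) (simp add: MB.emeasure_eq_measure zero_less_measure_iff)
  have sG: "(\<Pi>\<^sub>E d\<in>{..<D}. G d) \<in> sets (\<Pi>\<^sub>M d\<in>{..<D}. MG)" using Gs by (intro sets_PiM_I_finite) auto
  have sB: "(\<Pi>\<^sub>E k\<in>{..<K}. B k) \<in> sets (\<Pi>\<^sub>M k\<in>{..<K}. MB)" using Bs by (intro sets_PiM_I_finite) auto
  have As: "A \<in> sets ?P" unfolding prior A_def using sG sB by (rule pair_measureI)
  have mA: "measure ?P A = (\<Prod>d<D. measure MG (G d)) * (\<Prod>k<K. measure MB (B k))"
  proof -
    have "emeasure ?P A = ennreal (\<Prod>d<D. measure MG (G d)) * ennreal (\<Prod>k<K. measure MB (B k))"
      unfolding prior A_def eG[symmetric] eB[symmetric]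
      by (rule sigma_finite_measure.emeasure_pair_measure_Times[OF _ sG sB])
         (intro prob_space_imp_sigma_finite prob_space_PiM MB.prob_space_axioms)
    then show ?thesis
      using pG pB by (simp add: P.emeasure_eq_measure ennreal_mult[symmetric])
  qed
  have mA0: "0 < measure ?P A" using pG pB by (simp add: mA)
  define q\<theta> where "q\<theta> = (\<Pi>\<^sub>M d\<in>{..<D}. uniform_measure MG (G d)) \<Otimes>\<^sub>M (\<Pi>\<^sub>M k\<in>{..<K}. uniform_measure MB (B k))"
  \<comment> \<open>Two descriptions of one law: the product form gives membership in the mean-field
    family, the conditioned prior gives the divergence.\<close>
  have q\<theta>: "q\<theta> = uniform_measure ?P A"
  proof -
    have "(\<Pi>\<^sub>M d\<in>{..<D}. uniform_measure MG (G d)) = uniform_measure (\<Pi>\<^sub>M d\<in>{..<D}. MG) (\<Pi>\<^sub>E d\<in>{..<D}. G d)"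
      by (rule PiM_uniform_measure) (use Gs G0 MG.prob_space_axioms in auto)
    moreover have "(\<Pi>\<^sub>M k\<in>{..<K}. uniform_measure MB (B k)) = uniform_measure (\<Pi>\<^sub>M k\<in>{..<K}. MB) (\<Pi>\<^sub>E k\<in>{..<K}. B k)"
      by (rule PiM_uniform_measure) (use Bs B0 MB.prob_space_axioms in auto)
    moreover have "uniform_measure (\<Pi>\<^sub>M d\<in>{..<D}. MG) (\<Pi>\<^sub>E d\<in>{..<D}. G d) \<Otimes>\<^sub>M
        uniform_measure (\<Pi>\<^sub>M k\<in>{..<K}. MB) (\<Pi>\<^sub>E k\<in>{..<K}. B k) =
        uniform_measure ((\<Pi>\<^sub>M d\<in>{..<D}. MG) \<Otimes>\<^sub>M (\<Pi>\<^sub>M k\<in>{..<K}. MB))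
          ((\<Pi>\<^sub>E d\<in>{..<D}. G d) \<times> (\<Pi>\<^sub>E k\<in>{..<K}. B k))"
      by (rule pair_uniform_measure[OF _ _ sG sB])
        (auto simp only: eG eB ennreal_eq_0_iff not_le pG pB
          intro!: prob_space_PiM MG.prob_space_axioms MB.prob_space_axioms)
    ultimately show ?thesis by (simp only: q\<theta>_def prior A_def)
  qed
  have wd: "w \<in> datasets D V N" using w set_data_law(1)[OF \<theta>s] by auto
  have L: "0 < lik D K N \<theta>s w"
    using w set_data_law(2)[OF \<theta>s wd] lik_bounds(1)[OF \<theta>s wd] by (simp add: set_pmf_iff less_le)
  obtain qz where qz: "\<And>n d. n < N \<Longrightarrow> d < D \<Longrightarrow> set_pmf (qz n d) \<subseteq> {..<K}"
    "\<And>s. s \<in> datasets D K N \<Longrightarrow>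
      pmf (Pi_pmf {..<N} undefined (\<lambda>n. Pi_pmf {..<D} undefined (qz n))) s * lik D K N \<theta>s w
      = complete_lik D N \<theta>s w s"
    using posterior_latent[OF \<theta>s wd L] by metis
  define qS where "qS = Pi_pmf {..<N} undefined (\<lambda>n. Pi_pmf {..<D} undefined (qz n))"
  have lawG: "simplex_law K (uniform_measure MG (G d))" for d
  proof -
    have "AE p in MG. p \<in> prob_simplex K"
      unfolding MG_def using AE_dirichlet_pos[of K "1 / real K powr c"] KV
      by (auto simp: prob_simplex_def elim!: eventually_mono intro: less_imp_le)
    then have "AE p in uniform_measure MG (G d). p \<in> prob_simplex K"
      using Gs by (intro AE_uniform_measureI) auto
    then show ?thesis
      using G0 by (auto simp: simplex_law_def sMG intro!: prob_space_uniform_measure)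
  qed
  have lawB: "simplex_law V (uniform_measure MB (B k))" for k
  proof -
    have "AE p in MB. p \<in> prob_simplex V"
      unfolding MB_def using AE_dirichlet_pos[of V "1 / real V powr c"] KV
      by (auto simp: prob_simplex_def elim!: eventually_mono intro: less_imp_le)
    then have "AE p in uniform_measure MB (B k). p \<in> prob_simplex V"
      using Bs by (intro AE_uniform_measureI) auto
    then show ?thesis
      using B0 by (auto simp: simplex_law_def sMB intro!: prob_space_uniform_measure)
  qed
  have mf: "(q\<theta>, qS) \<in> mean_field D K V N"
    unfolding mean_field_def q\<theta>_def qS_def using lawG lawB qz(1) by blast
  have "AE \<theta> in q\<theta>. \<theta> \<in> A"
    unfolding q\<theta> using As by (intro AE_uniform_measureI) auto
  then have "AE \<theta> in q\<theta>. ereal (- ?X) \<le> elbo D K N (lik D K N \<theta>s w) w qS \<theta>"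
  proof eventually_elim
    case (elim \<theta>)
    then have "fst \<theta> \<in> (\<Pi>\<^sub>E d\<in>{..<D}. G d)" "snd \<theta> \<in> (\<Pi>\<^sub>E k\<in>{..<K}. B k)"
      by (auto simp: A_def)
    then have *: "fst \<theta> d \<in> G d" if "d < D" for d
      using that by (auto dest: PiE_mem)
    have **: "snd \<theta> k \<in> B k" if "k < K" for k
      using that \<open>snd \<theta> \<in> _\<close> by (auto dest: PiE_mem)
    show ?case
      using * ** by (intro competitor_elbo_ge[OF \<theta>s wd L mean_field_props(4)[OF mf] _ _ _ \<sigma>])
        (auto simp: G_def B_def qS_def intro: qz(2))
  qed
  moreover have "0 \<le> ?X"
    using \<rho> \<sigma> by (intro mult_nonneg_nonneg add_nonneg_nonneg sum_nonneg) auto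
  ultimately have ext: "ereal (- ?X) \<le> ext_integral q\<theta> (elbo D K N (lik D K N \<theta>s w) w qS)"
    using mean_field_props(1)[OF mf] by (intro ext_integral_AE_ge) auto
  have "- ln (measure ?P A) \<le> (\<Sum>d<D. a d) + (\<Sum>k<K. b k)"
  proof -
    have "exp (- ((\<Sum>d<D. a d) + (\<Sum>k<K. b k))) = (\<Prod>d<D. exp (- a d)) * (\<Prod>k<K. exp (- b k))"
      by (simp only: minus_add_distrib exp_add sum_negf[symmetric] exp_sum finite_lessThan)
    also have "\<dots> \<le> measure ?P A"
      unfolding mA using Gm Bm by (intro mult_mono prod_mono) (auto intro!: prod_nonneg)
    finally have "ln (exp (- ((\<Sum>d<D. a d) + (\<Sum>k<K. b k)))) \<le> ln (measure ?P A)"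
      using mA0 by (subst ln_le_cancel_iff) auto
    then show ?thesis by simp
  qed
  then have "1 / \<alpha> * (- ln (measure ?P A)) \<le> 1 / \<alpha> * ((\<Sum>d<D. a d) + (\<Sum>k<K. b k))"
    using \<alpha> by (intro mult_left_mono) auto
  then have kl: "ereal (1 / \<alpha>) * kl q\<theta> ?P \<le> ereal (1 / \<alpha> * ((\<Sum>d<D. a d) + (\<Sum>k<K. b k)))"
    unfolding q\<theta> kl_uniform_measure[OF P.prob_space_axioms As mA0] by simp
  have "vb_objective c \<alpha> D K V N \<theta>s w (q\<theta>, qS) \<le> ereal (?X) + ereal (1 / \<alpha> * ((\<Sum>d<D. a d) + (\<Sum>k<K. b k)))"
    unfolding vb_objective_elbo
  proof (rule add_mono)
    have "- ext_integral q\<theta> (elbo D K N (lik D K N \<theta>s w) w qS) \<le> - ereal (- ?X)"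
      using ext by (simp only: ereal_minus_le_minus)
    then show "- ext_integral q\<theta> (elbo D K N (lik D K N \<theta>s w) w qS) \<le> ereal ?X"
      by (simp only: uminus_ereal.simps minus_minus)
  qed (rule kl)
  then show ?thesis using mf by (auto simp: algebra_simps)
qed

section \<open>Risk bounds\<close>

text \<open>
  Topic \<open>k\<close> is used by at most \<open>m k\<close> documents; shrinking its neighbourhood by that factor costs
  only \<open>d k * ln (m k) \<le> m k / \<delta>0\<close> in prior mass, and the \<open>m k\<close> sum up to \<open>\<Sum>j<D. e j\<close>.
\<close>
lemma sparse_truth_objective:
  fixes c \<delta>0 :: real
  assumes c: "c > 1" and \<delta>0: "\<delta>0 > 0"
  defines "A0 \<equiv> c + 3 + \<bar>ln 4 + 2 * ln (2 / \<delta>0)\<bar> / ln 2"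
  assumes \<alpha>: "0 < \<alpha>" and KV: "K \<ge> 1" "V \<ge> 1"
    and truth: "sparse_truth \<delta>0 D K V \<theta>s e d"
    and w: "w \<in> set_pmf (data_law D K V N \<theta>s)"
    and \<epsilon>\<gamma>: "\<And>j. j < D \<Longrightarrow> 0 < \<epsilon>\<gamma> j \<and> \<epsilon>\<gamma> j < 1" and \<epsilon>\<beta>: "\<And>k. k < K \<Longrightarrow> 0 < \<epsilon>\<beta> k \<and> \<epsilon>\<beta> k < 1"
  shows "\<exists>q\<in>mean_field D K V N. vb_objective c \<alpha> D K V N \<theta>s w q \<le>
    ereal (real N * ((\<Sum>j<D. (\<epsilon>\<gamma> j)\<^sup>2) + (\<Sum>k<K. (\<epsilon>\<beta> k)\<^sup>2)) +
      1 / \<alpha> * (A0 * (2 + 1 / (\<delta>0 * ln 2)) *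
        ((\<Sum>j<D. real (e j) * ln (real K / \<epsilon>\<gamma> j)) + (\<Sum>k<K. real (d k) * ln (real V / \<epsilon>\<beta> k)))))"
proof -
  have A0: "0 \<le> A0" using c by (auto simp: A0_def intro!: add_nonneg_nonneg)
  have \<theta>s: "simplex_param D K V \<theta>s" using truth by (auto simp: simplex_param_def sparse_truth_def)
  have sp\<gamma>: "fst \<theta>s j \<in> prob_simplex K" "m_sparse K (e j) (fst \<theta>s j)" "e j < K"
    "\<And>i. i < K \<Longrightarrow> fst \<theta>s j i \<noteq> 0 \<Longrightarrow> \<delta>0 \<le> fst \<theta>s j i" if "j < D" for j
    using truth that by (auto simp: sparse_truth_def)
  have sp\<beta>: "snd \<theta>s k \<in> prob_simplex V" "m_sparse V (d k) (snd \<theta>s k)" "d k < V"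
    "\<And>i. i < V \<Longrightarrow> snd \<theta>s k i \<noteq> 0 \<Longrightarrow> \<delta>0 \<le> snd \<theta>s k i" if "k < K" for k
    using truth that by (auto simp: sparse_truth_def)
  define m where "m = (\<lambda>k. card {j. j < D \<and> fst \<theta>s j k \<noteq> 0})"
  \<comment> \<open>The \<open>max 1\<close> avoids a zero denominator for a topic that no document
    uses and keeps \<sigma> k \<le> 1.\<close>
  define \<sigma> where "\<sigma> = (\<lambda>k. (\<epsilon>\<beta> k)\<^sup>2 / real (max 1 (m k)))"
  have \<sigma>: "0 < \<sigma> k" "\<sigma> k \<le> 1" "real (m k) * \<sigma> k \<le> (\<epsilon>\<beta> k)\<^sup>2" if "k < K" for k
  proof -
    have "0 < (\<epsilon>\<beta> k)\<^sup>2" using \<epsilon>\<beta>[OF that] by simp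
    moreover have "(\<epsilon>\<beta> k)\<^sup>2 \<le> 1" using \<epsilon>\<beta>[OF that] by (intro power_le_one) auto
    moreover have "real (m k) / real (max 1 (m k)) \<le> 1" by simp
    ultimately show "0 < \<sigma> k" "\<sigma> k \<le> 1" "real (m k) * \<sigma> k \<le> (\<epsilon>\<beta> k)\<^sup>2"
      using mult_right_mono[of "real (m k) / real (max 1 (m k))" 1 "(\<epsilon>\<beta> k)\<^sup>2"]
      by (auto simp: \<sigma>_def divide_simps)
  qed
  define a where "a = (\<lambda>j. A0 * real (e j) * (ln (real K) + ln (1 / (\<epsilon>\<gamma> j)\<^sup>2)))"
  define b where "b = (\<lambda>k. A0 * real (d k) * (ln (real V) + ln (1 / \<sigma> k)))"
  have mass_a: "exp (- a j) \<le> measure (dirichlet K (1 / real K powr c))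
        {p \<in> space (simplex_coords K). \<forall>i<K. fst \<theta>s j i * exp (- (\<epsilon>\<gamma> j)\<^sup>2) \<le> p i}" if "j < D" for j
    unfolding a_def A0_def
    by (rule dirichlet_neighbourhood_mass[OF c sp\<gamma>(1-3)[OF that] \<delta>0 sp\<gamma>(4)[OF that]])
       (use \<epsilon>\<gamma>[OF that] in \<open>auto intro: power_le_one\<close>)
  have mass_b: "exp (- b k) \<le> measure (dirichlet V (1 / real V powr c))
        {p \<in> space (simplex_coords V). \<forall>i<V. snd \<theta>s k i * exp (- \<sigma> k) \<le> p i}" if "k < K" for k
    unfolding b_def A0_def
    by (rule dirichlet_neighbourhood_mass[OF c sp\<beta>(1-3)[OF that] \<delta>0 sp\<beta>(4)[OF that] \<sigma>(1,2)[OF that]])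
  from competitor_objective[OF KV \<alpha> \<theta>s w, of "\<lambda>j. (\<epsilon>\<gamma> j)\<^sup>2" \<sigma> a c b] mass_a mass_b \<sigma>
  obtain q where q: "q \<in> mean_field D K V N" "vb_objective c \<alpha> D K V N \<theta>s w q \<le>
    ereal (real N * ((\<Sum>j<D. (\<epsilon>\<gamma> j)\<^sup>2) + (\<Sum>k<K. real (m k) * \<sigma> k)) + 1 / \<alpha> * ((\<Sum>j<D. a j) + (\<Sum>k<K. b k)))"
    by (auto simp: m_def less_imp_le)
  have e1: "1 \<le> e j" if "j < D" for j
    using sp\<gamma>(1,2)[OF that] by (rule m_sparse_ge_1)
  \<comment> \<open>Nonzero entries are at least \<delta>0 and sum to 1.\<close>
  have d_le: "real (d k) \<le> 1 / \<delta>0" if "k < K" for k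
  proof -
    have "real (d k) * \<delta>0 = (\<Sum>i\<in>{i. i < V \<and> snd \<theta>s k i \<noteq> 0}. \<delta>0)"
      using sp\<beta>(2)[OF that] by (simp add: m_sparse_def)
    also have "\<dots> \<le> (\<Sum>i\<in>{i. i < V \<and> snd \<theta>s k i \<noteq> 0}. snd \<theta>s k i)"
      using sp\<beta>(4)[OF that] by (intro sum_mono) auto
    also have "\<dots> \<le> (\<Sum>i<V. snd \<theta>s k i)"
      using sp\<beta>(1)[OF that] by (intro sum_mono2) (auto simp: prob_simplex_def)
    also have "\<dots> = 1" using sp\<beta>(1)[OF that] by (simp add: prob_simplex_def)
    finally show ?thesis using \<delta>0 by (simp add: field_simps)
  qed
  \<comment> \<open>Double counting of the nonzero entries of the true topic proportions.\<close>
  have sum_m: "(\<Sum>k<K. real (m k)) = (\<Sum>j<D. real (e j))"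
  proof -
    have "(\<Sum>k<K. real (m k)) = (\<Sum>k<K. \<Sum>j<D. if fst \<theta>s j k \<noteq> 0 then 1 else 0)"
      by (intro sum.cong refl) (simp add: m_def sum.If_cases Int_def)
    also have "\<dots> = (\<Sum>j<D. \<Sum>k<K. if fst \<theta>s j k \<noteq> 0 then 1 else 0)" by (rule sum.swap)
    also have "\<dots> = (\<Sum>j<D. real (e j))"
      using sp\<gamma>(2) by (intro sum.cong refl) (auto simp: m_sparse_def sum.If_cases Int_def)
    finally show ?thesis .
  qed
  define L\<gamma> where "L\<gamma> = (\<Sum>j<D. real (e j) * ln (real K / \<epsilon>\<gamma> j))"
  define L\<beta> where "L\<beta> = (\<Sum>k<K. real (d k) * ln (real V / \<epsilon>\<beta> k))"
  \<comment> \<open>Charges the leftover sum of the e j to the logarithmic term: 1 \<le> e j < K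
    gives K \<ge> 2, so each logarithm is at least ln 2.\<close>
  have sum_e: "(\<Sum>j<D. real (e j)) \<le> L\<gamma> / ln 2"
  proof -
    have "real (e j) * ln 2 \<le> real (e j) * ln (real K / \<epsilon>\<gamma> j)" if "j < D" for j
    proof (rule mult_left_mono)
      have "2 * \<epsilon>\<gamma> j \<le> real K"
        using \<epsilon>\<gamma>[OF that] e1[OF that] sp\<gamma>(3)[OF that] by linarith
      then have "2 \<le> real K / \<epsilon>\<gamma> j" using \<epsilon>\<gamma>[OF that] by (simp add: field_simps)
      then show "ln 2 \<le> ln (real K / \<epsilon>\<gamma> j)" by (subst ln_le_cancel_iff) auto
    qed simp
    then have "(\<Sum>j<D. real (e j) * ln 2) \<le> L\<gamma>" unfolding L\<gamma>_def by (intro sum_mono) auto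
    then show ?thesis by (simp add: field_simps flip: sum_distrib_right)
  qed
  have L\<beta>0: "0 \<le> L\<beta>"
    unfolding L\<beta>_def
  proof (intro sum_nonneg mult_nonneg_nonneg)
    fix k assume "k \<in> {..<K}"
    then have "\<epsilon>\<beta> k \<le> real V" "0 < \<epsilon>\<beta> k" using \<epsilon>\<beta>[of k] KV by auto
    then show "0 \<le> ln (real V / \<epsilon>\<beta> k)" by (simp add: field_simps)
  qed simp
  have "(\<Sum>j<D. a j) \<le> (\<Sum>j<D. A0 * (2 * (real (e j) * ln (real K / \<epsilon>\<gamma> j))))"
  proof (rule sum_mono)
    fix j assume "j \<in> {..<D}"
    then have j: "j < D" "0 < \<epsilon>\<gamma> j" using \<epsilon>\<gamma> by auto
    have "ln (real K) + ln (1 / (\<epsilon>\<gamma> j)\<^sup>2) \<le> 2 * ln (real K / \<epsilon>\<gamma> j)"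
      using j KV by (simp add: ln_div ln_realpow)
    then have "A0 * real (e j) * (ln (real K) + ln (1 / (\<epsilon>\<gamma> j)\<^sup>2)) \<le> A0 * real (e j) * (2 * ln (real K / \<epsilon>\<gamma> j))"
      using A0 by (intro mult_left_mono) auto
    then show "a j \<le> A0 * (2 * (real (e j) * ln (real K / \<epsilon>\<gamma> j)))" by (simp add: a_def ac_simps)
  qed
  also have "\<dots> = A0 * (2 * L\<gamma>)" by (simp add: L\<gamma>_def sum_distrib_left)
  finally have sum_a: "(\<Sum>j<D. a j) \<le> A0 * (2 * L\<gamma>)" .
  have "(\<Sum>k<K. b k) \<le> (\<Sum>k<K. A0 * (2 * (real (d k) * ln (real V / \<epsilon>\<beta> k)) + real (m k) / \<delta>0))"
  proof (rule sum_mono)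
    fix k assume "k \<in> {..<K}"
    then have k: "k < K" "0 < \<epsilon>\<beta> k" using \<epsilon>\<beta> by auto
    have lm: "ln (real (max 1 (m k))) \<le> real (m k)"
      using ln_le_minus_one[of "real (max 1 (m k))"] by (auto simp: max_def split: if_splits)
    have "ln (1 / \<sigma> k) = ln (real (max 1 (m k))) + 2 * ln (1 / \<epsilon>\<beta> k)"
      using k by (simp add: \<sigma>_def ln_div ln_realpow)
    moreover have "ln (real V / \<epsilon>\<beta> k) = ln (real V) + ln (1 / \<epsilon>\<beta> k)"
      using k KV by (simp add: ln_div)
    moreover have "0 \<le> ln (real V)" using KV by simp
    ultimately have "ln (real V) + ln (1 / \<sigma> k) \<le> 2 * ln (real V / \<epsilon>\<beta> k) + real (m k)"
      using lm by linarith
    then have "real (d k) * (ln (real V) + ln (1 / \<sigma> k)) \<le> real (d k) * (2 * ln (real V / \<epsilon>\<beta> k) + real (m k))"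
      by (intro mult_left_mono) auto
    also have "\<dots> \<le> 2 * (real (d k) * ln (real V / \<epsilon>\<beta> k)) + real (m k) / \<delta>0"
      using mult_right_mono[OF d_le[OF k(1)], of "real (m k)"] by (simp add: algebra_simps)
    finally show "b k \<le> A0 * (2 * (real (d k) * ln (real V / \<epsilon>\<beta> k)) + real (m k) / \<delta>0)"
      using A0 by (simp add: b_def mult.assoc mult_left_mono)
  qed
  also have "\<dots> = A0 * (2 * L\<beta> + (\<Sum>j<D. real (e j)) / \<delta>0)"
    by (simp add: L\<beta>_def sum_distrib_left sum.distrib sum_m[symmetric] sum_divide_distrib distrib_left)
  also have "\<dots> \<le> A0 * (2 * L\<beta> + (L\<gamma> / ln 2) / \<delta>0)"
    using A0 \<delta>0 sum_e by (intro mult_left_mono add_left_mono divide_right_mono) auto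
  finally have sum_b: "(\<Sum>k<K. b k) \<le> A0 * (2 * L\<beta> + (L\<gamma> / ln 2) / \<delta>0)" .
  have "(\<Sum>j<D. a j) + (\<Sum>k<K. b k) \<le> A0 * (2 * L\<gamma>) + A0 * (2 * L\<beta> + (L\<gamma> / ln 2) / \<delta>0)"
    using sum_a sum_b by (rule add_mono)
  \<comment> \<open>A nonnegative term in \<open>L\<beta>\<close> is added so that
    \<open>L\<gamma>\<close> and \<open>L\<beta>\<close> share the factor 2 + 1 / (\<delta>0 * ln
    2).\<close>
  also have "\<dots> \<le> A0 * (2 * L\<gamma>) + A0 * (2 * L\<beta> + (L\<gamma> / ln 2) / \<delta>0) + A0 * (L\<beta> / ln 2 / \<delta>0)"
    using A0 L\<beta>0 \<delta>0 by simp
  also have "\<dots> = A0 * (2 + 1 / (\<delta>0 * ln 2)) * (L\<gamma> + L\<beta>)"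
    using \<delta>0 by (simp add: field_simps)
  finally have "1 / \<alpha> * ((\<Sum>j<D. a j) + (\<Sum>k<K. b k)) \<le> 1 / \<alpha> * (A0 * (2 + 1 / (\<delta>0 * ln 2)) * (L\<gamma> + L\<beta>))"
    using \<alpha> by (intro mult_left_mono) auto
  moreover have "real N * ((\<Sum>j<D. (\<epsilon>\<gamma> j)\<^sup>2) + (\<Sum>k<K. real (m k) * \<sigma> k)) \<le>
      real N * ((\<Sum>j<D. (\<epsilon>\<gamma> j)\<^sup>2) + (\<Sum>k<K. (\<epsilon>\<beta> k)\<^sup>2))"
    using \<sigma>(3) by (intro mult_left_mono add_left_mono sum_mono) auto
  ultimately have "ereal (real N * ((\<Sum>j<D. (\<epsilon>\<gamma> j)\<^sup>2) + (\<Sum>k<K. real (m k) * \<sigma> k)) + 1 / \<alpha> * ((\<Sum>j<D. a j) + (\<Sum>k<K. b k)))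
     \<le> ereal (real N * ((\<Sum>j<D. (\<epsilon>\<gamma> j)\<^sup>2) + (\<Sum>k<K. (\<epsilon>\<beta> k)\<^sup>2)) + 1 / \<alpha> * (A0 * (2 + 1 / (\<delta>0 * ln 2)) * (L\<gamma> + L\<beta>)))"
    by simp
  then show ?thesis using q order_trans unfolding L\<gamma>_def L\<beta>_def by blast
qed

lemma risk_rhs_eq:
  fixes b :: real
  assumes "b \<noteq> 0" "D \<noteq> 0" "N \<noteq> 0"
  shows "A * (a / b * (1 / D * x + 1 / D * y) + 1 / (N * b) * (1 / D * u + 1 / D * v))
    = A * (a * (N * (x + y)) + (u + v)) / (N * D * b)"
  using assms by (simp add: field_simps)

text \<open>The minimizer is no worse than the competitor of \<open>sparse_truth_objective\<close>.
  The summand 2 in \<open>A\<close> counts \<alpha> * N * S twice: once from the objective and once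
  from the deviation term ln M.\<close>

lemma lda_renyi_risk:
  fixes c \<delta>0 :: real
  assumes c: "c > 1" and \<delta>0: "\<delta>0 > 0"
  defines "A \<equiv> 2 + (c + 3 + \<bar>ln 4 + 2 * ln (2 / \<delta>0)\<bar> / ln 2) * (2 + 1 / (\<delta>0 * ln 2))"
  assumes \<alpha>: "0 < \<alpha>" "\<alpha> < 1" and DKVN: "D \<ge> 1" "K \<ge> 1" "V \<ge> 1" "N \<ge> 1"
    and truth: "sparse_truth \<delta>0 D K V \<theta>s e d"
    and vb: "vb_solution c \<alpha> D K V N \<theta>s qhat"
    and \<epsilon>\<gamma>: "\<And>j. j < D \<Longrightarrow> 0 < \<epsilon>\<gamma> j \<and> \<epsilon>\<gamma> j < 1" and \<epsilon>\<beta>: "\<And>k. k < K \<Longrightarrow> 0 < \<epsilon>\<beta> k \<and> \<epsilon>\<beta> k < 1"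
  shows "1 - (1 / \<alpha>) / (real N * (\<Sum>j<D. (\<epsilon>\<gamma> j)\<^sup>2) + real N * (\<Sum>k<K. (\<epsilon>\<beta> k)\<^sup>2))
    \<le> measure_pmf.prob (data_law D K V N \<theta>s)
        {w \<in> set_pmf (data_law D K V N \<theta>s). (\<integral>\<^sup>+ \<theta>. ennreal (1 / real D) *
                   renyi_div (obs_count D V) \<alpha> (obs_mass D K \<theta>) (obs_mass D K \<theta>s) \<partial>fst (qhat w))
                \<le> ennreal (A *
                    (\<alpha> / (1 - \<alpha>) *
                       (1 / real D * (\<Sum>j<D. (\<epsilon>\<gamma> j)\<^sup>2) + 1 / real D * (\<Sum>k<K. (\<epsilon>\<beta> k)\<^sup>2)) +
                     1 / (real N * (1 - \<alpha>)) *
                       (1 / real D * (\<Sum>j<D. real (e j) * ln (real K / \<epsilon>\<gamma> j)) +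
                        1 / real D * (\<Sum>k<K. real (d k) * ln (real V / \<epsilon>\<beta> k)))))}"
proof -
  define S where "S = (\<Sum>j<D. (\<epsilon>\<gamma> j)\<^sup>2) + (\<Sum>k<K. (\<epsilon>\<beta> k)\<^sup>2)"
  define L where "L = (\<Sum>j<D. real (e j) * ln (real K / \<epsilon>\<gamma> j)) + (\<Sum>k<K. real (d k) * ln (real V / \<epsilon>\<beta> k))"
  define A1 where "A1 = (c + 3 + \<bar>ln 4 + 2 * ln (2 / \<delta>0)\<bar> / ln 2) * (2 + 1 / (\<delta>0 * ln 2))"
  \<comment> \<open>With this threshold the deviation term \<open>ln M \<le> M\<close> is absorbed by the \<open>\<alpha> * N * S\<close> of the objective.\<close>
  define M where "M = \<alpha> * (real N * S)"
  have A1: "0 \<le> A1" using c \<delta>0 by (auto simp: A1_def intro!: mult_nonneg_nonneg add_nonneg_nonneg)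
  have \<theta>s: "simplex_param D K V \<theta>s" using truth by (auto simp: simplex_param_def sparse_truth_def)
  have "0 < (\<Sum>j<D. (\<epsilon>\<gamma> j)\<^sup>2)"
    using \<epsilon>\<gamma> DKVN by (intro sum_pos) (fastforce simp: lessThan_empty_iff)+
  then have S: "0 < S" unfolding S_def by (intro add_pos_nonneg sum_nonneg) auto
  then have M: "0 < M" using \<alpha> DKVN by (simp add: M_def)
  have L0: "0 \<le> L"
    unfolding L_def
  proof (intro add_nonneg_nonneg sum_nonneg mult_nonneg_nonneg)
    show "0 \<le> ln (real K / \<epsilon>\<gamma> j)" if "j \<in> {..<D}" for j
    proof -
      have "\<epsilon>\<gamma> j \<le> real K" "0 < \<epsilon>\<gamma> j" using \<epsilon>\<gamma>[of j] that DKVN by auto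
      then show ?thesis by (simp add: field_simps)
    qed
    show "0 \<le> ln (real V / \<epsilon>\<beta> k)" if "k \<in> {..<K}" for k
    proof -
      have "\<epsilon>\<beta> k \<le> real V" "0 < \<epsilon>\<beta> k" using \<epsilon>\<beta>[of k] that DKVN by auto
      then show ?thesis by (simp add: field_simps)
    qed
  qed auto
  define rhs where "rhs = A * (\<alpha> / (1 - \<alpha>) *
        (1 / real D * (\<Sum>j<D. (\<epsilon>\<gamma> j)\<^sup>2) + 1 / real D * (\<Sum>k<K. (\<epsilon>\<beta> k)\<^sup>2)) +
      1 / (real N * (1 - \<alpha>)) *
        (1 / real D * (\<Sum>j<D. real (e j) * ln (real K / \<epsilon>\<gamma> j)) +
         1 / real D * (\<Sum>k<K. real (d k) * ln (real V / \<epsilon>\<beta> k))))"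
  have rhs: "rhs = A * (\<alpha> * (real N * S) + L) / (real N * real D * (1 - \<alpha>))"
    unfolding rhs_def S_def L_def using DKVN \<alpha> by (intro risk_rhs_eq) auto
  have event: "(\<integral>\<^sup>+ \<theta>. ennreal (1 / real D) *
       renyi_div (obs_count D V) \<alpha> (obs_mass D K \<theta>) (obs_mass D K \<theta>s) \<partial>fst (qhat w)) \<le> ennreal rhs"
    if w: "w \<in> set_pmf (data_law D K V N \<theta>s)" and moment: "evidence_moment c \<alpha> D K V N \<theta>s w \<le> ennreal M" for w
  proof -
    have am: "is_arg_min (vb_objective c \<alpha> D K V N \<theta>s w) (\<lambda>q. q \<in> mean_field D K V N) (qhat w)"
      using vb w by (auto simp: vb_solution_def)
    define B where "B = real N * S + 1 / \<alpha> * (A1 * L)"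
    obtain q where q: "q \<in> mean_field D K V N" "vb_objective c \<alpha> D K V N \<theta>s w q \<le> ereal B"
      using sparse_truth_objective[OF c \<delta>0 \<alpha>(1) DKVN(2,3) truth w, where \<epsilon>\<gamma> = \<epsilon>\<gamma> and \<epsilon>\<beta> = \<epsilon>\<beta>, OF \<epsilon>\<gamma> \<epsilon>\<beta>]
      unfolding B_def S_def L_def A1_def by blast
    have mem: "(fst (qhat w), snd (qhat w)) \<in> mean_field D K V N"
      using am by (simp add: is_arg_min_def)
    have "vb_objective c \<alpha> D K V N \<theta>s w (qhat w) \<le> vb_objective c \<alpha> D K V N \<theta>s w q"
      using am q(1) unfolding is_arg_min_def by (meson not_le)
    then have obj: "vb_objective c \<alpha> D K V N \<theta>s w (fst (qhat w), snd (qhat w)) \<le> ereal B"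
      using q(2) by simp
    have "ln M \<le> M" using ln_le_minus_one[OF M] by simp
    then have "\<alpha> * B + ln M \<le> 2 * (\<alpha> * (real N * S)) + A1 * L"
      using \<alpha> by (simp add: B_def M_def algebra_simps)
    also have "\<dots> \<le> A * (\<alpha> * (real N * S) + L)"
    proof -
      have "A = 2 + A1" by (simp add: A_def A1_def)
      then show ?thesis using A1 L0 M by (simp add: algebra_simps M_def)
    qed
    finally have "(\<alpha> * B + ln M) / (real N * real D * (1 - \<alpha>)) \<le> rhs"
      unfolding rhs using \<alpha> by (intro divide_right_mono) auto
    then show ?thesis
      using order_trans[OF renyi_risk_bound[OF DKVN(2,3) \<alpha> DKVN(1,4) \<theta>s w mem obj moment M] ennreal_leI] by blast
  qed
  have "1 - (1 / \<alpha>) / (real N * (\<Sum>j<D. (\<epsilon>\<gamma> j)\<^sup>2) + real N * (\<Sum>k<K. (\<epsilon>\<beta> k)\<^sup>2)) = 1 - 1 / M"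
    by (simp add: M_def S_def distrib_left[symmetric])
  also have "\<dots> \<le> measure_pmf.prob (data_law D K V N \<theta>s)
     {w \<in> set_pmf (data_law D K V N \<theta>s). evidence_moment c \<alpha> D K V N \<theta>s w \<le> ennreal M}"
    by (rule prob_evidence_moment_le[OF DKVN(2,3) \<theta>s \<alpha> M])
  also have "\<dots> \<le> measure_pmf.prob (data_law D K V N \<theta>s)
     {w \<in> set_pmf (data_law D K V N \<theta>s). (\<integral>\<^sup>+ \<theta>. ennreal (1 / real D) *
       renyi_div (obs_count D V) \<alpha> (obs_mass D K \<theta>) (obs_mass D K \<theta>s) \<partial>fst (qhat w)) \<le> ennreal rhs}"
    using event by (intro measure_pmf.finite_measure_mono) auto
  finally show ?thesis unfolding rhs_def .
qed

text \<open>For \<alpha> \<le> 1/2 and s = sqrt (x * y), the geometric mean is s^(2 * \<alpha>) *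
  y^(1 - 2 * \<alpha>). AM-GM applied to s and y, instead of x and y, leaves the gap \<alpha> * (x +
  y - 2 * s), a squared difference of roots. The other half of the range follows by exchanging x and
  y.\<close>

lemma young_powr_refined:
  fixes x y :: real
  assumes x: "0 \<le> x" and y: "0 \<le> y" and \<alpha>: "0 < \<alpha>" "\<alpha> < 1"
  shows "min \<alpha> (1 - \<alpha>) * (x powr (1/2) - y powr (1/2))\<^sup>2 \<le> \<alpha> * x + (1 - \<alpha>) * y - x powr \<alpha> * y powr (1 - \<alpha>)"
proof -
  have half: "a * (u powr (1/2) - v powr (1/2))\<^sup>2 \<le> a * u + (1 - a) * v - u powr a * v powr (1 - a)"
    if a: "0 < a" "a \<le> 1/2" and u: "0 \<le> u" and v: "0 \<le> v" for a u v :: real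
  proof -
    define s where "s = u powr (1/2) * v powr (1/2)"
    have "s powr (2 * a) * v powr (1 - 2 * a) \<le> 2 * a * s + (1 - 2 * a) * v"
      using a v by (intro young_powr) (auto simp: s_def)
    moreover have "s powr (2 * a) * v powr (1 - 2 * a) = u powr a * v powr (1 - a)"
    proof (cases "v = 0")
      case False
      have "s powr (2 * a) * v powr (1 - 2 * a) = u powr a * (v powr a * v powr (1 - 2 * a))"
        using u v by (simp add: s_def powr_mult powr_powr)
      also have "v powr a * v powr (1 - 2 * a) = v powr (1 - a)" by (simp flip: powr_add)
      finally show ?thesis .
    qed simp
    moreover have sq: "(u powr (1/2) - v powr (1/2))\<^sup>2 = u + v - 2 * s"
    proof -
      have "(u powr (1/2))\<^sup>2 = u" "(v powr (1/2))\<^sup>2 = v"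
        using u v by (simp_all add: powr_half_sqrt)
      then show ?thesis by (simp add: s_def power2_diff)
    qed
    ultimately show ?thesis unfolding sq by (simp add: algebra_simps)
  qed
  show ?thesis
  proof (cases "\<alpha> \<le> 1/2")
    case True
    then show ?thesis using half[of \<alpha> x y] x y \<alpha> by (simp add: min_def)
  next
    case False
    then show ?thesis using half[of "1 - \<alpha>" y x] x y \<alpha>
      by (simp add: min_def power2_commute algebra_simps)
  qed
qed

text \<open>Summing the refined AM-GM bounds the weighted Hellinger term by 1 - I, where I is the
  affinity; then 1 - I \<le> - ln I. For affinity 0 the right side is infinite.\<close>

lemma hellinger_le_renyi:
  assumes \<theta>: "simplex_param D K V \<theta>" and \<theta>s: "simplex_param D K V \<theta>s" and \<alpha>: "0 < \<alpha>" "\<alpha> < 1"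
  shows "ennreal (min \<alpha> (1 - \<alpha>) * (hellinger (obs_count D V) (obs_mass D K \<theta>) (obs_mass D K \<theta>s))\<^sup>2)
    \<le> ennreal (1 - \<alpha>) * renyi_div (obs_count D V) \<alpha> (obs_mass D K \<theta>) (obs_mass D K \<theta>s)"
proof (cases "affinity \<alpha> D K V \<theta> \<theta>s = 0")
  case True
  then have "renyi_div (obs_count D V) \<alpha> (obs_mass D K \<theta>) (obs_mass D K \<theta>s) = \<infinity>"
    by (simp add: renyi_div_def affinity_eq_integral)
  then show ?thesis using \<alpha> by (simp add: ennreal_mult_top)
next
  case False
  define I where "I = affinity \<alpha> D K V \<theta> \<theta>s"
  have I: "0 < I" using False affinity_nonneg[of \<alpha> D K V \<theta> \<theta>s] by (simp add: I_def)
  define H where "H = (\<Sum>y\<in>words D V. (obs_mass D K \<theta> y powr (1/2) - obs_mass D K \<theta>s y powr (1/2))\<^sup>2)"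
  have H: "(hellinger (obs_count D V) (obs_mass D K \<theta>) (obs_mass D K \<theta>s))\<^sup>2 = H"
    unfolding hellinger_def obs_count_def H_def
    by (subst lebesgue_integral_count_space_finite) (auto intro: sum_nonneg)
  have "min \<alpha> (1 - \<alpha>) * H \<le> (\<Sum>y\<in>words D V. \<alpha> * obs_mass D K \<theta> y + (1 - \<alpha>) * obs_mass D K \<theta>s y
      - obs_mass D K \<theta> y powr \<alpha> * obs_mass D K \<theta>s y powr (1 - \<alpha>))"
    unfolding H_def sum_distrib_left
    using young_powr_refined[OF obs_mass_nonneg[OF \<theta>] obs_mass_nonneg[OF \<theta>s] \<alpha>] by (intro sum_mono) auto
  also have "\<dots> = 1 - I"
    using sum_obs_mass[OF \<theta>] sum_obs_mass[OF \<theta>s]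
    by (simp add: sum.distrib sum_subtractf I_def affinity_def flip: sum_distrib_left)
  also have "\<dots> \<le> - ln I" using ln_le_minus_one[OF I] by simp
  also have "\<dots> = (1 - \<alpha>) * (- ln I / (1 - \<alpha>))" using \<alpha> by simp
  finally have "ennreal (min \<alpha> (1 - \<alpha>) * H) \<le> ennreal ((1 - \<alpha>) * (- ln I / (1 - \<alpha>)))"
    by (rule ennreal_leI)
  then show ?thesis
    using renyi_div_eq[OF I[unfolded I_def] \<alpha>(2)] \<alpha> by (simp add: H I_def ennreal_mult'[symmetric])
qed

text \<open>All radii are set to \<epsilon> with \<epsilon>^2 = ln N / N. Then N times the sum of
  their squares is (D + K) * ln N, which drives the failure probability to 0, while ln (1 /
  \<epsilon>) \<le> ln N keeps the logarithms within those of the claim. N \<ge> 3 ensures ln N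
  \<ge> 1.\<close>

lemma lda_hellinger_risk:
  fixes c \<delta>0 :: real
  assumes c: "c > 1" and \<delta>0: "\<delta>0 > 0"
  defines "A \<equiv> 2 + (c + 3 + \<bar>ln 4 + 2 * ln (2 / \<delta>0)\<bar> / ln 2) * (2 + 1 / (\<delta>0 * ln 2))"
  assumes \<alpha>: "0 < \<alpha>" "\<alpha> < 1" and DKVN: "D \<ge> 1" "K \<ge> 1" "V \<ge> 1" "N \<ge> 3"
    and truth: "sparse_truth \<delta>0 D K V \<theta>s e d"
    and vb: "vb_solution c \<alpha> D K V N \<theta>s qhat"
  shows "1 - (1 / \<alpha>) / ln (real N) \<le> measure_pmf.prob (data_law D K V N \<theta>s)
     {w. sqrt (\<integral>\<theta>. 1 / real D * (hellinger (obs_count D V) (obs_mass D K \<theta>) (obs_mass D K \<theta>s))\<^sup>2 \<partial>fst (qhat w))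
       \<le> sqrt (2 * A) * sqrt ((\<Sum>j<D. real (e j)) / (real D * real N * min \<alpha> (1 - \<alpha>)) * ln (real D * real K * real N) +
           (\<Sum>k<K. real (d k)) / (real D * real N * min \<alpha> (1 - \<alpha>)) * ln (real K * real V * real N))}"
proof -
  define l where "l = ln (real N)"
  define \<epsilon> where "\<epsilon> = sqrt (l / real N)"
  define a where "a = min \<alpha> (1 - \<alpha>)"
  have a: "0 < a" using \<alpha> by (simp add: a_def)
  have N: "1 \<le> N" using DKVN by simp
  have l1: "1 \<le> l"
  proof -
    have "exp 1 \<le> real N" using exp_le DKVN by linarith
    then show ?thesis using DKVN by (simp add: l_def ln_ge_iff)
  qed
  have lN: "l < real N" using ln_less_self[of "real N"] DKVN by (simp add: l_def)
  have \<epsilon>: "0 < \<epsilon>" "\<epsilon> < 1" "\<epsilon>\<^sup>2 = l / real N"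
    using l1 lN DKVN by (auto simp: \<epsilon>_def)
  have ln_\<epsilon>: "- ln \<epsilon> \<le> l"
  proof -
    have "1 / real N \<le> \<epsilon>\<^sup>2" using l1 DKVN by (simp add: \<epsilon> divide_right_mono)
    then have "ln (1 / real N) \<le> ln (\<epsilon>\<^sup>2)" using DKVN \<epsilon>(1) by (subst ln_le_cancel_iff) auto
    then have "- l \<le> 2 * ln \<epsilon>" using DKVN \<epsilon>(1) by (simp add: l_def ln_div ln_realpow)
    then show ?thesis using l1 by simp
  qed
  have \<theta>s: "simplex_param D K V \<theta>s" using truth by (auto simp: simplex_param_def sparse_truth_def)
  have e1: "1 \<le> e j" if "j < D" for j
    using truth that by (intro m_sparse_ge_1[of "fst \<theta>s j" K]) (auto simp: sparse_truth_def)
  have d1: "1 \<le> d k" if "k < K" for k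
    using truth that by (intro m_sparse_ge_1[of "snd \<theta>s k" V]) (auto simp: sparse_truth_def)
  define E where "E = (\<Sum>j<D. real (e j))"
  define F where "F = (\<Sum>k<K. real (d k))"
  define LE where "LE = ln (real D * real K * real N)"
  define LF where "LF = ln (real K * real V * real N)"
  have DE: "real D \<le> E"
    using sum_mono[of "{..<D}" "\<lambda>_. 1" "\<lambda>j. real (e j)"] e1 by (fastforce simp: E_def)
  have KF: "real K \<le> F"
    using sum_mono[of "{..<K}" "\<lambda>_. 1" "\<lambda>k. real (d k)"] d1 by (fastforce simp: F_def)
  have LE: "LE = ln (real D) + ln (real K) + l" and LF: "LF = ln (real K) + ln (real V) + l"
    using DKVN by (simp_all add: LE_def LF_def l_def ln_mult)
  have ln0: "0 \<le> ln (real D)" "0 \<le> ln (real K)" "0 \<le> ln (real V)" using DKVN by auto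
  have lLE: "l \<le> LE" "ln (real K / \<epsilon>) \<le> LE" and lLF: "l \<le> LF" "ln (real V / \<epsilon>) \<le> LF"
  proof -
    have "ln (real K / \<epsilon>) = ln (real K) - ln \<epsilon>" "ln (real V / \<epsilon>) = ln (real V) - ln \<epsilon>"
      using \<epsilon>(1) DKVN by (simp_all add: ln_div)
    then show "l \<le> LE" "ln (real K / \<epsilon>) \<le> LE" "l \<le> LF" "ln (real V / \<epsilon>) \<le> LF"
      using ln0 ln_\<epsilon> unfolding LE LF by linarith+
  qed
  have L0: "0 \<le> LE" "0 \<le> LF" using lLE lLF l1 by auto
  have A: "0 \<le> A" using c \<delta>0 by (auto simp: A_def intro!: mult_nonneg_nonneg add_nonneg_nonneg)
  define T where "T = E / (real D * real N * a) * LE + F / (real D * real N * a) * LF"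
  define rhs where "rhs = A * (\<alpha> / (1 - \<alpha>) *
        (1 / real D * (\<Sum>j<D. \<epsilon>\<^sup>2) + 1 / real D * (\<Sum>k<K. \<epsilon>\<^sup>2)) +
      1 / (real N * (1 - \<alpha>)) *
        (1 / real D * (\<Sum>j<D. real (e j) * ln (real K / \<epsilon>)) +
         1 / real D * (\<Sum>k<K. real (d k) * ln (real V / \<epsilon>))))"
  have rhs: "rhs = A * (\<alpha> * (real N * ((\<Sum>j<D. \<epsilon>\<^sup>2) + (\<Sum>k<K. \<epsilon>\<^sup>2))) +
      ((\<Sum>j<D. real (e j) * ln (real K / \<epsilon>)) + (\<Sum>k<K. real (d k) * ln (real V / \<epsilon>)))) / (real N * real D * (1 - \<alpha>))"
    unfolding rhs_def using DKVN \<alpha> by (intro risk_rhs_eq) auto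
  have "real N * ((\<Sum>j<D. \<epsilon>\<^sup>2) + (\<Sum>k<K. \<epsilon>\<^sup>2)) = real D * l + real K * l"
    using DKVN by (simp add: \<epsilon>(3) field_simps)
  then have "(1 - \<alpha>) / a * rhs = A / (real N * real D * a) *
      (\<alpha> * (real D * l + real K * l) + (E * ln (real K / \<epsilon>) + F * ln (real V / \<epsilon>)))"
    unfolding rhs E_def F_def sum_distrib_right using \<alpha> by simp
  also have "\<dots> \<le> A / (real N * real D * a) * (2 * (E * LE + F * LF))"
  proof (rule mult_left_mono)
    \<comment> \<open>Every sparsity level is at least 1, so D \<le> E and K \<le> F: the squared
      radii cost no more than the logarithmic terms, whence the factor 2.\<close>
    have "\<alpha> * (real D * l + real K * l) \<le> 1 * (real D * l + real K * l)"
      using \<alpha> l1 by (intro mult_right_mono) auto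
    also have "\<dots> \<le> E * LE + F * LF"
      using DE KF lLE lLF l1 L0 by (simp only: mult_1) (intro add_mono mult_mono; simp)
    finally have "\<alpha> * (real D * l + real K * l) \<le> E * LE + F * LF" .
    moreover have "E * ln (real K / \<epsilon>) \<le> E * LE" "F * ln (real V / \<epsilon>) \<le> F * LF"
      using lLE lLF by (auto simp: E_def F_def intro!: mult_left_mono sum_nonneg)
    ultimately show "\<alpha> * (real D * l + real K * l) + (E * ln (real K / \<epsilon>) + F * ln (real V / \<epsilon>))
       \<le> 2 * (E * LE + F * LF)" by simp
    show "0 \<le> A / (real N * real D * a)" using A a by simp
  qed
  also have "\<dots> = 2 * A * T" using DKVN a by (simp add: T_def field_simps)
  finally have rhs_le: "(1 - \<alpha>) / a * rhs \<le> 2 * A * T" .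
  have T0: "0 \<le> T"
    using L0 a by (auto simp: T_def E_def F_def intro!: add_nonneg_nonneg mult_nonneg_nonneg divide_nonneg_nonneg sum_nonneg)
  let ?R = "\<lambda>\<theta>. ennreal (1 / real D) * renyi_div (obs_count D V) \<alpha> (obs_mass D K \<theta>) (obs_mass D K \<theta>s)"
  let ?h = "\<lambda>\<theta>. 1 / real D * (hellinger (obs_count D V) (obs_mass D K \<theta>) (obs_mass D K \<theta>s))\<^sup>2"
  have event: "sqrt (\<integral>\<theta>. ?h \<theta> \<partial>fst (qhat w)) \<le> sqrt (2 * A) * sqrt T"
    if w: "w \<in> set_pmf (data_law D K V N \<theta>s)" and R: "(\<integral>\<^sup>+\<theta>. ?R \<theta> \<partial>fst (qhat w)) \<le> ennreal rhs" for w
  proof -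
    have "(fst (qhat w), snd (qhat w)) \<in> mean_field D K V N"
      using vb w by (auto simp: vb_solution_def is_arg_min_def)
    note q = mean_field_props[OF this]
    have meas: "?R \<in> borel_measurable (fst (qhat w))"
    proof -
      have "?R \<in> borel_measurable (param_space D K V)"
        unfolding renyi_div_def affinity_eq_integral Let_def by measurable
      then show ?thesis using measurable_cong_sets[OF q(2) refl] by blast
    qed
    have "(\<integral>\<^sup>+\<theta>. ennreal (?h \<theta>) \<partial>fst (qhat w)) \<le> (\<integral>\<^sup>+\<theta>. ennreal ((1 - \<alpha>) / a) * ?R \<theta> \<partial>fst (qhat w))"
    proof (rule nn_integral_mono_AE, use q(3) in eventually_elim)
      case (elim \<theta>)
      have "ennreal (?h \<theta>) = ennreal (1 / (real D * a)) *
          ennreal (a * (hellinger (obs_count D V) (obs_mass D K \<theta>) (obs_mass D K \<theta>s))\<^sup>2)"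
        using a by (simp add: ennreal_mult'[symmetric])
      also have "\<dots> \<le> ennreal (1 / (real D * a)) *
          (ennreal (1 - \<alpha>) * renyi_div (obs_count D V) \<alpha> (obs_mass D K \<theta>) (obs_mass D K \<theta>s))"
        using hellinger_le_renyi[OF elim \<theta>s \<alpha>] unfolding a_def by (intro mult_left_mono) auto
      also have "\<dots> = ennreal (1 / (real D * a) * (1 - \<alpha>)) *
          renyi_div (obs_count D V) \<alpha> (obs_mass D K \<theta>) (obs_mass D K \<theta>s)"
        using a \<alpha> by (subst ennreal_mult) (auto simp: mult.assoc)
      also have "1 / (real D * a) * (1 - \<alpha>) = (1 - \<alpha>) / a * (1 / real D)" by simp
      also have "ennreal ((1 - \<alpha>) / a * (1 / real D)) * renyi_div (obs_count D V) \<alpha> (obs_mass D K \<theta>) (obs_mass D K \<theta>s)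
          = ennreal ((1 - \<alpha>) / a) * ?R \<theta>"
        using a \<alpha> by (subst ennreal_mult) (auto simp: mult.assoc)
      finally show ?case .
    qed
    also have "\<dots> = ennreal ((1 - \<alpha>) / a) * (\<integral>\<^sup>+\<theta>. ?R \<theta> \<partial>fst (qhat w))"
      by (rule nn_integral_cmult[OF meas])
    also have "\<dots> \<le> ennreal ((1 - \<alpha>) / a) * ennreal rhs" by (intro mult_left_mono R) simp
    also have "\<dots> = ennreal ((1 - \<alpha>) / a * rhs)"
      using a \<alpha> by (intro ennreal_mult'[symmetric]) simp
    also have "\<dots> \<le> ennreal (2 * A * T)" using rhs_le by (rule ennreal_leI)
    \<comment> \<open>The bound on the nonnegative integral passes to the Bochner integral used in
      the claim.\<close>
    finally have "(\<integral>\<theta>. ?h \<theta> \<partial>fst (qhat w)) \<le> 2 * A * T"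
      using A T0 by (intro integral_real_bounded) auto
    then show ?thesis by (simp flip: real_sqrt_mult)
  qed
  have "1 - (1 / \<alpha>) / l \<le> 1 - (1 / \<alpha>) / (real N * (\<Sum>j<D. \<epsilon>\<^sup>2) + real N * (\<Sum>k<K. \<epsilon>\<^sup>2))"
  proof -
    have "real N * (\<Sum>j<D. \<epsilon>\<^sup>2) + real N * (\<Sum>k<K. \<epsilon>\<^sup>2) = (real D + real K) * l"
      using DKVN by (simp add: \<epsilon>(3) field_simps)
    moreover have "1 * l \<le> (real D + real K) * l" using DKVN l1 by (intro mult_right_mono) auto
    ultimately show ?thesis using l1 \<alpha> by (auto intro!: divide_left_mono)
  qed
  also have "\<dots> \<le> measure_pmf.prob (data_law D K V N \<theta>s)
     {w \<in> set_pmf (data_law D K V N \<theta>s). (\<integral>\<^sup>+\<theta>. ?R \<theta> \<partial>fst (qhat w)) \<le> ennreal rhs}"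
    using lda_renyi_risk[OF c \<delta>0 \<alpha> DKVN(1-3) N truth vb, where \<epsilon>\<gamma> = "\<lambda>_. \<epsilon>" and \<epsilon>\<beta> = "\<lambda>_. \<epsilon>"] \<epsilon>
    unfolding rhs_def A_def by simp
  also have "\<dots> \<le> measure_pmf.prob (data_law D K V N \<theta>s)
     {w. sqrt (\<integral>\<theta>. ?h \<theta> \<partial>fst (qhat w)) \<le> sqrt (2 * A) * sqrt T}"
    using event by (intro measure_pmf.finite_measure_mono) auto
  finally show ?thesis unfolding T_def E_def F_def LE_def LF_def a_def l_def .
qed

theorem corollary4p5:
  fixes c \<delta>0 :: real
  assumes "c > 1" and "\<delta>0 > 0"
  shows
    "(\<exists>A>0. \<forall>\<alpha>\<in>{0<..<1}. \<exists>C>0.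
        \<forall>(D::nat) (K::nat) (V::nat) (N::nat) (\<theta>s::lda_param) (e::nat \<Rightarrow> nat) (d::nat \<Rightarrow> nat)
         qhat (\<epsilon>\<gamma>::nat \<Rightarrow> real) (\<epsilon>\<beta>::nat \<Rightarrow> real).
          D \<ge> 1 \<longrightarrow> K \<ge> 1 \<longrightarrow> V \<ge> 1 \<longrightarrow> N \<ge> 1 \<longrightarrow>
          sparse_truth \<delta>0 D K V \<theta>s e d \<longrightarrow>
          vb_solution c \<alpha> D K V N \<theta>s qhat \<longrightarrow>
          (\<forall>j<D. 0 < \<epsilon>\<gamma> j \<and> \<epsilon>\<gamma> j < 1) \<longrightarrow> (\<forall>k<K. 0 < \<epsilon>\<beta> k \<and> \<epsilon>\<beta> k < 1) \<longrightarrow>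
          measure_pmf.prob (data_law D K V N \<theta>s)
            {w. (\<integral>\<^sup>+ \<theta>. ennreal (1 / real D) *
                   renyi_div (obs_count D V) \<alpha> (obs_mass D K \<theta>) (obs_mass D K \<theta>s) \<partial>fst (qhat w))
                \<le> ennreal (A *
                    (\<alpha> / (1 - \<alpha>) *
                       (1 / real D * (\<Sum>j<D. (\<epsilon>\<gamma> j)\<^sup>2) + 1 / real D * (\<Sum>k<K. (\<epsilon>\<beta> k)\<^sup>2)) +
                     1 / (real N * (1 - \<alpha>)) *
                       (1 / real D * (\<Sum>j<D. real (e j) * ln (real K / \<epsilon>\<gamma> j)) +
                        1 / real D * (\<Sum>k<K. real (d k) * ln (real V / \<epsilon>\<beta> k)))))}
          \<ge> 1 - C / (real N * (\<Sum>j<D. (\<epsilon>\<gamma> j)\<^sup>2) + real N * (\<Sum>k<K. (\<epsilon>\<beta> k)\<^sup>2)))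
     \<and>
     (\<exists>A>0. \<forall>\<alpha>\<in>{0<..<1}.
        \<forall>(D::nat \<Rightarrow> nat) (K::nat \<Rightarrow> nat) (V::nat \<Rightarrow> nat) (\<theta>s::nat \<Rightarrow> lda_param)
         (e::nat \<Rightarrow> nat \<Rightarrow> nat) (d::nat \<Rightarrow> nat \<Rightarrow> nat) qhat.
          (\<forall>N\<ge>1. D N \<ge> 1 \<and> K N \<ge> 1 \<and> V N \<ge> 1 \<and>
             sparse_truth \<delta>0 (D N) (K N) (V N) (\<theta>s N) (e N) (d N) \<and>
             vb_solution c \<alpha> (D N) (K N) (V N) N (\<theta>s N) (qhat N)) \<longrightarrow>
          (\<lambda>N. ((\<Sum>j<D N. real (e N j)) + (\<Sum>k<K N. real (d N k))) / (real (D N) * real N))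
            \<longlonglongrightarrow> 0 \<longrightarrow>
          (\<lambda>N. measure_pmf.prob (data_law (D N) (K N) (V N) N (\<theta>s N))
             {w. sqrt (\<integral>\<theta>. 1 / real (D N) *
                     (hellinger (obs_count (D N) (V N)) (obs_mass (D N) (K N) \<theta>)
                        (obs_mass (D N) (K N) (\<theta>s N)))\<^sup>2 \<partial>fst (qhat N w))
                 \<le> A * sqrt
                     ((\<Sum>j<D N. real (e N j)) / (real (D N) * real N * min \<alpha> (1 - \<alpha>)) *
                        ln (real (D N) * real (K N) * real N) +
                      (\<Sum>k<K N. real (d N k)) / (real (D N) * real N * min \<alpha> (1 - \<alpha>)) *
                        ln (real (K N) * real (V N) * real N))})
            \<longlonglongrightarrow> 1)"
proof -
  define A where "A = 2 + (c + 3 + \<bar>ln 4 + 2 * ln (2 / \<delta>0)\<bar> / ln 2) * (2 + 1 / (\<delta>0 * ln 2))"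
  have A: "0 < A"
    using assms by (auto simp: A_def intro!: add_pos_nonneg mult_nonneg_nonneg add_nonneg_nonneg)
  show ?thesis
  proof (rule conjI, goal_cases)
    case 1
    show ?case
    proof (rule exI[of _ A], intro conjI ballI A, goal_cases)
      case (1 \<alpha>)
      then have \<alpha>: "0 < \<alpha>" "\<alpha> < 1" by auto
      show ?case
      \<comment> \<open>Markov's inequality at the threshold \<alpha> * N * S leaves the failure
        probability (1 / \<alpha>) / (N * S).\<close>
      proof (rule exI[of _ "1 / \<alpha>"], intro conjI allI impI, goal_cases)
        case 1
        show ?case using \<alpha> by simp
      next
        case (2 D K V N \<theta>s e d qhat \<epsilon>\<gamma> \<epsilon>\<beta>)
        note risk = lda_renyi_risk[OF assms \<alpha> 2(1-6), folded A_def,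
            where \<epsilon>\<gamma> = \<epsilon>\<gamma> and \<epsilon>\<beta> = \<epsilon>\<beta>, OF 2(7)[rule_format] 2(8)[rule_format]]
        show ?case
          by (rule order_trans[OF risk]) (auto intro!: measure_pmf.finite_measure_mono)
      qed
    qed
  next
    case 2
    show ?case
    proof (rule exI[of _ "sqrt (2 * A)"], intro conjI ballI allI impI, goal_cases)
      case 1
      show ?case using A by simp
    next
      case (2 \<alpha> D K V \<theta>s e d qhat)
      show ?case
      \<comment> \<open>The constant \<open>sqrt (2 * A)\<close> is free of \<alpha>; only the rate
        (1 / \<alpha>) / ln N of the failure probability involves it, and this vanishes for each
        fixed \<alpha>.\<close>
      proof (rule tendsto_sandwich[where f = "\<lambda>N. 1 - (1 / \<alpha>) / ln (real N)" and h = "\<lambda>_. 1"], goal_cases)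
        case 1
        show ?case
        proof (rule eventually_sequentiallyI[of 3], goal_cases)
          case (1 N)
          then show ?case
            unfolding A_def using 2(2)[rule_format, of N] 2(1)
            by (intro lda_hellinger_risk[OF assms]) auto
        qed
      next
        case 3
        have "filterlim (\<lambda>N. ln (real N)) at_top sequentially"
          by (rule filterlim_compose[OF ln_at_top filterlim_real_sequentially])
        then have "(\<lambda>N. (1 / \<alpha>) / ln (real N)) \<longlonglongrightarrow> 0"
          by (rule real_tendsto_divide_at_top[OF tendsto_const])
        from tendsto_diff[OF tendsto_const[of 1] this] show ?case by simp
      qed simp_all
    qed
  qed
qed

end
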